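(* Let $(M,g)$ be a Kasner-type spacetime. Assume that $\mathrm P$ is a linear wave operator on $\mathbb C^m$-valued functions, for some $m\in\mathbb N$, such that $[\mathrm T,t^2\mathrm P]=0$. Then there exists a discrete set $\sigma_1,\sigma_2,\dots\in\mathbb C$ such that the following holds: (1) For every $\alpha>0$, the set of all $\sigma_j$ satisfying $\mathrm{Im}(\sigma_j)\ge-\alpha$ is finite. (2) If $u\in C^\infty(M;\mathbb C^m)$ is a non-trivial solution to $$\mathrm Pu=0,\qquad(\mathrm T+i\sigma)^ku=0\qquad( * )$$ for a $\sigma\in\mathbb C$ and $k\in\mathbb N$, then $\sigma=\sigma_j$ for some $j\in\mathbb N$. (3) For any fixed $\sigma\in\mathbb C$, the vector space of $u\in C^\infty(M;\mathbb C^m)$ solving $( * )$ for some $k\in\mathbb N$ is finite dimensional.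
   Context: Kasner-type spacetime: for $n\ge1$, $M=(0,\infty)_t\times\mathbb R^n_x$, $g=-\mathrm dt^2+\sum_{j=1}^nt^{2p_j}\mathrm dx_j^2$, with $p_1,\dots,p_n\in\mathbb R$ and $p_j<1$ for all $j$. $\mathrm T:=-t\partial_t-\sum_{j=1}^n(1-p_j)x_j\partial_{x_j}$, acting componentwise on $\mathbb C^m$-valued functions. A linear wave operator on $\mathbb C^m$-valued functions is a linear second-order $m\times m$ system of differential operators on $M$ with smooth coefficients whose principal symbol is $g^{-1}(\xi,\xi)\,\mathrm{id}$ (so its leading part is $\partial_t^2-\sum_jt^{-2p_j}\partial_{x_j}^2$ times the identity). *)

theory Defs
  imports "HOL-Analysis.Analysis" "HOL-Library.Function_Algebras"
begin

text \<open>Smooth (that is, \<open>C\<^sup>\<infinity>\<close>) functions. The definition is meant for open sets \<open>S\<close>: all derivatives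
  are two-sided derivatives in the ambient Euclidean space.\<close>

fun Ck_on :: "nat \<Rightarrow> 'a::euclidean_space set \<Rightarrow> ('a \<Rightarrow> 'b::real_normed_vector) \<Rightarrow> bool" where
  "Ck_on 0 S f \<longleftrightarrow> continuous_on S f"
| "Ck_on (Suc k) S f \<longleftrightarrow>
     (\<forall>x\<in>S. f differentiable (at x)) \<and> (\<forall>v. Ck_on k S (\<lambda>x. frechet_derivative f (at x) v))"

definition smooth_on :: "'a::euclidean_space set \<Rightarrow> ('a \<Rightarrow> 'b::real_normed_vector) \<Rightarrow> bool" where
  "smooth_on S f \<longleftrightarrow> (\<forall>k. Ck_on k S f)"

text \<open>Spacetime points are pairs \<open>(t, x)\<close>. Coordinate indices are elements of \<open>'n option\<close>, where
  \<open>None\<close> stands for \<open>t\<close> and \<open>Some j\<close> for \<open>x\<^sub>j\<close>. A function on the spacetime is represented by a total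
  function of which only the values on \<open>kasner_space\<close> matter.\<close>

definition kasner_space :: "(real \<times> (real^'n)) set" where
  "kasner_space = {0<..} \<times> UNIV"

definition coord_vec :: "'n option \<Rightarrow> real \<times> (real^'n)" where
  "coord_vec \<mu> = (case \<mu> of None \<Rightarrow> (1, 0) | Some j \<Rightarrow> (0, axis j 1))"

definition partial :: "'n option \<Rightarrow> (real \<times> (real^'n) \<Rightarrow> 'b::real_normed_vector) \<Rightarrow> real \<times> (real^'n) \<Rightarrow> 'b" where
  "partial \<mu> u z = frechet_derivative u (at z) (coord_vec \<mu>)"

definition kasner_metric :: "real^'n \<Rightarrow> real \<times> (real^'n) \<Rightarrow> real^('n option)^('n option)" where
  "kasner_metric p z = (\<chi> \<mu> \<nu>. if \<mu> = \<nu>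
     then (case \<mu> of None \<Rightarrow> - 1 | Some j \<Rightarrow> fst z powr (2 * p $ j)) else 0)"

definition dual_metric :: "real^'n \<Rightarrow> real \<times> (real^'n) \<Rightarrow> real^('n option) \<Rightarrow> real^('n option) \<Rightarrow> real" where
  "dual_metric p z \<xi> \<eta> = \<xi> \<bullet> (matrix_inv (kasner_metric p z) *v \<eta>)"

type_synonym ('n, 'm) field_op =
  "(real \<times> (real^'n) \<Rightarrow> complex^'m) \<Rightarrow> (real \<times> (real^'n) \<Rightarrow> complex^'m)"

text \<open>The principal symbol of a second-order operator with top-order part
  \<open>\<Sum>\<mu> \<nu>. A \<mu> \<nu> \<partial>\<^sub>\<mu> \<partial>\<^sub>\<nu>\<close>, with the convention that \<open>\<partial>\<^sub>\<mu>\<close> is replaced by \<open>\<i> \<xi>\<^sub>\<mu>\<close>; hence the sign.\<close>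

definition principal_symbol2 ::
    "('n option \<Rightarrow> 'n option \<Rightarrow> real \<times> (real^'n) \<Rightarrow> complex^'m^'m)
      \<Rightarrow> real \<times> (real^'n) \<Rightarrow> real^('n option) \<Rightarrow> complex^'m^'m" where
  "principal_symbol2 A z \<xi> = (\<Sum>\<mu>\<in>UNIV. \<Sum>\<nu>\<in>UNIV. (- (\<xi> $ \<mu> * \<xi> $ \<nu>)) *\<^sub>R A \<mu> \<nu> z)"

definition linear_wave_operator :: "real^'n \<Rightarrow> ('n::finite, 'm::finite) field_op \<Rightarrow> bool" where
  "linear_wave_operator p P \<longleftrightarrow>
     (\<exists>(A :: 'n option \<Rightarrow> 'n option \<Rightarrow> real \<times> (real^'n) \<Rightarrow> complex^'m^'m)
       (B :: 'n option \<Rightarrow> real \<times> (real^'n) \<Rightarrow> complex^'m^'m)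
       (C :: real \<times> (real^'n) \<Rightarrow> complex^'m^'m).
        (\<forall>\<mu> \<nu>. smooth_on kasner_space (A \<mu> \<nu>)) \<and>
        (\<forall>\<mu>. smooth_on kasner_space (B \<mu>)) \<and>
        smooth_on kasner_space C \<and>
        (\<forall>z\<in>kasner_space. \<forall>\<xi>. principal_symbol2 A z \<xi> = dual_metric p z \<xi> \<xi> *\<^sub>R mat 1) \<and>
        (\<forall>u. smooth_on kasner_space u \<longrightarrow> (\<forall>z\<in>kasner_space.
           P u z = (\<Sum>\<mu>\<in>UNIV. \<Sum>\<nu>\<in>UNIV. A \<mu> \<nu> z *v partial \<mu> (partial \<nu> u) z)
                   + (\<Sum>\<mu>\<in>UNIV. B \<mu> z *v partial \<mu> u z) + C z *v u z)))"

definition scaling_field :: "real^'n \<Rightarrow> ('n::finite, 'm::finite) field_op" where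
  "scaling_field p u z =
     - (fst z *\<^sub>R partial None u z)
     - (\<Sum>j\<in>UNIV. ((1 - p $ j) * snd z $ j) *\<^sub>R partial (Some j) u z)"

definition scaling_shift :: "real^'n \<Rightarrow> complex \<Rightarrow> ('n::finite, 'm::finite) field_op" where
  "scaling_shift p \<sigma> u z = scaling_field p u z + (\<i> * \<sigma>) *s u z"

definition t_squared :: "('n::finite, 'm::finite) field_op \<Rightarrow> ('n::finite, 'm::finite) field_op" where
  "t_squared P u z = (fst z)\<^sup>2 *\<^sub>R P u z"

definition op_commutator :: "('n::finite, 'm::finite) field_op \<Rightarrow> ('n::finite, 'm::finite) field_op \<Rightarrow> ('n::finite, 'm::finite) field_op" where
  "op_commutator X Y u z = X (Y u) z - Y (X u) z"

definition mode_solution ::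
    "real^'n \<Rightarrow> ('n::finite, 'm::finite) field_op \<Rightarrow> complex \<Rightarrow> nat \<Rightarrow> (real \<times> (real^'n) \<Rightarrow> complex^'m) \<Rightarrow> bool" where
  "mode_solution p P \<sigma> k u \<longleftrightarrow>
     smooth_on kasner_space u \<and>
     (\<forall>z\<in>kasner_space. P u z = 0) \<and>
     (\<forall>z\<in>kasner_space. (scaling_shift p \<sigma> ^^ k) u z = 0)"

text \<open>The space of all solutions for some \<open>k\<close>. Each function on \<open>kasner_space\<close> is represented by its
  extension by zero, so that distinct elements are distinct functions on \<open>kasner_space\<close>.\<close>

definition mode_space ::
    "real^'n \<Rightarrow> ('n::finite, 'm::finite) field_op \<Rightarrow> complex \<Rightarrow> (real \<times> (real^'n) \<Rightarrow> complex^'m) set" where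
  "mode_space p P \<sigma> =
     {u. (\<forall>z. z \<notin> kasner_space \<longrightarrow> u z = 0) \<and> (\<exists>k. mode_solution p P \<sigma> k u)}"

definition cscale_fun :: "complex \<Rightarrow> ('a \<Rightarrow> complex^'m) \<Rightarrow> ('a \<Rightarrow> complex^'m)" where
  "cscale_fun c f = (\<lambda>z. c *s f z)"

global_interpretation cfun: vector_space cscale_fun
  by unfold_locales
    (auto simp: cscale_fun_def fun_eq_iff plus_fun_def vec_eq_iff algebra_simps)

definition finite_dim_cspace :: "('a \<Rightarrow> complex^'m) set \<Rightarrow> bool" where
  "finite_dim_cspace V \<longleftrightarrow> cfun.subspace V \<and> (\<exists>B. finite B \<and> V \<subseteq> cfun.span B)"

end

theory Submission
  imports Defs
begin

text \<open>
  Write \<open>q\<^sub>j = 1 - p\<^sub>j > 0\<close>. The scaling field \<open>T\<close> generates the flow \<open>(t, x) \<mapsto> (e\<^sup>-\<^sup>\<tau> t, e\<^sup>-\<^sup>q\<^sup>\<tau> x)\<close>, and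
  in the coordinates \<open>\<tau> = - ln t\<close> and \<open>y\<^sub>j = x\<^sub>j / t^q\<^sub>j\<close> the equation \<open>P u = 0\<close> becomes autonomous: a mode
  is a generalized eigenfunction of the generator of an evolution in \<open>\<tau>\<close>. Everything
  can be read off from the slice \<open>t = 1\<close>, where the metric is Minkowski, because \<open>T\<close> maps solutions to
  solutions.

  In terms of the jet \<open>U = (\<partial>\<^sub>t u, u, \<partial>\<^sub>1 u, \<dots>, \<partial>\<^sub>n u)\<close> on the slice, \<open>T\<close> acts on solutions as a symmetric
  hyperbolic operator \<open>\<Sum>\<^sub>k S\<^sub>k \<partial>\<^sub>k U - \<Sum>\<^sub>k q\<^sub>k y\<^sub>k \<partial>\<^sub>k U + M U\<close> (\<open>data_generator\<close>). Three features of it carry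
  the proof. First, for \<open>\<bar>y\<^sub>k\<bar> > 1 / q\<^sub>k\<close> the drift is faster than light, so the faces of a large cube are
  spacelike and outgoing, and energy is estimated on the cube without boundary terms
  (\<open>weighted_energy_inequality\<close>). Second, the drift expands, so that each derivative gains damping at rate
  \<open>q\<^sub>k\<close>; in a Sobolev space of high order \<open>N\<close>, the operator is dissipative with any prescribed rate,
  modulo terms with fewer derivatives (\<open>damped_energy_inequality\<close>). Third, these terms are relatively
  compact, which is made quantitative by a Poincare inequality on small boxes
  (\<open>approximate_by_cell_means\<close>).

  The finiteness statement is then a comparison of traces. Suppose that \<open>v\<^sub>1, \<dots>, v\<^sub>d\<close> are orthonormal in
  the Sobolev inner product and that \<open>T\<close> is triangular on their span with eigenvalues of real part at
  least \<open>- \<alpha>\<close>. Summing \<open>\<langle>T v\<^sub>i, v\<^sub>i\<rangle>\<close> gives at least \<open>- \<alpha> d\<close>, whereas the dissipative estimate with rate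
  \<open>\<alpha> + 1\<close> gives at most \<open>- (\<alpha> + 1) d + d / 2\<close> plus a constant. Hence \<open>d\<close> is bounded
  (\<open>dimension_bound\<close>). A maximal family of this kind contains all modes with \<open>Im \<sigma> \<ge> - \<alpha>\<close> in its span
  (\<open>maximal_flag\<close>), which yields finite dimensionality and the finiteness of the set of such \<open>\<sigma>\<close>
  together. Discreteness follows, because every bounded set lies in such a half-plane.

  The inner product only sees the cube. That no mode is lost is a matter of unique continuation: an
  eigenfunction whose jet vanishes on the cube vanishes on the whole slice, because outside the cube the
  operator is hyperbolic in the outward direction (\<open>unique_continuation\<close>), and then on the spacetime, by
  transport along \<open>T\<close> (\<open>eigenfunction_vanishes\<close>).
\<close>

section \<open>Calculus of smooth functions\<close>

lemma frechet_derivative_cong_open: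
  assumes "open S" "x \<in> S" "\<And>y. y \<in> S \<Longrightarrow> f y = g y"
  shows "frechet_derivative f (at x) = frechet_derivative g (at x)"
    and "f differentiable (at x) \<longleftrightarrow> g differentiable (at x)"
proof -
  have "(f has_derivative f') (at x) \<longleftrightarrow> (g has_derivative f') (at x)" for f'
    using assms has_derivative_transform_within_open[of f f' x UNIV S g]
      has_derivative_transform_within_open[of g f' x UNIV S f] by auto
  then show "frechet_derivative f (at x) = frechet_derivative g (at x)"
    and "f differentiable (at x) \<longleftrightarrow> g differentiable (at x)"
    by (auto simp: frechet_derivative_def differentiable_def)
qed

lemma Ck_on_cong:
  assumes "open S" "\<And>x. x \<in> S \<Longrightarrow> f x = g x"
  shows "Ck_on k S f \<longleftrightarrow> Ck_on k S g"
  using assms(2)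
proof (induction k arbitrary: f g)
  case 0
  then show ?case by (simp cong: continuous_on_cong)
next
  case (Suc k)
  show ?case
    using frechet_derivative_cong_open[OF assms(1) _ Suc.prems]
      Suc.IH[of "\<lambda>x. frechet_derivative f (at x) v" "\<lambda>x. frechet_derivative g (at x) v" for v]
    by auto
qed

lemma smooth_on_cong:
  assumes "open S" "\<And>x. x \<in> S \<Longrightarrow> f x = g x"
  shows "smooth_on S f \<longleftrightarrow> smooth_on S g"
  using Ck_on_cong[OF assms] by (auto simp: smooth_on_def)

lemma Ck_on_SucI:
  assumes "open S" "\<And>x. x \<in> S \<Longrightarrow> (f has_derivative f' x) (at x)"
    "\<And>v. Ck_on k S (\<lambda>x. f' x v)"
  shows "Ck_on (Suc k) S f"
proof -
  have "frechet_derivative f (at x) = f' x" if "x \<in> S" for x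
    using assms(2)[OF that] frechet_derivative_at by metis
  then have "Ck_on k S (\<lambda>x. frechet_derivative f (at x) v) \<longleftrightarrow> Ck_on k S (\<lambda>x. f' x v)" for v
    by (intro Ck_on_cong[OF assms(1)]) auto
  then show ?thesis using assms by (auto simp: differentiable_def)
qed

lemma Ck_on_has_derivative:
  "Ck_on (Suc k) S f \<Longrightarrow> x \<in> S \<Longrightarrow> (f has_derivative frechet_derivative f (at x)) (at x)"
  by (auto simp: frechet_derivative_works)

lemma Ck_on_SucD: "Ck_on (Suc k) S f \<Longrightarrow> Ck_on k S f"
proof (induction k arbitrary: f)
  case 0
  then show ?case
    by (auto intro!: continuous_at_imp_continuous_on differentiable_imp_continuous_within)
next
  case (Suc k)
  from Suc.prems show ?case
    unfolding Ck_on.simps(2)[of "Suc k" S f] Ck_on.simps(2)[of k S f]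
    using Suc.IH by blast
qed

lemma Ck_on_continuous: "Ck_on k S f \<Longrightarrow> continuous_on S f"
  by (induction k) (use Ck_on_SucD in auto)

lemma smooth_on_imp_continuous: "smooth_on S f \<Longrightarrow> continuous_on S f"
  using Ck_on_continuous by (auto simp: smooth_on_def)

lemma smooth_on_has_derivative:
  "smooth_on S f \<Longrightarrow> x \<in> S \<Longrightarrow> (f has_derivative frechet_derivative f (at x)) (at x)"
  unfolding smooth_on_def using Ck_on_has_derivative by blast

lemma smooth_on_frechet_derivative:
  "smooth_on S f \<Longrightarrow> smooth_on S (\<lambda>x. frechet_derivative f (at x) v)"
  unfolding smooth_on_def using Ck_on.simps(2) by blast

lemma smooth_on_const: "smooth_on S (\<lambda>x. c)" if "open S"
proof -
  have "Ck_on k S (\<lambda>x. c)" for k and c :: 'b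
  proof (induction k arbitrary: c)
    case 0
    then show ?case by simp
  next
    case (Suc k)
    show ?case
      by (rule Ck_on_SucI[OF that, where f'="\<lambda>x v. 0"]) (auto intro: Suc)
  qed
  then show ?thesis by (simp add: smooth_on_def)
qed

lemma Ck_on_add:
  assumes "open S"
  shows "Ck_on k S f \<Longrightarrow> Ck_on k S g \<Longrightarrow> Ck_on k S (\<lambda>x. f x + g x)"
proof (induction k arbitrary: f g)
  case 0
  then show ?case by (auto intro: continuous_intros)
next
  case (Suc k)
  show ?case
    by (rule Ck_on_SucI[OF assms(1), where
          f'="\<lambda>x v. frechet_derivative f (at x) v + frechet_derivative g (at x) v"])
       (use Suc in \<open>auto intro!: has_derivative_add Ck_on_has_derivative simp del: Ck_on.simps
           simp: Ck_on.simps(2)\<close>)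
qed

lemma smooth_on_add:
  assumes "open S" "smooth_on S f" "smooth_on S g"
  shows "smooth_on S (\<lambda>x. f x + g x)"
  using Ck_on_add[OF assms(1), of _ f g] assms(2,3) by (simp add: smooth_on_def)

lemma smooth_on_bounded_linear:
  assumes "open S" "smooth_on S f" "bounded_linear L"
  shows "smooth_on S (\<lambda>x. L (f x))"
proof -
  have "Ck_on k S f \<Longrightarrow> Ck_on k S (\<lambda>x. L (f x))" for k
  proof (induction k arbitrary: f)
    case 0
    then show ?case using assms(3)
      by (auto intro: bounded_linear.continuous_on)
  next
    case (Suc k)
    show ?case
      by (rule Ck_on_SucI[OF assms(1), where f'="\<lambda>x v. L (frechet_derivative f (at x) v)"])
         (use Suc in \<open>auto intro!: bounded_linear.has_derivative[OF assms(3)] Ck_on_has_derivative simp del: Ck_on.simps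
             simp: Ck_on.simps(2)\<close>)
  qed
  then show ?thesis using assms by (simp add: smooth_on_def)
qed

lemma smooth_on_bilinear:
  fixes pr :: "'b::real_normed_vector \<Rightarrow> 'c::real_normed_vector \<Rightarrow> 'd::real_normed_vector"
  assumes "open S" "bounded_bilinear pr" "smooth_on S f" "smooth_on S g"
  shows "smooth_on S (\<lambda>x. pr (f x) (g x))"
proof -
  have "Ck_on k S f \<Longrightarrow> Ck_on k S g \<Longrightarrow> Ck_on k S (\<lambda>x. pr (f x) (g x))" for k
  proof (induction k arbitrary: f g)
    case 0
    then show ?case using bounded_bilinear.continuous_on[OF assms(2)] by auto
  next
    case (Suc k)
    show ?case
    proof (rule Ck_on_SucI[OF assms(1)])
      show "((\<lambda>x. pr (f x) (g x)) has_derivative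
          (\<lambda>v. pr (f x) (frechet_derivative g (at x) v) + pr (frechet_derivative f (at x) v) (g x))) (at x)"
        if "x \<in> S" for x
        by (rule bounded_bilinear.FDERIV[OF assms(2)])
          (use Suc.prems that Ck_on_has_derivative in blast)+
      show "Ck_on k S (\<lambda>x. pr (f x) (frechet_derivative g (at x) v)
             + pr (frechet_derivative f (at x) v) (g x))" for v
        by (rule Ck_on_add[OF assms(1)]; rule Suc.IH) (use Suc.prems Ck_on_SucD in \<open>auto simp del: Ck_on.simps
             simp: Ck_on.simps(2)\<close>)
    qed
  qed
  then show ?thesis using assms by (simp add: smooth_on_def)
qed

lemma smooth_on_affine_comp:
  assumes "open T" "\<And>y. y \<in> T \<Longrightarrow> c + L y \<in> S" "smooth_on S f" "bounded_linear L"
  shows "smooth_on T (\<lambda>y. f (c + L y))"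
proof -
  have L: "((\<lambda>y. c + L y) has_derivative L) (at y)" for y
    using bounded_linear.has_derivative[OF assms(4) has_derivative_ident]
    by (auto intro!: derivative_eq_intros)
  have "Ck_on k S f \<Longrightarrow> Ck_on k T (\<lambda>y. f (c + L y))" for k
  proof (induction k arbitrary: f)
    case 0
    have "continuous_on T (\<lambda>y. c + L y)"
      using L by (meson continuous_at_imp_continuous_on has_derivative_continuous)
    then show ?case using 0 assms(2)
      by (auto intro: continuous_on_compose2)
  next
    case (Suc k)
    show ?case
    proof (rule Ck_on_SucI[OF assms(1)])
      show "((\<lambda>y. f (c + L y)) has_derivative (\<lambda>v. frechet_derivative f (at (c + L y)) (L v))) (at y)"
        if "y \<in> T" for y
        using has_derivative_compose[OF L, of f _ y] Suc.prems assms(2)[OF that] Ck_on_has_derivative by metis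
      show "Ck_on k T (\<lambda>y. frechet_derivative f (at (c + L y)) (L v))" for v
        by (rule Suc.IH) (use Suc.prems in auto)
    qed
  qed
  then show ?thesis using assms by (simp add: smooth_on_def)
qed

lemma smooth_on_ident: "open S \<Longrightarrow> smooth_on S (\<lambda>x. x)"
  unfolding smooth_on_def
proof
  fix k assume "open S"
  show "Ck_on k S (\<lambda>x. x)"
  proof (cases k)
    case (Suc k)
    then show ?thesis using \<open>open S\<close>
      by (auto intro!: Ck_on_SucI[where f'="\<lambda>x v. v"] smooth_on_const[unfolded smooth_on_def, rule_format])
  qed auto
qed

text \<open>Symmetry of second derivatives: both mixed derivatives are the derivative at \<open>0\<close> of
  \<open>s \<mapsto> \<partial>\<^sub>w f (x + s v)\<close>, one by definition and the other by differentiating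
  \<open>f (x + s v) - f x = \<integral> \<partial>\<^sub>v f (x + r v) dr\<close> under the integral sign.\<close>

lemma mixed_derivatives_commute:
  fixes f :: "'a::euclidean_space \<Rightarrow> 'b::euclidean_space"
  assumes S: "open S" "x \<in> S" and f: "smooth_on S f"
  shows "frechet_derivative (\<lambda>y. frechet_derivative f (at y) v) (at x) w
       = frechet_derivative (\<lambda>y. frechet_derivative f (at y) w) (at x) v"
proof -
  define D where "D u g y = frechet_derivative g (at y) u" for u and g :: "'a \<Rightarrow> 'b" and y
  have smD: "smooth_on S (D u g)" if "smooth_on S g" for u g
    using smooth_on_frechet_derivative[OF that] by (simp add: D_def[abs_def])
  obtain e where e: "e > 0" "ball x e \<subseteq> S" using S openE by blast
  \<comment> \<open>The factor keeps \<open>x + r v + t w\<close> in the ball for \<open>\<bar>r\<bar>, \<bar>t\<bar> \<le> d\<close>, also when \<open>v\<close> and \<open>w\<close> vanish.\<close>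
  define d where "d = e / (2 * (norm v + norm w + 1))"
  have d: "d > 0" using e by (simp add: d_def add_nonneg_pos)
  have inS: "x + r *\<^sub>R v + t *\<^sub>R w \<in> S" if "\<bar>r\<bar> \<le> d" "\<bar>t\<bar> \<le> d" for r t
  proof -
    have "norm (r *\<^sub>R v + t *\<^sub>R w) \<le> \<bar>r\<bar> * norm v + \<bar>t\<bar> * norm w"
      by (metis norm_scaleR norm_triangle_ineq)
    also have "\<dots> \<le> d * norm v + d * norm w"
      using that by (intro add_mono mult_right_mono) auto
    also have "\<dots> < d * (2 * (norm v + norm w + 1))"
      using d by (simp add: algebra_simps add_pos_nonneg add_nonneg_pos)
    also have "\<dots> = e"
    proof -
      have "norm v + norm w + 1 > 0" by (simp add: add_nonneg_pos)
      then show ?thesis by (simp add: d_def del: distrib_left_numeral)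
    qed
    finally show ?thesis using e(2) by (force simp: dist_norm norm_minus_commute ball_def algebra_simps)
  qed
  have der: "((\<lambda>r. g (y + r *\<^sub>R u)) has_vector_derivative D u g (y + r *\<^sub>R u)) (at r within X)"
    if "smooth_on S g" "y + r *\<^sub>R u \<in> S" for g y u r X
  proof -
    have 1: "((\<lambda>r. y + r *\<^sub>R u) has_derivative (\<lambda>h. h *\<^sub>R u)) (at r within X)"
      by (auto intro!: derivative_eq_intros)
    have 2: "(g has_derivative frechet_derivative g (at (y + r *\<^sub>R u))) (at (y + r *\<^sub>R u))"
      using smooth_on_has_derivative that by blast
    have "((\<lambda>r. g (y + r *\<^sub>R u)) has_derivative (\<lambda>h. frechet_derivative g (at (y + r *\<^sub>R u)) (h *\<^sub>R u))) (at r within X)"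
      by (rule has_derivative_compose[OF 1 2])
    moreover have "linear (frechet_derivative g (at (y + r *\<^sub>R u)))"
      using 2 has_derivative_linear by blast
    ultimately show ?thesis
      by (simp add: has_vector_derivative_def D_def linear_scale)
  qed
  have cont: "continuous_on X (\<lambda>z. g (x + a z *\<^sub>R v + b z *\<^sub>R w))"
    if "smooth_on S g" "\<And>z. z \<in> X \<Longrightarrow> \<bar>a z\<bar> \<le> d" "\<And>z. z \<in> X \<Longrightarrow> \<bar>b z\<bar> \<le> d"
      "continuous_on X a" "continuous_on X b" for g a b and X :: "'c::topological_space set"
    by (rule continuous_on_compose2[OF smooth_on_imp_continuous[OF that(1)]])
       (use that inS in \<open>auto intro!: continuous_intros\<close>)
  have key: "D w f (x + s *\<^sub>R v) = D w f x + integral {0..s} (\<lambda>r. D w (D v f) (x + r *\<^sub>R v))"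
    if s: "s \<in> {0..d}" for s
  proof -
    have ftc: "((\<lambda>r. D v f (x + t *\<^sub>R w + r *\<^sub>R v)) has_integral
        (f (x + t *\<^sub>R w + s *\<^sub>R v) - f (x + t *\<^sub>R w))) {0..s}" if "t \<in> {-d..d}" for t
    proof -
      have "((\<lambda>r. D v f (x + t *\<^sub>R w + r *\<^sub>R v)) has_integral
        (f (x + t *\<^sub>R w + s *\<^sub>R v) - f (x + t *\<^sub>R w + 0 *\<^sub>R v))) {0..s}"
      proof (rule fundamental_theorem_of_calculus)
        show "((\<lambda>r. f (x + t *\<^sub>R w + r *\<^sub>R v)) has_vector_derivative
            D v f (x + t *\<^sub>R w + r *\<^sub>R v)) (at r within {0..s})" if "r \<in> {0..s}" for r
          using inS[of r t] \<open>t \<in> {-d..d}\<close> that s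
          by (intro der[OF f]) (auto simp: ac_simps)
      qed (use s in auto)
      then show ?thesis by simp
    qed
    have A: "((\<lambda>t. integral (cbox 0 s) (\<lambda>r. D v f (x + t *\<^sub>R w + r *\<^sub>R v))) has_vector_derivative
       integral (cbox 0 s) (\<lambda>r. D w (D v f) (x + 0 *\<^sub>R w + r *\<^sub>R v))) (at 0 within {-d..d})"
    proof (rule leibniz_rule_vector_derivative)
      show "((\<lambda>t. D v f (x + t *\<^sub>R w + r *\<^sub>R v)) has_vector_derivative
           D w (D v f) (x + t *\<^sub>R w + r *\<^sub>R v)) (at t within {-d..d})"
        if "t \<in> {-d..d}" "r \<in> cbox 0 s" for t r
        using der[OF smD[OF f], of "x + r *\<^sub>R v" t w v] inS[of r t] that s by (simp add: ac_simps abs_le_iff)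
      show "continuous_on ({-d..d} \<times> cbox 0 s) (\<lambda>(t, r). D w (D v f) (x + t *\<^sub>R w + r *\<^sub>R v))"
        using cont[OF smD[OF smD[OF f]], of "{-d..d} \<times> cbox 0 s" snd fst] s
        by (force simp: case_prod_beta ac_simps intro!: continuous_intros)
    qed (use d ftc in auto)
    have B: "((\<lambda>t. f (x + t *\<^sub>R w + s *\<^sub>R v) - f (x + t *\<^sub>R w)) has_vector_derivative
        D w f (x + s *\<^sub>R v) - D w f x) (at 0 within {-d..d})"
    proof (rule has_vector_derivative_diff)
      show "((\<lambda>t. f (x + t *\<^sub>R w + s *\<^sub>R v)) has_vector_derivative D w f (x + s *\<^sub>R v)) (at 0 within {-d..d})"
        using der[OF f, of "x + s *\<^sub>R v" 0 w] inS[of s 0] s d by (simp add: ac_simps)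
      show "((\<lambda>t. f (x + t *\<^sub>R w)) has_vector_derivative D w f x) (at 0 within {-d..d})"
        using der[OF f, of "x" 0 w] S by (simp add: ac_simps)
    qed
    have "((\<lambda>t. integral (cbox 0 s) (\<lambda>r. D v f (x + t *\<^sub>R w + r *\<^sub>R v))) has_vector_derivative
        D w f (x + s *\<^sub>R v) - D w f x) (at 0 within {-d..d})"
      by (rule has_vector_derivative_transform[OF _ _ B])
         (use d ftc in \<open>auto simp: integral_unique\<close>)
    moreover have "at (0::real) within {-d..d} \<noteq> bot"
      using d by (simp add: trivial_limit_within islimpt_Icc)
    ultimately have "D w f (x + s *\<^sub>R v) - D w f x = integral (cbox 0 s) (\<lambda>r. D w (D v f) (x + 0 *\<^sub>R w + r *\<^sub>R v))"
      using vector_derivative_unique_within[OF _ _ A] by blast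
    then show ?thesis by (simp add: algebra_simps)
  qed
  have I: "((\<lambda>s. integral {0..s} (\<lambda>r. D w (D v f) (x + r *\<^sub>R v))) has_vector_derivative D w (D v f) (x + 0 *\<^sub>R v))
      (at 0 within {0..d})"
  proof (rule integral_has_vector_derivative)
    show "continuous_on {0..d} (\<lambda>r. D w (D v f) (x + r *\<^sub>R v))"
      using cont[OF smD[OF smD[OF f]], of "{0..d}" id "\<lambda>_. 0"] d by auto
  qed (use d in auto)
  have J: "((\<lambda>s. D w f (x + s *\<^sub>R v)) has_vector_derivative D w (D v f) (x + 0 *\<^sub>R v)) (at 0 within {0..d})"
    by (rule has_vector_derivative_transform[where f="\<lambda>s. D w f x + integral {0..s} (\<lambda>r. D w (D v f) (x + r *\<^sub>R v))"])
       (use d I key in \<open>auto intro!: derivative_eq_intros\<close>)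
  have K: "((\<lambda>s. D w f (x + s *\<^sub>R v)) has_vector_derivative D v (D w f) (x + 0 *\<^sub>R v)) (at 0 within {0..d})"
    by (rule der[OF smD[OF f]]) (use S in auto)
  have "D w (D v f) (x + 0 *\<^sub>R v) = D v (D w f) (x + 0 *\<^sub>R v)"
    using vector_derivative_unique_within[OF _ J K] d by (simp add: trivial_limit_within islimpt_Icc)
  then show ?thesis by (simp add: D_def[abs_def])
qed

section \<open>Poincare inequality and divergence theorem on boxes\<close>

lemma integrable_on_cbox_continuous:
  fixes f :: "'a::euclidean_space \<Rightarrow> 'b::banach"
  shows "continuous_on UNIV f \<Longrightarrow> f integrable_on cbox a b"
  by (meson continuous_on_subset integrable_continuous subset_UNIV)

lemma continuous_on_parametric_integral:
  fixes f :: "'c::topological_space \<Rightarrow> 'a::euclidean_space \<Rightarrow> 'b::banach"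
  assumes "continuous_on UNIV (\<lambda>(x, y). f x y)"
  shows "continuous_on UNIV (\<lambda>x. integral (cbox a b) (f x))"
  by (rule integral_continuous_on_param) (meson assms continuous_on_subset subset_UNIV)

text \<open>The fundamental theorem of calculus along the segment, followed by
  \<open>2 a b \<le> a\<^sup>2 + b\<^sup>2\<close>. Applying both to the scalar function \<open>s \<mapsto> w (x + s v) \<bullet> u\<close>, with \<open>u\<close> the
  total increment, makes \<open>(norm u)\<^sup>2\<close> appear on both sides and replaces a Cauchy-Schwarz inequality
  for integrals.\<close>

lemma norm_diff_squared_le_integral:
  fixes w :: "'a::euclidean_space \<Rightarrow> 'b::euclidean_space" and G :: "'a \<Rightarrow> real"
  assumes w: "\<And>y. (w has_derivative w' y) (at y)"
    and G: "continuous_on UNIV G"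
    and bd: "\<And>y v. (norm (w' y v))\<^sup>2 \<le> (norm v)\<^sup>2 * G y"
  shows "(norm (w (x + v) - w x))\<^sup>2 \<le> (norm v)\<^sup>2 * integral (cbox 0 1) (\<lambda>s. G (x + s *\<^sub>R v))"
proof -
  define u where "u = w (x + v) - w x"
  have lin: "linear (w' y)" for y using w has_derivative_linear by blast
  have "((\<lambda>s. w (x + s *\<^sub>R v) \<bullet> u) has_vector_derivative w' (x + s *\<^sub>R v) v \<bullet> u) (at s within {0..1})" for s
  proof -
    have "((\<lambda>r. x + r *\<^sub>R v) has_derivative (\<lambda>h. h *\<^sub>R v)) (at s within {0..1})"
      by (auto intro!: derivative_eq_intros)
    from has_derivative_compose[OF this w[of "x + s *\<^sub>R v"]]
    have "((\<lambda>s. w (x + s *\<^sub>R v) \<bullet> u) has_derivative (\<lambda>h. w' (x + s *\<^sub>R v) (h *\<^sub>R v) \<bullet> u)) (at s within {0..1})"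
      by (rule has_derivative_inner_left)
    then show ?thesis by (simp add: has_vector_derivative_def linear_scale[OF lin])
  qed
  from fundamental_theorem_of_calculus[OF _ this]
  have 1: "((\<lambda>s. w' (x + s *\<^sub>R v) v \<bullet> u) has_integral (norm u)\<^sup>2) (cbox 0 1)"
    by (simp add: u_def power2_norm_eq_inner inner_diff_left)
  have "continuous_on UNIV (\<lambda>s. G (x + s *\<^sub>R v))"
    by (rule continuous_on_compose2[OF G]) (auto intro!: continuous_intros)
  then have 2: "(\<lambda>s. G (x + s *\<^sub>R v)) integrable_on cbox 0 1"
    by (rule integrable_on_cbox_continuous)
  have "((\<lambda>s. (1/2) * ((norm v)\<^sup>2 * G (x + s *\<^sub>R v)) + (1/2) * (norm u)\<^sup>2) has_integral
     (1/2) * ((norm v)\<^sup>2 * integral (cbox 0 1) (\<lambda>s. G (x + s *\<^sub>R v))) + (1/2) * (norm u)\<^sup>2) (cbox 0 1)"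
  proof (intro has_integral_add has_integral_mult_right integrable_integral[OF 2])
    show "((\<lambda>s. (norm u)\<^sup>2) has_integral (norm u)\<^sup>2) (cbox 0 (1::real))"
      using has_integral_const[of "(norm u)\<^sup>2" "0::real" 1] by simp
  qed
  moreover have "w' y v \<bullet> u \<le> (1/2) * ((norm v)\<^sup>2 * G y) + (1/2) * (norm u)\<^sup>2" for y
  proof -
    have "w' y v \<bullet> u \<le> norm (w' y v) * norm u" by (rule norm_cauchy_schwarz)
    also have "\<dots> \<le> (1/2) * (norm (w' y v))\<^sup>2 + (1/2) * (norm u)\<^sup>2"
      using sum_squares_bound[of "norm (w' y v)" "norm u"] by simp
    finally show ?thesis using bd[of y v] by linarith
  qed
  ultimately have "(norm u)\<^sup>2 \<le> (1/2) * ((norm v)\<^sup>2 * integral (cbox 0 1) (\<lambda>s. G (x + s *\<^sub>R v))) + (1/2) * (norm u)\<^sup>2"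
    using has_integral_le[OF 1] by blast
  then show ?thesis by (simp add: u_def)
qed

text \<open>A Poincare inequality whose constant tends to \<open>0\<close> with the diameter \<open>\<delta>\<close> of the box, however thin the
  box is. The variance of \<open>w\<close> is half of the double integral of \<open>(norm (w y - w z))\<^sup>2\<close>, and passing
  through the midpoint of \<open>y\<close> and \<open>z\<close> reduces it to increments over the half of the segment that starts
  at \<open>z\<close>. On that half, for fixed \<open>y\<close>, the map \<open>z \<mapsto> (1 - s/2) z + (s/2) y\<close> contracts the box into
  itself by a factor at least \<open>1/2\<close>, so the change of variables costs at most \<open>2 ^ DIM('a)\<close>.\<close>

lemma poincare_cbox:
  fixes w :: "'a::euclidean_space \<Rightarrow> 'b::euclidean_space" and G :: "'a \<Rightarrow> real"
  assumes w: "\<And>y. (w has_derivative w' y) (at y)"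
    and G: "continuous_on UNIV G"
    and bd: "\<And>y v. (norm (w' y v))\<^sup>2 \<le> (norm v)\<^sup>2 * G y"
    and diam: "\<And>y z. y \<in> cbox a b \<Longrightarrow> z \<in> cbox a b \<Longrightarrow> norm (y - z) \<le> \<delta>"
    and G0: "\<And>y. 0 \<le> G y"
  shows "measure lborel (cbox a b) * integral (cbox a b) (\<lambda>y. (norm (w y))\<^sup>2)
    \<le> (norm (integral (cbox a b) w))\<^sup>2
      + measure lborel (cbox a b) * (\<delta>\<^sup>2 * 2 ^ DIM('a) * integral (cbox a b) G)"
proof -
  define B where "B = cbox a b"
  define c where "c = measure lborel B"
  define h where "h y z = (norm (w z - w ((1/2) *\<^sub>R (z + y))))\<^sup>2" for y z
  have c0: "c \<ge> 0" by (simp add: c_def B_def)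
  have cw: "continuous_on UNIV w"
    using w by (meson continuous_at_imp_continuous_on has_derivative_continuous)
  have cw': "continuous_on X (\<lambda>x. w (f x))" if "continuous_on X f" for X and f :: "'c::topological_space \<Rightarrow> 'a"
    by (rule continuous_on_compose2[OF cw that]) auto
  have cG': "continuous_on X (\<lambda>x. G (f x))" if "continuous_on X f" for X and f :: "'c::topological_space \<Rightarrow> 'a"
    by (rule continuous_on_compose2[OF G that]) auto
  have ch: "continuous_on X (\<lambda>x. h (f x) (g x))" if "continuous_on X f" "continuous_on X g"
    for X and f g :: "'c::topological_space \<Rightarrow> 'a"
    unfolding h_def by (intro continuous_intros cw' that)
  have int: "f integrable_on B" if "continuous_on UNIV f" for f :: "'a \<Rightarrow> real"
    unfolding B_def by (rule integrable_on_cbox_continuous[OF that])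
  have cint: "continuous_on UNIV (\<lambda>x. integral B (f x))"
    if "continuous_on UNIV (\<lambda>(x, y). f x y)" for f :: "'a \<Rightarrow> 'a \<Rightarrow> real"
    unfolding B_def by (rule continuous_on_parametric_integral[OF that])
  have shrink: "integral B (\<lambda>z. G ((1 - s/2) *\<^sub>R z + (s/2) *\<^sub>R y)) \<le> 2 ^ DIM('a) * integral B G"
    if s: "s \<in> {0..1}" and y: "y \<in> B" for s y
  proof -
    define m where "m = 1 - s/2"
    have m: "1/2 \<le> m" "m \<le> 1" "s/2 = 1 - m" using s by (auto simp: m_def)
    define d where "d = (1 - m) *\<^sub>R y"
    have mem: "x \<in> cbox (m *\<^sub>R a + d) (m *\<^sub>R b + d) \<Longrightarrow> x \<in> B" for x
    proof -
      assume x: "x \<in> cbox (m *\<^sub>R a + d) (m *\<^sub>R b + d)"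
      show "x \<in> B" unfolding B_def mem_box
      proof
        fix i :: 'a assume i: "i \<in> Basis"
        from y i have yi: "a \<bullet> i \<le> y \<bullet> i" "y \<bullet> i \<le> b \<bullet> i" by (auto simp: B_def mem_box)
        from x i have "m * (a \<bullet> i) + (1-m) * (y \<bullet> i) \<le> x \<bullet> i" "x \<bullet> i \<le> m * (b \<bullet> i) + (1-m) * (y \<bullet> i)"
          by (auto simp: mem_box d_def inner_simps)
        moreover have "(1-m) * (a \<bullet> i) \<le> (1-m) * (y \<bullet> i)" "(1-m) * (y \<bullet> i) \<le> (1-m) * (b \<bullet> i)"
          using yi m by (auto intro: mult_left_mono)
        ultimately show "a \<bullet> i \<le> x \<bullet> i \<and> x \<bullet> i \<le> b \<bullet> i" by (simp add: algebra_simps)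
      qed
    qed
    have img: "(\<lambda>x. (1 / m) *\<^sub>R x + - ((1 / m) *\<^sub>R d)) ` cbox (m *\<^sub>R a + d) (m *\<^sub>R b + d) = B"
    proof -
      have "B \<noteq> {}" using y by auto
      then have "cbox (m *\<^sub>R a + d) (m *\<^sub>R b + d) \<noteq> {}"
        using m by (auto simp: B_def box_ne_empty inner_simps intro!: mult_left_mono)
      then show ?thesis using m
        by (subst image_affinity_cbox) (auto simp: B_def algebra_simps)
    qed
    define j where "j = integral (cbox (m *\<^sub>R a + d) (m *\<^sub>R b + d)) G"
    have "(G has_integral j) (cbox (m *\<^sub>R a + d) (m *\<^sub>R b + d))"
      unfolding j_def by (intro integrable_integral integrable_on_cbox_continuous G)
    from has_integral_affinity[OF this, of m d]
    have I: "((\<lambda>x. G (m *\<^sub>R x + d)) has_integral (1 / \<bar>m\<bar> ^ DIM('a)) *\<^sub>R j) B"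
      using m img by simp
    have j0: "0 \<le> j" unfolding j_def
      by (intro integral_nonneg integrable_on_cbox_continuous G) (use G0 in auto)
    have "j \<le> integral B G"
      unfolding j_def by (rule integral_subset_le) (use mem G0 G int in \<open>auto intro: integrable_on_cbox_continuous\<close>)
    moreover have "1 / \<bar>m\<bar> ^ DIM('a) \<le> 2 ^ DIM('a)"
    proof -
      have "(1 / \<bar>m\<bar>) ^ DIM('a) \<le> 2 ^ DIM('a)"
        using m by (intro power_mono) (auto simp: field_simps)
      then show ?thesis by (simp add: power_one_over)
    qed
    ultimately have "(1 / \<bar>m\<bar> ^ DIM('a)) * j \<le> 2 ^ DIM('a) * integral B G"
      using j0 by (intro mult_mono) auto
    moreover have "\<bar>m\<bar> = m" using m by simp
    moreover have "(1 - s/2) *\<^sub>R z + (s/2) *\<^sub>R y = m *\<^sub>R z + d" for z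
      unfolding d_def m(3) by simp
    ultimately show ?thesis using integral_unique[OF I] by simp
  qed
  have hbound: "integral B (h y) \<le> \<delta>\<^sup>2 / 4 * (2 ^ DIM('a) * integral B G)" if y: "y \<in> B" for y
  proof -
    have pw: "h y z \<le> \<delta>\<^sup>2 / 4 * integral (cbox 0 1) (\<lambda>s. G ((1 - s/2) *\<^sub>R z + (s/2) *\<^sub>R y))" if z: "z \<in> B" for z
    proof -
      define v where "v = (1/2) *\<^sub>R (y - z)"
      have v: "(norm v)\<^sup>2 \<le> \<delta>\<^sup>2 / 4"
      proof -
        have "(norm (y - z))\<^sup>2 \<le> \<delta>\<^sup>2" using diam[of y z] y z by (intro power_mono) (auto simp: B_def)
        then show ?thesis by (simp add: v_def power_divide)
      qed
      have e1: "z + v = (1/2) *\<^sub>R (z + y)" by (simp add: v_def algebra_simps flip: scaleR_left_distrib)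
      have e2: "z + s *\<^sub>R v = (1 - s/2) *\<^sub>R z + (s/2) *\<^sub>R y" for s by (simp add: v_def algebra_simps)
      have "h y z \<le> (norm v)\<^sup>2 * integral (cbox 0 1) (\<lambda>s. G (z + s *\<^sub>R v))"
        using norm_diff_squared_le_integral[OF w G bd, of z v] by (simp add: h_def e1 norm_minus_commute)
      also have "\<dots> \<le> \<delta>\<^sup>2 / 4 * integral (cbox 0 1) (\<lambda>s. G (z + s *\<^sub>R v))"
        by (intro mult_right_mono v integral_nonneg integrable_on_cbox_continuous cG')
           (auto intro!: continuous_intros G0)
      finally show ?thesis by (simp add: e2)
    qed
    have cs: "continuous_on UNIV (\<lambda>(z, s). G ((1 - s/2) *\<^sub>R z + (s/2) *\<^sub>R y))"
      unfolding case_prod_beta by (intro cG' continuous_intros) auto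
    have cs': "continuous_on UNIV (\<lambda>(s, z). G ((1 - s/2) *\<^sub>R z + (s/2) *\<^sub>R y))"
      unfolding case_prod_beta by (intro cG' continuous_intros) auto
    have "integral B (h y) \<le> integral B (\<lambda>z. \<delta>\<^sup>2 / 4 * integral (cbox 0 1) (\<lambda>s. G ((1 - s/2) *\<^sub>R z + (s/2) *\<^sub>R y)))"
      by (intro integral_le int continuous_intros continuous_on_parametric_integral cs pw ch)
    also have "\<dots> = \<delta>\<^sup>2 / 4 * integral B (\<lambda>z. integral (cbox 0 1) (\<lambda>s. G ((1 - s/2) *\<^sub>R z + (s/2) *\<^sub>R y)))"
      by simp
    also have "\<dots> = \<delta>\<^sup>2 / 4 * integral (cbox 0 1) (\<lambda>s. integral B (\<lambda>z. G ((1 - s/2) *\<^sub>R z + (s/2) *\<^sub>R y)))"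
      unfolding B_def
      by (subst integral_swap_continuous) (use cs in \<open>auto intro: continuous_on_subset\<close>)
    also have "\<dots> \<le> \<delta>\<^sup>2 / 4 * integral (cbox 0 1) (\<lambda>s::real. 2 ^ DIM('a) * integral B G)"
    proof (intro mult_left_mono integral_le)
      show "(\<lambda>s. integral B (\<lambda>z. G ((1 - s/2) *\<^sub>R z + (s/2) *\<^sub>R y))) integrable_on cbox 0 1"
        unfolding B_def by (intro integrable_on_cbox_continuous continuous_on_parametric_integral cs')
    qed (use shrink y in auto)
    finally show ?thesis by simp
  qed
  define J where "J = integral B (\<lambda>y. integral B (h y))"
  have J: "J \<le> c * (\<delta>\<^sup>2 / 4 * (2 ^ DIM('a) * integral B G))"
  proof -
    have "J \<le> integral B (\<lambda>y. \<delta>\<^sup>2 / 4 * (2 ^ DIM('a) * integral B G))"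
      unfolding J_def
      by (intro integral_le int cint hbound)
         (auto simp: case_prod_beta intro!: ch continuous_intros)
    also have "\<dots> = c * (\<delta>\<^sup>2 / 4 * (2 ^ DIM('a) * integral B G))"
      unfolding c_def by (subst (2) B_def, simp only: integral_const real_scaleR_def B_def)
    finally show ?thesis .
  qed
  have J': "integral B (\<lambda>y. integral B (\<lambda>z. h z y)) = J"
    unfolding J_def B_def
    by (subst integral_swap_continuous) (auto simp: case_prod_beta intro!: ch continuous_intros)
  have "integral B (\<lambda>y. integral B (\<lambda>z. (norm (w y - w z))\<^sup>2))
     \<le> integral B (\<lambda>y. integral B (\<lambda>z. 2 * h y z + 2 * h z y))"
  proof (intro integral_le int cint)
    fix y z
    have "(norm (w y - w z))\<^sup>2 \<le> (norm (w y - w ((1/2) *\<^sub>R (y + z))) + norm (w z - w ((1/2) *\<^sub>R (y + z))))\<^sup>2"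
      using norm_triangle_ineq4[of "w y - w ((1/2) *\<^sub>R (y + z))" "w z - w ((1/2) *\<^sub>R (y + z))"]
      by (intro power_mono) simp_all
    also have "\<dots> \<le> 2 * h y z + 2 * h z y"
      using sum_squares_bound[of "norm (w y - w ((1/2) *\<^sub>R (y + z)))" "norm (w z - w ((1/2) *\<^sub>R (y + z)))"]
      by (simp add: h_def power2_sum add.commute)
    finally show "(norm (w y - w z))\<^sup>2 \<le> 2 * h y z + 2 * h z y" .
  qed (auto simp: case_prod_beta intro!: ch cw' continuous_intros)
  also have "\<dots> = 2 * J + 2 * integral B (\<lambda>y. integral B (\<lambda>z. h z y))"
  proof -
    have "integral B (\<lambda>z. 2 * h y z + 2 * h z y) = 2 * integral B (h y) + 2 * integral B (\<lambda>z. h z y)" for y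
      by (subst integral_add) (auto intro!: int ch continuous_intros)
    then show ?thesis unfolding J_def
      by (simp, subst integral_add) (auto intro!: int cint ch continuous_intros simp: case_prod_beta)
  qed
  finally have le: "integral B (\<lambda>y. integral B (\<lambda>z. (norm (w y - w z))\<^sup>2)) \<le> 4 * J" by (simp add: J')
  have iw: "w integrable_on B" unfolding B_def by (rule integrable_on_cbox_continuous[OF cw])
  have inner_int: "integral B (\<lambda>z. w z \<bullet> v) = integral B w \<bullet> v" for v
    using integral_component_eq[OF iw] by simp
  have "integral B (\<lambda>z. (norm (w y - w z))\<^sup>2)
      = c * (norm (w y))\<^sup>2 + integral B (\<lambda>z. (norm (w z))\<^sup>2) - 2 * (integral B w \<bullet> w y)" for y
  proof -
    have "(\<lambda>z. (norm (w y - w z))\<^sup>2) = (\<lambda>z. ((norm (w y))\<^sup>2 + (norm (w z))\<^sup>2) - 2 * (w z \<bullet> w y))"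
      by (auto simp: power2_norm_eq_inner inner_diff_left inner_diff_right inner_commute)
    moreover have "integral B (\<lambda>z. ((norm (w y))\<^sup>2 + (norm (w z))\<^sup>2) - 2 * (w z \<bullet> w y))
       = integral B (\<lambda>z. (norm (w y))\<^sup>2) + integral B (\<lambda>z. (norm (w z))\<^sup>2) - integral B (\<lambda>z. 2 * (w z \<bullet> w y))"
      by (subst integral_diff, (intro int continuous_intros cw)+, subst integral_add)
         (auto intro!: int continuous_intros cw)
    ultimately show ?thesis by (simp add: inner_int) (simp add: B_def c_def)
  qed
  then have "integral B (\<lambda>y. integral B (\<lambda>z. (norm (w y - w z))\<^sup>2))
     = integral B (\<lambda>y. (c * (norm (w y))\<^sup>2 + integral B (\<lambda>z. (norm (w z))\<^sup>2)) - 2 * (w y \<bullet> integral B w))"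
    by (simp add: inner_commute)
  also have "\<dots> = integral B (\<lambda>y. c * (norm (w y))\<^sup>2) + integral B (\<lambda>y. integral B (\<lambda>z. (norm (w z))\<^sup>2))
      - integral B (\<lambda>y. 2 * (w y \<bullet> integral B w))"
    by (subst integral_diff, (intro int continuous_intros cw)+, subst integral_add)
       (auto intro!: int continuous_intros cw)
  also have "\<dots> = 2 * (c * integral B (\<lambda>y. (norm (w y))\<^sup>2)) - 2 * (norm (integral B w))\<^sup>2"
    by (simp add: inner_int power2_norm_eq_inner) (simp add: B_def c_def)
  finally have "2 * (c * integral B (\<lambda>y. (norm (w y))\<^sup>2)) - 2 * (norm (integral B w))\<^sup>2 \<le> 4 * J"
    using le by simp
  also have "\<dots> \<le> c * (\<delta>\<^sup>2 * 2 ^ DIM('a) * integral B G)"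
    using J by (simp add: mult_ac)
  finally have "c * integral B (\<lambda>y. (norm (w y))\<^sup>2) \<le> (norm (integral B w))\<^sup>2
       + c * (\<delta>\<^sup>2 * 2 ^ DIM('a) * integral B G) / 2" by simp
  moreover have "0 \<le> c * (\<delta>\<^sup>2 * 2 ^ DIM('a) * integral B G)"
    using c0 G0 int[OF G] by (intro mult_nonneg_nonneg integral_nonneg) auto
  ultimately show ?thesis unfolding c_def B_def by linarith
qed

text \<open>The divergence theorem on a box for one coordinate direction, as an inequality: the hypotheses
  fix the sign of \<open>F\<close> at and beyond the two faces orthogonal to \<open>k\<close>. Instead of writing down face integrals one translates the
  box in direction \<open>k\<close>. The translated box gains a layer on which \<open>F \<ge> 0\<close> and loses a layer on which
  \<open>F \<le> 0\<close>, so the integral of \<open>F\<close> does not decrease, and its derivative at \<open>0\<close> is the integral of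
  \<open>\<partial>\<^sub>k F\<close>. The lost layer lies inside the box, hence the strict inequality \<open>a \<bullet> k < e\<close>.\<close>

lemma integral_derivative_nonneg:
  fixes F :: "'a::euclidean_space \<Rightarrow> real"
  assumes k: "k \<in> Basis"
    and F: "\<And>y. (F has_derivative F' y) (at y)"
    and cF: "continuous_on UNIV (\<lambda>y. F' y k)"
    and up: "\<And>y. b \<bullet> k \<le> y \<bullet> k \<Longrightarrow> 0 \<le> F y"
    and dn: "\<And>y. y \<bullet> k \<le> e \<Longrightarrow> F y \<le> 0"
    and ae: "a \<bullet> k < e"
  shows "0 \<le> integral (cbox a b) (\<lambda>y. F' y k)"
proof -
  define D where "D h = integral (cbox a b) (\<lambda>y. F (y + h *\<^sub>R k))" for h
  define d where "d = e - a \<bullet> k"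
  have d: "d > 0" using ae by (simp add: d_def)
  have lin: "linear (F' y)" for y using F has_derivative_linear by blast
  have contF: "continuous_on UNIV F"
    using F by (meson continuous_at_imp_continuous_on has_derivative_continuous)
  have int: "F integrable_on cbox u v" for u v by (rule integrable_on_cbox_continuous[OF contF])
  have "(D has_field_derivative integral (cbox a b) (\<lambda>y. F' (y + 0 *\<^sub>R k) k)) (at 0 within {0..d})"
    unfolding D_def
  proof (rule leibniz_rule_field_derivative)
    show "((\<lambda>x. F (t + x *\<^sub>R k)) has_field_derivative F' (t + x *\<^sub>R k) k) (at x within {0..d})" for x t
    proof -
      have "((\<lambda>r. t + r *\<^sub>R k) has_derivative (\<lambda>h. h *\<^sub>R k)) (at x within {0..d})"
        by (auto intro!: derivative_eq_intros)
      from has_derivative_compose[OF this F[of "t + x *\<^sub>R k"]]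
      show ?thesis by (simp add: has_field_derivative_def linear_scale[OF lin] mult_commute_abs)
    qed
    show "(\<lambda>t. F (t + x *\<^sub>R k)) integrable_on cbox a b" for x
      by (intro integrable_on_cbox_continuous continuous_on_compose2[OF contF]) (auto intro!: continuous_intros)
    show "continuous_on ({0..d} \<times> cbox a b) (\<lambda>(x, t). F' (t + x *\<^sub>R k) k)"
      unfolding case_prod_beta
      by (intro continuous_on_compose2[OF cF]) (auto intro!: continuous_intros)
  qed (use d in auto)
  then have lim: "((\<lambda>h. (D h - D 0) / (h - 0)) \<longlongrightarrow> integral (cbox a b) (\<lambda>y. F' y k)) (at 0 within {0..d})"
    by (simp add: has_field_derivative_iff)
  have mono: "D 0 \<le> D h" if h: "0 < h" "h \<le> d" for h
  proof -
    let ?B = "cbox (a + h *\<^sub>R k) (b + h *\<^sub>R k)"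
    have "D h = integral ?B F"
      using integral_shift_cbox_plus[of a b F "h *\<^sub>R k"] by (simp add: D_def o_def add.commute)
    also have "\<dots> = integral (?B \<inter> {x. x \<bullet> k \<le> b \<bullet> k}) F + integral (?B \<inter> {x. x \<bullet> k \<ge> b \<bullet> k}) F"
      by (rule integral_split[OF int k])
    also have "\<dots> \<ge> integral (?B \<inter> {x. x \<bullet> k \<le> b \<bullet> k}) F"
    proof -
      have "F integrable_on (?B \<inter> {x. x \<bullet> k \<ge> b \<bullet> k})"
        using integrable_split(2)[OF int k] by blast
      then have "0 \<le> integral (?B \<inter> {x. x \<bullet> k \<ge> b \<bullet> k}) F"
        by (rule integral_nonneg) (use up in auto)
      then show ?thesis by simp
    qed
    also have "?B \<inter> {x. x \<bullet> k \<le> b \<bullet> k} = cbox a b \<inter> {x. x \<bullet> k \<ge> a \<bullet> k + h}"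
    proof -
      have *: "(u + h *\<^sub>R k) \<bullet> i = (if i = k then u \<bullet> k + h else u \<bullet> i)" if "i \<in> Basis" for u i
        using that k by (auto simp: inner_simps inner_Basis)
      have "x \<in> ?B \<and> x \<bullet> k \<le> b \<bullet> k \<longleftrightarrow> x \<in> cbox a b \<and> a \<bullet> k + h \<le> x \<bullet> k" for x
      proof -
        have split: "(\<forall>i\<in>Basis. P i) \<longleftrightarrow> P k \<and> (\<forall>i\<in>Basis - {k}. P i)" for P
          using k by blast
        have "(\<forall>i\<in>Basis - {k}. (a + h *\<^sub>R k) \<bullet> i \<le> x \<bullet> i \<and> x \<bullet> i \<le> (b + h *\<^sub>R k) \<bullet> i)
           \<longleftrightarrow> (\<forall>i\<in>Basis - {k}. a \<bullet> i \<le> x \<bullet> i \<and> x \<bullet> i \<le> b \<bullet> i)"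
          by (intro ball_cong refl) (simp add: *)
        moreover have "((a + h *\<^sub>R k) \<bullet> k \<le> x \<bullet> k \<and> x \<bullet> k \<le> (b + h *\<^sub>R k) \<bullet> k) \<and> x \<bullet> k \<le> b \<bullet> k
           \<longleftrightarrow> (a \<bullet> k \<le> x \<bullet> k \<and> x \<bullet> k \<le> b \<bullet> k) \<and> a \<bullet> k + h \<le> x \<bullet> k"
          using h by (subst (1 2) *[OF k]) auto
        ultimately show ?thesis
          unfolding mem_box split[of "\<lambda>i. (a + h *\<^sub>R k) \<bullet> i \<le> x \<bullet> i \<and> x \<bullet> i \<le> (b + h *\<^sub>R k) \<bullet> i"]
            split[of "\<lambda>i. a \<bullet> i \<le> x \<bullet> i \<and> x \<bullet> i \<le> b \<bullet> i"]
          by blast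
      qed
      then show ?thesis by auto
    qed
    also have "integral (cbox a b \<inter> {x. x \<bullet> k \<ge> a \<bullet> k + h}) F \<ge> integral (cbox a b) F"
    proof -
      have "integral (cbox a b) F = integral (cbox a b \<inter> {x. x \<bullet> k \<le> a \<bullet> k + h}) F
          + integral (cbox a b \<inter> {x. x \<bullet> k \<ge> a \<bullet> k + h}) F"
        by (rule integral_split[OF int k])
      moreover have "integral (cbox a b \<inter> {x. x \<bullet> k \<le> a \<bullet> k + h}) F \<le> integral (cbox a b \<inter> {x. x \<bullet> k \<le> a \<bullet> k + h}) (\<lambda>_. 0)"
        using integrable_split(1)[OF int k] dn h
        by (intro integral_le) (auto simp: d_def intro: integrable_0)
      ultimately show ?thesis by simp
    qed
    finally show ?thesis by (simp add: D_def)
  qed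
  show ?thesis
  proof (rule tendsto_lowerbound[OF lim])
    show "\<forall>\<^sub>F h in at 0 within {0..d}. 0 \<le> (D h - D 0) / (h - 0)"
      using mono by (auto simp: eventually_at_filter intro!: always_eventually divide_nonneg_nonneg)
    show "at (0::real) within {0..d} \<noteq> bot" using d by (simp add: trivial_limit_within islimpt_Icc)
  qed
qed

section \<open>Partial derivatives and differential operators of lower order\<close>

lemma smooth_on_sum:
  assumes "open S" "\<And>i. i \<in> I \<Longrightarrow> smooth_on S (f i)"
  shows "smooth_on S (\<lambda>x. \<Sum>i\<in>I. f i x)"
  using assms(2)
  by (induction I rule: infinite_finite_induct)
     (auto intro!: smooth_on_const smooth_on_add assms(1))

lemma smooth_on_scaleR_const:
  "open S \<Longrightarrow> smooth_on S f \<Longrightarrow> smooth_on S (\<lambda>x. c *\<^sub>R f x)"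
  by (rule smooth_on_bounded_linear[OF _ _ bounded_linear_scaleR_right])

definition coord_deriv :: "'n::finite \<Rightarrow> (real^'n \<Rightarrow> 'b::real_normed_vector) \<Rightarrow> real^'n \<Rightarrow> 'b" where
  "coord_deriv j f y = frechet_derivative f (at y) (axis j 1)"

fun coord_derivs :: "'n::finite list \<Rightarrow> (real^'n \<Rightarrow> 'b::real_normed_vector) \<Rightarrow> real^'n \<Rightarrow> 'b" where
  "coord_derivs [] f = f"
| "coord_derivs (j # \<beta>) f = coord_deriv j (coord_derivs \<beta> f)"

abbreviation smooth :: "(real^'n::finite \<Rightarrow> 'b::real_normed_vector) \<Rightarrow> bool" where
  "smooth \<equiv> smooth_on UNIV"

lemma coord_deriv_eqI:
  "(f has_derivative f') (at y) \<Longrightarrow> coord_deriv j f y = f' (axis j 1)"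
  unfolding coord_deriv_def using frechet_derivative_at by metis

lemma smooth_has_derivative:
  "smooth f \<Longrightarrow> (f has_derivative frechet_derivative f (at y)) (at y)"
  by (simp add: smooth_on_has_derivative)

lemma smooth_coord_deriv: "smooth f \<Longrightarrow> smooth (coord_deriv j f)"
  using smooth_on_frechet_derivative[of UNIV f "axis j 1"] by (simp add: coord_deriv_def[abs_def])

lemma smooth_coord_derivs: "smooth f \<Longrightarrow> smooth (coord_derivs \<beta> f)"
  by (induction \<beta>) (auto intro: smooth_coord_deriv)

lemma smooth_continuous: "smooth f \<Longrightarrow> continuous_on X f"
  by (meson continuous_on_subset smooth_on_imp_continuous subset_UNIV)

lemma coord_deriv_add:
  assumes "smooth f" "smooth g"
  shows "coord_deriv j (\<lambda>y. f y + g y) = (\<lambda>y. coord_deriv j f y + coord_deriv j g y)"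
  by (rule ext, subst coord_deriv_eqI[OF has_derivative_add[OF smooth_has_derivative[OF assms(1)]
       smooth_has_derivative[OF assms(2)]]]) (simp add: coord_deriv_def)

lemma coord_deriv_bounded_linear:
  assumes "smooth f" "bounded_linear L"
  shows "coord_deriv j (\<lambda>y. L (f y)) = (\<lambda>y. L (coord_deriv j f y))"
  by (rule ext, subst coord_deriv_eqI[OF bounded_linear.has_derivative[OF assms(2) smooth_has_derivative[OF assms(1)]]])
     (simp add: coord_deriv_def)

lemma coord_deriv_bilinear:
  assumes "smooth f" "smooth g" "bounded_bilinear pr"
  shows "coord_deriv j (\<lambda>y. pr (f y) (g y)) = (\<lambda>y. pr (f y) (coord_deriv j g y) + pr (coord_deriv j f y) (g y))"
  by (rule ext, subst coord_deriv_eqI[OF bounded_bilinear.FDERIV[OF assms(3) smooth_has_derivative[OF assms(1)]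
       smooth_has_derivative[OF assms(2)]]]) (simp add: coord_deriv_def)

lemma coord_deriv_const: "coord_deriv j (\<lambda>y. c) = (\<lambda>y. 0)"
  by (rule ext, subst coord_deriv_eqI[OF has_derivative_const]) simp

lemma coord_deriv_sum:
  assumes "\<And>i. i \<in> I \<Longrightarrow> smooth (f i)"
  shows "coord_deriv j (\<lambda>y. \<Sum>i\<in>I. f i y) = (\<lambda>y. \<Sum>i\<in>I. coord_deriv j (f i) y)"
  using assms
  by (induction I rule: infinite_finite_induct)
     (simp_all add: coord_deriv_const coord_deriv_add smooth_on_sum)

lemma coord_deriv_commute:
  fixes f :: "real^'n::finite \<Rightarrow> 'b::euclidean_space"
  assumes "smooth f"
  shows "coord_deriv j (coord_deriv k f) = coord_deriv k (coord_deriv j f)"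
  using mixed_derivatives_commute[OF open_UNIV UNIV_I assms] by (auto simp: coord_deriv_def[abs_def])

lemma coord_derivs_add:
  assumes "smooth f" "smooth g"
  shows "coord_derivs \<beta> (\<lambda>y. f y + g y) = (\<lambda>y. coord_derivs \<beta> f y + coord_derivs \<beta> g y)"
  by (induction \<beta>) (simp_all add: coord_deriv_add smooth_coord_derivs assms)

lemma coord_derivs_bounded_linear:
  assumes "smooth f" "bounded_linear L"
  shows "coord_derivs \<beta> (\<lambda>y. L (f y)) = (\<lambda>y. L (coord_derivs \<beta> f y))"
  by (induction \<beta>) (simp_all add: coord_deriv_bounded_linear smooth_coord_derivs assms)

lemma coord_derivs_sum:
  assumes "\<And>i. i \<in> I \<Longrightarrow> smooth (f i)"
  shows "coord_derivs \<beta> (\<lambda>y. \<Sum>i\<in>I. f i y) = (\<lambda>y. \<Sum>i\<in>I. coord_derivs \<beta> (f i) y)"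
  by (induction \<beta>) (simp_all add: coord_deriv_sum smooth_coord_derivs assms)

definition cube :: "real \<Rightarrow> (real^'n::finite) set" where
  "cube r = cbox (vec (- r)) (vec r)"

lemma mem_cube: "y \<in> cube r \<longleftrightarrow> (\<forall>k. \<bar>y $ k\<bar> \<le> r)"
  by (auto simp: cube_def mem_box_cart abs_le_iff) (meson minus_le_iff)+

lemma compact_cube: "compact (cube r)"
  by (simp add: cube_def)

lemma integrable_on_cube:
  fixes f :: "real^'n::finite \<Rightarrow> 'b::banach"
  shows "continuous_on UNIV f \<Longrightarrow> f integrable_on cube r"
  unfolding cube_def by (rule integrable_on_cbox_continuous)

lemma box_vec_nonempty: "0 < r \<Longrightarrow> box (vec (- r)) (vec r :: real^'n::finite) \<noteq> {}"
proof -
  assume "0 < r"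
  then have "0 \<in> box (vec (- r)) (vec r :: real^'n)" by (simp add: mem_box_cart)
  then show ?thesis by blast
qed

lemma zero_if_integral_cube_zero:
  fixes f :: "real^'n::finite \<Rightarrow> real"
  assumes f: "continuous_on UNIV f" "\<And>y. 0 \<le> f y" and r: "0 < r"
    and int: "integral (cube r) f = 0" and y: "y \<in> cube r"
  shows "f y = 0"
proof (rule has_integral_0_cbox_imp_0[where a="vec (- r)" and b="vec r"])
  show "(f has_integral 0) (cbox (vec (- r)) (vec r))"
    using integrable_integral[OF integrable_on_cube[OF f(1)], of r] int by (simp add: cube_def)
  show "continuous_on (cbox (vec (- r)) (vec r)) f" using f(1) continuous_on_subset by blast
qed (use f r y in \<open>auto simp: cube_def intro: box_vec_nonempty\<close>)

lemma bounded_linear_coordinate: "bounded_linear (\<lambda>y::real^'n::finite. c * y $ k)"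
  by (intro bounded_linear_compose[OF bounded_linear_mult_right] bounded_linear_vec_nth)

text \<open>Linear differential operators of order less than \<open>k\<close> with smooth coefficients. The commutators of
  \<open>\<partial>\<^sup>\<beta>\<close> with the zeroth-order term of a system lie in this class. Generating it term by term
  turns closure under differentiation and the bound on compact sets into short inductions.\<close>

inductive lower_order_op ::
    "nat \<Rightarrow> ((real^'n::finite \<Rightarrow> 'b::euclidean_space) \<Rightarrow> real^'n \<Rightarrow> 'b) \<Rightarrow> bool" where
  zero: "lower_order_op k (\<lambda>U y. 0)"
| step: "smooth M \<Longrightarrow> length \<gamma> < k \<Longrightarrow> lower_order_op k R
    \<Longrightarrow> lower_order_op k (\<lambda>U y. blinfun_apply (M y) (coord_derivs \<gamma> U y) + R U y)"

lemma lower_order_op_smooth: "lower_order_op k R \<Longrightarrow> smooth U \<Longrightarrow> smooth (R U)"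
  by (induction rule: lower_order_op.induct)
     (auto intro!: smooth_on_const smooth_on_add smooth_on_bilinear[OF _ bounded_bilinear_blinfun_apply] smooth_coord_derivs)

lemma lower_order_op_deriv:
  "lower_order_op k R \<Longrightarrow>
     \<exists>R'. lower_order_op (Suc k) R' \<and> (\<forall>U. smooth U \<longrightarrow> coord_deriv j (R U) = R' U)"
proof (induction rule: lower_order_op.induct)
  case (zero k)
  then show ?case
    by (intro exI[of _ "\<lambda>U y. 0"]) (auto intro: lower_order_op.zero simp: coord_deriv_const)
next
  case (step M \<gamma> k R)
  then obtain R' where R': "lower_order_op (Suc k) R'"
    "\<And>U. smooth U \<Longrightarrow> coord_deriv j (R U) = R' U" by blast
  have "lower_order_op (Suc k) (\<lambda>U y. blinfun_apply (M y) (coord_derivs (j # \<gamma>) U y)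
     + (blinfun_apply (coord_deriv j M y) (coord_derivs \<gamma> U y) + R' U y))"
    by (intro lower_order_op.step R' smooth_coord_deriv) (use step in auto)
  moreover have "coord_deriv j (\<lambda>y. blinfun_apply (M y) (coord_derivs \<gamma> U y) + R U y)
    = (\<lambda>y. blinfun_apply (M y) (coord_derivs (j # \<gamma>) U y)
     + (blinfun_apply (coord_deriv j M y) (coord_derivs \<gamma> U y) + R' U y))" if "smooth U" for U
  proof -
    have sU: "smooth (coord_derivs \<gamma> U)" by (rule smooth_coord_derivs[OF that])
    show ?thesis
      unfolding coord_deriv_add[OF smooth_on_bilinear[OF open_UNIV bounded_bilinear_blinfun_apply step(1) sU]
          lower_order_op_smooth[OF step(3) that]]
        coord_deriv_bilinear[OF step(1) sU bounded_bilinear_blinfun_apply] R'(2)[OF that]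
      by (simp add: add.assoc)
  qed
  ultimately show ?case by blast
qed

definition short_lists :: "nat \<Rightarrow> 'n::finite list set" where
  "short_lists N = {\<beta>. length \<beta> < N}"

lemma finite_short_lists: "finite (short_lists N)"
proof (cases N)
  case (Suc M)
  then have "short_lists N \<subseteq> {\<beta> :: 'a list. set \<beta> \<subseteq> UNIV \<and> length \<beta> \<le> M}"
    by (auto simp: short_lists_def)
  then show ?thesis by (rule finite_subset) (rule finite_lists_length_le, simp)
qed (auto simp: short_lists_def)

lemma norm_blinfun_bounded_on_cube:
  assumes "smooth M"
  shows "\<exists>m\<ge>0. \<forall>y\<in>cube r. norm (M y) \<le> m"
proof -
  have "compact (M ` cube r)"
    by (intro compact_continuous_image smooth_continuous assms compact_cube)
  then obtain m where "\<forall>z\<in>M ` cube r. norm z \<le> m"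
    using compact_imp_bounded bounded_iff by blast
  then show ?thesis by (intro exI[of _ "max 0 m"]) (auto simp: le_max_iff_disj)
qed

lemma lower_order_op_bound:
  "lower_order_op k R \<Longrightarrow>
    \<exists>C\<ge>0. \<forall>U. \<forall>y\<in>cube r. (norm (R U y))\<^sup>2 \<le> C * (\<Sum>\<gamma>\<in>short_lists k. (norm (coord_derivs \<gamma> U y))\<^sup>2)"
proof (induction rule: lower_order_op.induct)
  case (zero k)
  then show ?case by (intro exI[of _ 0]) auto
next
  case (step M \<gamma> k R)
  then obtain C where C: "C \<ge> 0"
    "\<And>U y. y \<in> cube r \<Longrightarrow> (norm (R U y))\<^sup>2 \<le> C * (\<Sum>\<gamma>\<in>short_lists k. (norm (coord_derivs \<gamma> U y))\<^sup>2)"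
    by blast
  obtain m where m: "m \<ge> 0" "\<And>y. y \<in> cube r \<Longrightarrow> norm (M y) \<le> m"
    using norm_blinfun_bounded_on_cube[OF step(1)] by blast
  have "(norm (blinfun_apply (M y) (coord_derivs \<gamma> U y) + R U y))\<^sup>2
    \<le> (2 * m\<^sup>2 + 2 * C) * (\<Sum>\<gamma>\<in>short_lists k. (norm (coord_derivs \<gamma> U y))\<^sup>2)" (is "?L \<le> _ * ?s")
    if y: "y \<in> cube r" for U y
  proof -
    let ?a = "norm (blinfun_apply (M y) (coord_derivs \<gamma> U y))" and ?b = "norm (R U y)"
    have "?L \<le> (?a + ?b)\<^sup>2" by (intro power_mono norm_triangle_ineq) simp
    also have "\<dots> \<le> 2 * ?a\<^sup>2 + 2 * ?b\<^sup>2"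
      using sum_squares_bound[of ?a ?b] by (simp add: power2_sum)
    finally have 1: "?L \<le> 2 * ?a\<^sup>2 + 2 * ?b\<^sup>2" .
    have "?a \<le> m * norm (coord_derivs \<gamma> U y)"
      using norm_blinfun[of "M y" "coord_derivs \<gamma> U y"] m(2)[OF y]
      by (meson mult_right_mono norm_ge_zero order_trans)
    then have 2: "?a\<^sup>2 \<le> m\<^sup>2 * (norm (coord_derivs \<gamma> U y))\<^sup>2"
      by (metis norm_ge_zero power_mono power_mult_distrib)
    have "\<gamma> \<in> short_lists k" using step by (simp add: short_lists_def)
    then have "(norm (coord_derivs \<gamma> U y))\<^sup>2 \<le> ?s"
      by (intro member_le_sum finite_short_lists) auto
    then have "m\<^sup>2 * (norm (coord_derivs \<gamma> U y))\<^sup>2 \<le> m\<^sup>2 * ?s" by (rule mult_left_mono) simp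
    with 1 2 C(2)[OF y, of U] show ?thesis by (simp add: distrib_right)
  qed
  then show ?case using C(1) by (intro exI[of _ "2 * m\<^sup>2 + 2 * C"]) auto
qed

section \<open>Energy estimates for systems with outward drift\<close>

text \<open>First-order systems \<open>\<partial>\<^sub>\<tau> U = \<Sum>\<^sub>k S\<^sub>k \<partial>\<^sub>k U - \<Sum>\<^sub>k q\<^sub>k y\<^sub>k \<partial>\<^sub>k U + M U\<close>
  with constant symmetric \<open>S\<^sub>k\<close> of norm at most \<open>1\<close> and an outward drift with positive rates \<open>q\<^sub>k\<close>. From
  \<open>\<bar>y\<^sub>k\<bar> \<ge> \<rho>\<close> on, the drift is at least as fast as the propagation speed \<open>1\<close>, so nothing enters a cube of
  half side length greater than \<open>\<rho>\<close> through its faces, and energy estimates hold there without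
  boundary conditions.\<close>

locale transport_system =
  fixes q :: "'n::finite \<Rightarrow> real"
    and S :: "'n \<Rightarrow> 'b::euclidean_space \<Rightarrow> 'b"
    and M :: "real^'n \<Rightarrow> 'b \<Rightarrow>\<^sub>L 'b"
    and \<rho> :: real
  assumes q_pos: "0 < q k"
    and S_linear: "linear (S k)"
    and S_sym: "S k x \<bullet> y = x \<bullet> S k y"
    and S_bound: "\<bar>S k x \<bullet> x\<bar> \<le> x \<bullet> x"
    and M_smooth: "smooth M"
    and rho: "1 \<le> q k * \<rho>"
begin

definition evol :: "(real^'n \<Rightarrow> 'b) \<Rightarrow> real^'n \<Rightarrow> 'b" where
  "evol U y = (\<Sum>k\<in>UNIV. S k (coord_deriv k U y) - (q k * y $ k) *\<^sub>R coord_deriv k U y)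
     + blinfun_apply (M y) (U y)"

text \<open>The outward energy flux in direction \<open>k\<close>: twice the first-order part of \<open>U \<bullet> evol U\<close> equals
  \<open>(\<Sum>k. q k) * (U \<bullet> U)\<close> minus the divergence of this vector field.\<close>

definition flux :: "'n \<Rightarrow> (real^'n \<Rightarrow> 'b) \<Rightarrow> real^'n \<Rightarrow> real" where
  "flux k U y = q k * y $ k * (U y \<bullet> U y) - S k (U y) \<bullet> U y"

lemma rho_pos: "0 < \<rho>"
  using rho q_pos by (metis less_le_trans zero_less_one zero_less_mult_pos)

lemma S_bounded_linear: "bounded_linear (S k)"
  using S_linear linear_conv_bounded_linear by blast

lemma smooth_MU: "smooth U \<Longrightarrow> smooth (\<lambda>y. blinfun_apply (M y) (U y))"
  by (rule smooth_on_bilinear[OF open_UNIV bounded_bilinear_blinfun_apply M_smooth])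

lemma smooth_coordinate: "smooth (\<lambda>y::real^'n. c * y $ k)"
  by (rule smooth_on_bounded_linear[OF open_UNIV smooth_on_ident[OF open_UNIV] bounded_linear_coordinate])

lemma smooth_drift: "smooth U \<Longrightarrow> smooth (\<lambda>y. S k (coord_deriv k U y) - (q k * y $ k) *\<^sub>R coord_deriv k U y)"
proof -
  assume U: "smooth U"
  have "smooth (\<lambda>y. S k (coord_deriv k U y) + (- q k * y $ k) *\<^sub>R coord_deriv k U y)"
    by (intro smooth_on_add open_UNIV smooth_on_bounded_linear[OF open_UNIV _ S_bounded_linear]
        smooth_on_bilinear[OF _ bounded_bilinear_scaleR] smooth_coordinate smooth_coord_deriv U)
  then show ?thesis by simp
qed

lemma smooth_evol: "smooth U \<Longrightarrow> smooth (evol U)"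
  unfolding evol_def[abs_def]
  by (intro smooth_on_add smooth_on_sum smooth_drift smooth_MU open_UNIV)

text \<open>The term \<open>- q j *\<^sub>R coord_deriv j U\<close> is the source of the decay: because the drift expands, every
  derivative gains damping at rate \<open>q j\<close>.\<close>

lemma coord_deriv_evol:
  assumes U: "smooth U"
  shows "coord_deriv j (evol U) = (\<lambda>y. evol (coord_deriv j U) y - q j *\<^sub>R coord_deriv j U y
     + blinfun_apply (coord_deriv j M y) (U y))"
proof
  fix y
  have drift: "coord_deriv j (\<lambda>y. S k (coord_deriv k U y) - (q k * y $ k) *\<^sub>R coord_deriv k U y) y
     = S k (coord_deriv k (coord_deriv j U) y) - (q k * y $ k) *\<^sub>R coord_deriv k (coord_deriv j U) y
       - (if k = j then q k *\<^sub>R coord_deriv k U y else 0)" for k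
  proof -
    have dU: "(coord_deriv k U has_derivative frechet_derivative (coord_deriv k U) (at y)) (at y)"
      by (intro smooth_has_derivative smooth_coord_deriv U)
    have dy: "((\<lambda>y. q k * y $ k) has_derivative (\<lambda>v. q k * v $ k)) (at y)"
      by (rule bounded_linear.has_derivative[OF bounded_linear_coordinate has_derivative_ident])
    have "coord_deriv j (\<lambda>y. S k (coord_deriv k U y) - (q k * y $ k) *\<^sub>R coord_deriv k U y) y
      = S k (coord_deriv j (coord_deriv k U) y)
        - ((q k * y $ k) *\<^sub>R coord_deriv j (coord_deriv k U) y + (q k * axis j 1 $ k) *\<^sub>R coord_deriv k U y)"
      by (subst coord_deriv_eqI[OF has_derivative_diff[OF bounded_linear.has_derivative[OF S_bounded_linear dU]
              has_derivative_scaleR[OF dy dU]]])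
         (simp add: coord_deriv_def[abs_def])
    then show ?thesis using coord_deriv_commute[OF U, of j k] by (auto simp: axis_def)
  qed
  have "coord_deriv j (evol U) y =
    (\<Sum>k\<in>UNIV. S k (coord_deriv k (coord_deriv j U) y) - (q k * y $ k) *\<^sub>R coord_deriv k (coord_deriv j U) y
       - (if k = j then q k *\<^sub>R coord_deriv k U y else 0))
    + (blinfun_apply (M y) (coord_deriv j U y) + blinfun_apply (coord_deriv j M y) (U y))"
    unfolding evol_def[abs_def]
    by (simp add: coord_deriv_add smooth_on_sum smooth_drift smooth_MU U coord_deriv_sum drift
         coord_deriv_bilinear[OF M_smooth U bounded_bilinear_blinfun_apply])
  then show "coord_deriv j (evol U) y = evol (coord_deriv j U) y - q j *\<^sub>R coord_deriv j U y
     + blinfun_apply (coord_deriv j M y) (U y)"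
    unfolding evol_def by (simp add: sum_subtractf)
qed

lemma coord_derivs_evol:
  "\<exists>R. lower_order_op (length \<beta>) R \<and> (\<forall>U. smooth U \<longrightarrow>
     coord_derivs \<beta> (evol U) = (\<lambda>y. evol (coord_derivs \<beta> U) y
       - sum_list (map q \<beta>) *\<^sub>R coord_derivs \<beta> U y + R U y))"
proof (induction \<beta>)
  case Nil
  then show ?case by (intro exI[of _ "\<lambda>U y. 0"]) (auto intro: lower_order_op.zero)
next
  case (Cons j \<beta>)
  then obtain R where R: "lower_order_op (length \<beta>) R" "\<And>U. smooth U \<Longrightarrow>
     coord_derivs \<beta> (evol U) = (\<lambda>y. evol (coord_derivs \<beta> U) y
       - sum_list (map q \<beta>) *\<^sub>R coord_derivs \<beta> U y + R U y)" by blast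
  obtain R' where R': "lower_order_op (Suc (length \<beta>)) R'"
    "\<And>U. smooth U \<Longrightarrow> coord_deriv j (R U) = R' U"
    using lower_order_op_deriv[OF R(1)] by blast
  have "lower_order_op (length (j # \<beta>)) (\<lambda>U y. blinfun_apply (coord_deriv j M y) (coord_derivs \<beta> U y) + R' U y)"
    by (intro lower_order_op.step smooth_coord_deriv M_smooth) (use R' in auto)
  moreover have "coord_derivs (j # \<beta>) (evol U) = (\<lambda>y. evol (coord_derivs (j # \<beta>) U) y
       - sum_list (map q (j # \<beta>)) *\<^sub>R coord_derivs (j # \<beta>) U y
       + (blinfun_apply (coord_deriv j M y) (coord_derivs \<beta> U y) + R' U y))" if U: "smooth U" for U
  proof -
    have sU: "smooth (coord_derivs \<beta> U)" by (rule smooth_coord_derivs[OF U])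
    have "coord_derivs (j # \<beta>) (evol U) = coord_deriv j (\<lambda>y. (evol (coord_derivs \<beta> U) y
       + (- sum_list (map q \<beta>)) *\<^sub>R coord_derivs \<beta> U y) + R U y)"
      using R(2)[OF U] by simp
    also have "\<dots> = (\<lambda>y. (coord_deriv j (evol (coord_derivs \<beta> U)) y
       + (- sum_list (map q \<beta>)) *\<^sub>R coord_deriv j (coord_derivs \<beta> U) y) + coord_deriv j (R U) y)"
      by (simp only: coord_deriv_add smooth_on_add smooth_evol sU smooth_on_scaleR_const open_UNIV
         lower_order_op_smooth[OF R(1) U] coord_deriv_bounded_linear[OF sU bounded_linear_scaleR_right])
    finally show ?thesis
      by (simp add: coord_deriv_evol[OF sU] R'(2)[OF U] algebra_simps)
  qed
  ultimately show ?case by blast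
qed

lemma flux_has_derivative:
  assumes U: "smooth U"
  shows "(flux k U has_derivative (\<lambda>v. q k * v $ k * (U y \<bullet> U y)
      + 2 * (q k * y $ k * (U y \<bullet> frechet_derivative U (at y) v))
      - 2 * (S k (frechet_derivative U (at y) v) \<bullet> U y))) (at y)"
proof -
  have dU: "(U has_derivative frechet_derivative U (at y)) (at y)" by (rule smooth_has_derivative[OF U])
  have dy: "((\<lambda>y. q k * y $ k) has_derivative (\<lambda>v. q k * v $ k)) (at y)"
    by (rule bounded_linear.has_derivative[OF bounded_linear_coordinate has_derivative_ident])
  have "((\<lambda>y. q k * y $ k * (U y \<bullet> U y) - S k (U y) \<bullet> U y) has_derivative
     (\<lambda>v. (q k * y $ k * (U y \<bullet> frechet_derivative U (at y) v + frechet_derivative U (at y) v \<bullet> U y)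
         + q k * v $ k * (U y \<bullet> U y))
       - (S k (U y) \<bullet> frechet_derivative U (at y) v + S k (frechet_derivative U (at y) v) \<bullet> U y))) (at y)"
    by (intro has_derivative_diff has_derivative_mult has_derivative_inner dU dy
        bounded_linear.has_derivative[OF S_bounded_linear])
  moreover have "S k (U y) \<bullet> v = S k v \<bullet> U y" for v using S_sym[of k "U y" v] by (simp add: inner_commute)
  ultimately show ?thesis
    unfolding flux_def[abs_def] by (simp add: inner_commute algebra_simps)
qed

lemma flux_lower_bound:
  assumes "\<rho> \<le> y $ k"
  shows "(q k * y $ k - 1) * (U y \<bullet> U y) \<le> flux k U y" "0 \<le> q k * y $ k - 1"
proof -
  show "(q k * y $ k - 1) * (U y \<bullet> U y) \<le> flux k U y"
    using S_bound[of k "U y"] by (simp add: flux_def left_diff_distrib)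
  show "0 \<le> q k * y $ k - 1"
    using rho[of k] assms q_pos[of k] by (smt (verit) mult_left_mono)
qed

lemma flux_upper_bound:
  assumes "\<rho> \<le> - (y $ k)"
  shows "flux k U y \<le> - ((q k * (- (y $ k)) - 1) * (U y \<bullet> U y))" "0 \<le> q k * (- (y $ k)) - 1"
proof -
  show "flux k U y \<le> - ((q k * (- (y $ k)) - 1) * (U y \<bullet> U y))"
    using S_bound[of k "U y"] by (simp add: flux_def left_diff_distrib)
  show "0 \<le> q k * (- (y $ k)) - 1"
    using rho[of k] assms q_pos[of k] by (smt (verit) mult_left_mono)
qed

lemma flux_nonneg: "\<rho> \<le> y $ k \<Longrightarrow> 0 \<le> flux k U y"
  using flux_lower_bound[of y k] by (meson inner_ge_zero mult_nonneg_nonneg order_trans)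

lemma flux_nonpos: "\<rho> \<le> - (y $ k) \<Longrightarrow> flux k U y \<le> 0"
  using flux_upper_bound[of y k] by (meson inner_ge_zero mult_nonneg_nonneg neg_le_0_iff_le order_trans)

text \<open>The divergence of \<open>\<phi>\<close> times the flux has nonnegative integral over every cube on whose faces the flux
  points outward, and the integrand is computed from the equation. The choice \<open>\<phi> = 1\<close> gives the basic
  energy estimate; a rapidly decreasing \<open>\<phi>\<close> gives unique continuation.\<close>

lemma weighted_energy_inequality:
  assumes U: "smooth U" and r: "\<rho> < r"
    and \<phi>: "\<And>y. 0 \<le> \<phi> y" "\<And>y. (\<phi> has_derivative \<phi>' y) (at y)"
      "\<And>k. continuous_on UNIV (\<lambda>y. \<phi>' y (axis k 1))"
  shows "0 \<le> integral (cube r) (\<lambda>y. \<phi> y * (sum q UNIV * (U y \<bullet> U y) + 2 * (U y \<bullet> blinfun_apply (M y) (U y))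
      - 2 * (U y \<bullet> evol U y)) + (\<Sum>k\<in>UNIV. \<phi>' y (axis k 1) * flux k U y))"
proof -
  define f' where "f' k y = q k * (U y \<bullet> U y) + 2 * (q k * y $ k * (U y \<bullet> coord_deriv k U y))
      - 2 * (S k (coord_deriv k U y) \<bullet> U y)" for k y
  have c\<phi>: "continuous_on UNIV \<phi>"
    using \<phi>(2) by (meson continuous_at_imp_continuous_on has_derivative_continuous)
  have cU: "continuous_on UNIV U" "continuous_on UNIV (coord_deriv k U)" for k
    using U by (auto intro!: smooth_continuous smooth_coord_deriv)
  have cS: "continuous_on UNIV (\<lambda>y. S k (f y))" if "continuous_on UNIV f" for f :: "real^'n \<Rightarrow> 'b" and k
    by (rule bounded_linear.continuous_on[OF S_bounded_linear that])
  have cflux: "continuous_on UNIV (flux k U)" for k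
    unfolding flux_def[abs_def] by (intro continuous_intros cU cS)
  have cf': "continuous_on UNIV (f' k)" for k
    unfolding f'_def[abs_def] by (intro continuous_intros cU cS)
  have c: "continuous_on UNIV (\<lambda>y. \<phi> y * f' k y + \<phi>' y (axis k 1) * flux k U y)" for k
    by (intro continuous_intros c\<phi> cf' cflux \<phi>)
  have key: "0 \<le> integral (cube r) (\<lambda>y. \<phi> y * f' k y + \<phi>' y (axis k 1) * flux k U y)" for k
  proof -
    define F' where "F' y v = \<phi> y * (q k * v $ k * (U y \<bullet> U y)
      + 2 * (q k * y $ k * (U y \<bullet> frechet_derivative U (at y) v))
      - 2 * (S k (frechet_derivative U (at y) v) \<bullet> U y)) + \<phi>' y v * flux k U y" for y v
    have F': "F' y (axis k 1) = \<phi> y * f' k y + \<phi>' y (axis k 1) * flux k U y" for y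
      by (simp add: F'_def f'_def coord_deriv_def)
    have "0 \<le> integral (cube r) (\<lambda>y. F' y (axis k 1))"
      unfolding cube_def
    proof (rule integral_derivative_nonneg[where F="\<lambda>y. \<phi> y * flux k U y" and e="-\<rho>"])
      show "((\<lambda>y. \<phi> y * flux k U y) has_derivative F' y) (at y)" for y
        unfolding F'_def[abs_def]
        by (rule has_derivative_mult[OF \<phi>(2) flux_has_derivative[OF U]])
      show "continuous_on UNIV (\<lambda>y. F' y (axis k 1))" unfolding F' by (rule c)
    qed (use r flux_nonneg flux_nonpos \<phi>(1) in \<open>auto simp: inner_axis axis_in_Basis_iff intro: mult_nonneg_nonneg mult_nonneg_nonpos\<close>)
    then show ?thesis by (simp add: F')
  qed
  have "(\<Sum>k\<in>UNIV. \<phi> y * f' k y + \<phi>' y (axis k 1) * flux k U y)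
    = \<phi> y * (sum q UNIV * (U y \<bullet> U y) + 2 * (U y \<bullet> blinfun_apply (M y) (U y))
      - 2 * (U y \<bullet> evol U y)) + (\<Sum>k\<in>UNIV. \<phi>' y (axis k 1) * flux k U y)" for y
  proof -
    have "U y \<bullet> evol U y = (\<Sum>k\<in>UNIV. S k (coord_deriv k U y) \<bullet> U y)
        - (\<Sum>k\<in>UNIV. q k * y $ k * (U y \<bullet> coord_deriv k U y))
       + U y \<bullet> blinfun_apply (M y) (U y)"
      by (simp add: evol_def inner_add_right inner_sum_right inner_diff_right inner_commute sum_subtractf)
    moreover have "(\<Sum>k\<in>UNIV. f' k y) = sum q UNIV * (U y \<bullet> U y)
        + 2 * (\<Sum>k\<in>UNIV. q k * y $ k * (U y \<bullet> coord_deriv k U y))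
        - 2 * (\<Sum>k\<in>UNIV. S k (coord_deriv k U y) \<bullet> U y)"
      by (simp add: f'_def sum.distrib sum_subtractf sum_distrib_left sum_distrib_right)
    ultimately have "(\<Sum>k\<in>UNIV. f' k y) = sum q UNIV * (U y \<bullet> U y) + 2 * (U y \<bullet> blinfun_apply (M y) (U y))
      - 2 * (U y \<bullet> evol U y)" by linarith
    then show ?thesis by (simp add: sum.distrib flip: sum_distrib_left)
  qed
  then have "integral (cube r) (\<lambda>y. \<phi> y * (sum q UNIV * (U y \<bullet> U y) + 2 * (U y \<bullet> blinfun_apply (M y) (U y))
      - 2 * (U y \<bullet> evol U y)) + (\<Sum>k\<in>UNIV. \<phi>' y (axis k 1) * flux k U y))
    = (\<Sum>k\<in>UNIV. integral (cube r) (\<lambda>y. \<phi> y * f' k y + \<phi>' y (axis k 1) * flux k U y))"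
    by (subst integral_sum[symmetric]) (auto intro!: integrable_on_cube c)
  also have "\<dots> \<ge> 0" by (intro sum_nonneg key)
  finally show ?thesis .
qed

end

lemma norm_frechet_derivative_le:
  fixes w :: "real^'n::finite \<Rightarrow> 'b::euclidean_space"
  assumes "smooth w"
  shows "(norm (frechet_derivative w (at y) v))\<^sup>2 \<le> (norm v)\<^sup>2 * (\<Sum>j\<in>UNIV. (norm (coord_deriv j w y))\<^sup>2)"
proof -
  have lin: "linear (frechet_derivative w (at y))"
    using smooth_has_derivative[OF assms] has_derivative_linear by blast
  have "frechet_derivative w (at y) v = frechet_derivative w (at y) (\<Sum>j\<in>UNIV. (v $ j) *\<^sub>R axis j 1)"
    by (metis basis_expansion scalar_mult_eq_scaleR)
  also have "\<dots> = (\<Sum>j\<in>UNIV. (v $ j) *\<^sub>R coord_deriv j w y)"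
    by (simp add: linear_sum[OF lin] linear_scale[OF lin] coord_deriv_def)
  finally have "norm (frechet_derivative w (at y) v) \<le> (\<Sum>j\<in>UNIV. \<bar>v $ j\<bar> * norm (coord_deriv j w y))"
    by (metis (no_types, lifting) norm_scaleR norm_sum sum.cong)
  then have "(norm (frechet_derivative w (at y) v))\<^sup>2 \<le> (\<Sum>j\<in>UNIV. \<bar>v $ j\<bar> * norm (coord_deriv j w y))\<^sup>2"
    by (intro power_mono) auto
  also have "\<dots> \<le> (\<Sum>j\<in>UNIV. \<bar>v $ j\<bar>\<^sup>2) * (\<Sum>j\<in>UNIV. (norm (coord_deriv j w y))\<^sup>2)"
    by (rule Cauchy_Schwarz_ineq_sum)
  also have "(\<Sum>j\<in>UNIV. \<bar>v $ j\<bar>\<^sup>2) = (norm v)\<^sup>2"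
    unfolding power2_norm_eq_inner by (simp add: inner_vec_def power2_eq_square)
  finally show ?thesis .
qed

lemma integral_null_cbox:
  fixes f :: "'a::euclidean_space \<Rightarrow> 'b::banach"
  shows "measure lborel (cbox a b) = 0 \<Longrightarrow> integral (cbox a b) f = 0"
  by (rule integral_unique) (rule has_integral_null)

text \<open>The quantitative form of the compactness of the embedding of \<open>H\<^sup>1\<close> into \<open>L\<^sup>2\<close>: up to a small multiple
  of the gradient, the \<open>L\<^sup>2\<close> norm on a cube is controlled by finitely many linear functionals, the
  integrals over the cells of a fine division.\<close>

lemma approximate_by_cell_means:
  fixes r \<epsilon> :: real
  assumes "\<epsilon> > 0"
  shows "\<exists>D :: (real^'n::finite) set set. finite D \<and> (\<forall>B\<in>D. B \<subseteq> cube r \<and> (\<exists>a b. B = cbox a b)) \<and>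
     (\<forall>w :: real^'n \<Rightarrow> 'b::euclidean_space. smooth w \<longrightarrow>
       integral (cube r) (\<lambda>y. (norm (w y))\<^sup>2)
        \<le> \<epsilon> * (\<Sum>j\<in>UNIV. integral (cube r) (\<lambda>y. (norm (coord_deriv j w y))\<^sup>2))
          + (\<Sum>B\<in>D. (norm (integral B w))\<^sup>2 / measure lborel B))"
proof -
  \<comment> \<open>The mesh size for which the constant of the Poincare inequality is \<open>\<epsilon>\<close>.\<close>
  define \<delta> where "\<delta> = sqrt (\<epsilon> / 2 ^ DIM(real^'n))"
  have \<delta>: "\<delta> > 0" "\<delta>\<^sup>2 * 2 ^ DIM(real^'n) = \<epsilon>" using assms by (auto simp: \<delta>_def)
  obtain p where p: "p tagged_division_of (cube r :: (real^'n) set)" "(\<lambda>x. ball x (\<delta>/2)) fine p"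
    unfolding cube_def using fine_division_exists[OF gauge_ball[of "\<delta>/2"]] \<delta>(1) by (metis half_gt_zero)
  define D where "D = snd ` p"
  have D: "D division_of cube r" unfolding D_def by (rule division_of_tagged_division[OF p(1)])
  have fin: "finite D" and sub: "\<And>B. B \<in> D \<Longrightarrow> B \<subseteq> cube r" and box: "\<And>B. B \<in> D \<Longrightarrow> \<exists>a b. B = cbox a b"
    using division_ofD[OF D] by blast+
  have diam: "norm (y - z) \<le> \<delta>" if "B \<in> D" "y \<in> B" "z \<in> B" for B y z
  proof -
    from that(1) obtain x where "(x, B) \<in> p" by (auto simp: D_def)
    then have "B \<subseteq> ball x (\<delta>/2)" using p(2) by (auto simp: fine_def)
    then have "dist x y < \<delta>/2" "dist x z < \<delta>/2" using that by auto
    then have "dist y z < \<delta>" using dist_triangle3[of y z x] by (simp add: dist_commute)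
    then show ?thesis by (simp add: dist_norm)
  qed
  have "integral (cube r) (\<lambda>y. (norm (w y))\<^sup>2)
        \<le> \<epsilon> * (\<Sum>j\<in>UNIV. integral (cube r) (\<lambda>y. (norm (coord_deriv j w y))\<^sup>2))
          + (\<Sum>B\<in>D. (norm (integral B w))\<^sup>2 / measure lborel B)"
    if w: "smooth w" for w :: "real^'n \<Rightarrow> 'b"
  proof -
    define G where "G y = (\<Sum>j\<in>UNIV. (norm (coord_deriv j w y))\<^sup>2)" for y
    have cG: "continuous_on UNIV G"
      unfolding G_def[abs_def] by (intro continuous_intros smooth_continuous smooth_coord_deriv w)
    have cw: "continuous_on UNIV (\<lambda>y. (norm (w y))\<^sup>2)"
      by (intro continuous_intros smooth_continuous w)
    \<comment> \<open>Degenerate cells have measure zero; there all integrals vanish, and so does the quotient by convention.\<close>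
    have cell: "integral B (\<lambda>y. (norm (w y))\<^sup>2) \<le> \<epsilon> * integral B G + (norm (integral B w))\<^sup>2 / measure lborel B"
      if B: "B \<in> D" for B
    proof -
      obtain a b where ab: "B = cbox a b" using box[OF B] by blast
      show ?thesis
      proof (cases "measure lborel B = 0")
        case True
        then show ?thesis using integral_null_cbox[of a b] by (simp add: ab)
      next
        case False
        define m where "m = measure lborel B"
        have m: "m > 0" using False by (simp add: m_def zero_less_measure_iff)
        have "m * integral B (\<lambda>y. (norm (w y))\<^sup>2) \<le> (norm (integral B w))\<^sup>2 + m * (\<epsilon> * integral B G)"
          unfolding ab m_def \<delta>(2)[symmetric]
          by (rule poincare_cbox[OF smooth_has_derivative[OF w] cG])
             (use diam[OF B] norm_frechet_derivative_le[OF w] ab in \<open>auto simp: G_def sum_nonneg\<close>)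
        then show ?thesis using m by (simp add: field_simps flip: m_def)
      qed
    qed
    have "integral (cube r) (\<lambda>y. (norm (w y))\<^sup>2) = (\<Sum>B\<in>D. integral B (\<lambda>y. (norm (w y))\<^sup>2))"
      by (rule integral_combine_division_topdown[OF integrable_on_cube[OF cw] D])
    also have "\<dots> \<le> (\<Sum>B\<in>D. \<epsilon> * integral B G + (norm (integral B w))\<^sup>2 / measure lborel B)"
      by (rule sum_mono[OF cell])
    also have "\<dots> = \<epsilon> * (\<Sum>B\<in>D. integral B G) + (\<Sum>B\<in>D. (norm (integral B w))\<^sup>2 / measure lborel B)"
      by (simp add: sum.distrib sum_distrib_left)
    also have "(\<Sum>B\<in>D. integral B G) = integral (cube r) G"
      by (rule integral_combine_division_topdown[OF integrable_on_cube[OF cG] D, symmetric])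
    also have "integral (cube r) G = (\<Sum>j\<in>UNIV. integral (cube r) (\<lambda>y. (norm (coord_deriv j w y))\<^sup>2))"
      unfolding G_def[abs_def]
      by (rule integral_sum) (simp, intro integrable_on_cube continuous_intros smooth_continuous smooth_coord_deriv w)
    finally show ?thesis .
  qed
  with fin sub box show ?thesis by (intro exI[of _ D]) blast
qed

lemma integral_squared_le:
  fixes f :: "'a::euclidean_space \<Rightarrow> real"
  assumes "continuous_on UNIV f"
  shows "(integral (cbox a b) f)\<^sup>2 \<le> measure lborel (cbox a b) * integral (cbox a b) (\<lambda>y. (f y)\<^sup>2)"
proof (cases "measure lborel (cbox a b) = 0")
  case True
  then show ?thesis using integral_null_cbox[of a b] by simp
next
  case False
  define m where "m = measure lborel (cbox a b)"
  have m: "m > 0" using False by (simp add: m_def zero_less_measure_iff)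
  define i where "i = integral (cbox a b) f"
  have int: "g integrable_on cbox a b" if "continuous_on UNIV g" for g :: "'a \<Rightarrow> real"
    by (rule integrable_on_cbox_continuous[OF that])
  have "0 \<le> integral (cbox a b) (\<lambda>y. (f y - i / m)\<^sup>2)"
    by (intro integral_nonneg int continuous_intros assms) auto
  also have "(\<lambda>y. (f y - i / m)\<^sup>2) = (\<lambda>y. ((f y)\<^sup>2 + (i/m)\<^sup>2) - 2 * (i / m) * f y)"
    by (simp add: power2_diff algebra_simps)
  also have "integral (cbox a b) \<dots> = integral (cbox a b) (\<lambda>y. (f y)\<^sup>2) + m * (i/m)\<^sup>2 - 2 * (i / m) * i"
    by (subst integral_diff, (intro int continuous_intros assms)+, subst integral_add)
       (auto intro!: int continuous_intros assms simp: i_def m_def)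
  finally have "i\<^sup>2 / m \<le> integral (cbox a b) (\<lambda>y. (f y)\<^sup>2)"
    using m by (simp add: power2_eq_square field_simps)
  then show ?thesis using m by (simp add: i_def[symmetric] m_def[symmetric] field_simps)
qed

context transport_system
begin

abbreviation "Om \<equiv> cube (\<rho> + 1) :: (real^'n) set"

lemma MU_inner_le:
  assumes "norm (M y) \<le> m"
  shows "x \<bullet> blinfun_apply (M y) x \<le> m * (x \<bullet> x)"
proof -
  have "x \<bullet> blinfun_apply (M y) x \<le> norm x * (norm (M y) * norm x)"
    by (meson mult_left_mono norm_blinfun norm_cauchy_schwarz norm_ge_zero order_trans)
  also have "\<dots> \<le> norm x * (m * norm x)"
    using assms by (intro mult_left_mono mult_right_mono) auto
  also have "\<dots> = m * (x \<bullet> x)" by (simp add: dot_square_norm power2_eq_square)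
  finally show ?thesis .
qed

text \<open>The growth constant does not depend on the number of derivatives taken of \<open>U\<close>, since the commutator
  formula brings in only damping and lower-order terms. This is what lets the damping win at high order.\<close>

lemma energy_inequality:
  "\<exists>c. \<forall>U. smooth U \<longrightarrow> integral Om (\<lambda>y. evol U y \<bullet> U y) \<le> c * integral Om (\<lambda>y. U y \<bullet> U y)"
proof -
  obtain m where m: "m \<ge> 0" "\<And>y. y \<in> Om \<Longrightarrow> norm (M y) \<le> m"
    using norm_blinfun_bounded_on_cube[OF M_smooth] by blast
  define c where "c = sum q UNIV / 2 + m"
  have "integral Om (\<lambda>y. evol U y \<bullet> U y) \<le> c * integral Om (\<lambda>y. U y \<bullet> U y)" if U: "smooth U" for U
  proof -
    have c0: "continuous_on UNIV U" "continuous_on UNIV (evol U)" "continuous_on UNIV (\<lambda>y. blinfun_apply (M y) (U y))"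
      using U by (auto intro: smooth_continuous smooth_evol smooth_MU)
    have "0 \<le> integral Om (\<lambda>y. 1 * (sum q UNIV * (U y \<bullet> U y) + 2 * (U y \<bullet> blinfun_apply (M y) (U y))
      - 2 * (U y \<bullet> evol U y)) + (\<Sum>k\<in>UNIV. 0 * flux k U y))"
      using weighted_energy_inequality[OF U, of "\<rho> + 1" "\<lambda>_. 1" "\<lambda>_ _. 0"] by auto
    also have "\<dots> \<le> integral Om (\<lambda>y. 2 * c * (U y \<bullet> U y) - 2 * (evol U y \<bullet> U y))"
    proof (intro integral_le integrable_on_cube)
      fix y assume y: "y \<in> Om"
      show "1 * (sum q UNIV * (U y \<bullet> U y) + 2 * (U y \<bullet> blinfun_apply (M y) (U y))
      - 2 * (U y \<bullet> evol U y)) + (\<Sum>k\<in>UNIV. 0 * flux k U y) \<le> 2 * c * (U y \<bullet> U y) - 2 * (evol U y \<bullet> U y)"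
        using MU_inner_le[OF m(2)[OF y], of "U y"] by (simp add: c_def inner_commute distrib_right)
    qed (auto intro!: continuous_intros c0)
    also have "\<dots> = 2 * c * integral Om (\<lambda>y. U y \<bullet> U y) - 2 * integral Om (\<lambda>y. evol U y \<bullet> U y)"
      by (subst integral_diff) (auto intro!: integrable_on_cube continuous_intros c0)
    finally show ?thesis by simp
  qed
  then show ?thesis by blast
qed

text \<open>The inner product of the Sobolev space \<open>H\<^sup>N\<close> of the cube, summed over words of coordinate
  directions rather than over multi-indices. The words allow induction one derivative at a time, and
  counting a mixed derivative several times only gives an equivalent norm.\<close>

definition sob :: "nat \<Rightarrow> (real^'n \<Rightarrow> 'b) \<Rightarrow> (real^'n \<Rightarrow> 'b) \<Rightarrow> real" where
  "sob N U V = (\<Sum>\<beta>\<in>short_lists (Suc N). integral Om (\<lambda>y. coord_derivs \<beta> U y \<bullet> coord_derivs \<beta> V y))"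

definition seminorm2 :: "'n list \<Rightarrow> (real^'n \<Rightarrow> 'b) \<Rightarrow> real" where
  "seminorm2 \<beta> U = integral Om (\<lambda>y. (norm (coord_derivs \<beta> U y))\<^sup>2)"

lemma continuous_coord_derivs: "smooth U \<Longrightarrow> continuous_on X (coord_derivs \<beta> U)"
  by (intro smooth_continuous smooth_coord_derivs)

lemma seminorm2_nonneg: "smooth U \<Longrightarrow> 0 \<le> seminorm2 \<beta> U"
  unfolding seminorm2_def
  by (intro integral_nonneg integrable_on_cube continuous_intros continuous_coord_derivs) auto

lemma sob_eq: "sob N U U = (\<Sum>\<beta>\<in>short_lists (Suc N). seminorm2 \<beta> U)"
  by (simp add: sob_def seminorm2_def dot_square_norm)

lemma seminorm2_le_sob: "smooth U \<Longrightarrow> length \<beta> \<le> N \<Longrightarrow> seminorm2 \<beta> U \<le> sob N U U"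
  unfolding sob_eq
  by (rule member_le_sum) (auto simp: short_lists_def intro: finite_short_lists[unfolded short_lists_def] seminorm2_nonneg)

lemma sob_nonneg: "smooth U \<Longrightarrow> 0 \<le> sob N U U"
  unfolding sob_eq by (intro sum_nonneg seminorm2_nonneg)

lemma sob_commute: "sob N U V = sob N V U"
  by (simp add: sob_def inner_commute)

lemma sob_add_left:
  assumes "smooth U" "smooth U'" "smooth V"
  shows "sob N (\<lambda>y. U y + U' y) V = sob N U V + sob N U' V"
  unfolding sob_def sum.distrib[symmetric] coord_derivs_add[OF assms(1,2)] inner_add_left
  by (intro sum.cong refl integral_add integrable_on_cube continuous_intros continuous_coord_derivs assms)

lemma sob_scaleR_left:
  assumes "smooth U"
  shows "sob N (\<lambda>y. c *\<^sub>R U y) V = c * sob N U V"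
  unfolding sob_def coord_derivs_bounded_linear[OF assms bounded_linear_scaleR_right]
  by (simp add: sum_distrib_left)

lemma sob_sum_left:
  assumes "\<And>i. i \<in> I \<Longrightarrow> smooth (v i)" "smooth V"
  shows "sob N (\<lambda>y. \<Sum>i\<in>I. c i *\<^sub>R v i y) V = (\<Sum>i\<in>I. c i * sob N (v i) V)"
  using assms
proof (induction I rule: infinite_finite_induct)
  case (insert x F)
  then show ?case
    by (simp add: sob_add_left sob_scaleR_left smooth_on_scaleR_const smooth_on_sum)
next
  case (infinite A)
  then show ?case using sob_scaleR_left[of V N 0 V] by simp
next
  case empty
  then show ?case using sob_scaleR_left[of V N 0 V] by simp
qed

text \<open>For a word \<open>\<beta>\<close> of length \<open>N\<close> the commutator formula contributes damping of at least
  \<open>N * Min (range q)\<close>. For large \<open>N\<close> this exceeds \<open>\<alpha>\<close> plus the growth constant of the basic energy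
  estimate, so that the top-order part of the norm decays at rate \<open>\<alpha>\<close>. All remaining terms involve
  fewer derivatives and are collected on the right.\<close>

lemma damped_energy_inequality:
  "\<exists>N C. 0 \<le> C \<and> (\<forall>U. smooth U \<longrightarrow>
     sob N (evol U) U \<le> - \<alpha> * sob N U U + C * (\<Sum>\<beta>\<in>short_lists N. seminorm2 \<beta> U))"
proof -
  obtain c where c: "\<And>U. smooth U \<Longrightarrow> integral Om (\<lambda>y. evol U y \<bullet> U y) \<le> c * integral Om (\<lambda>y. U y \<bullet> U y)"
    using energy_inequality by blast
  define low where "low k U = (\<Sum>\<gamma>\<in>short_lists k. seminorm2 \<gamma> U)" for k U
  have low_mono: "low k U \<le> low l U" if "k \<le> l" "smooth U" for k l U
    unfolding low_def using that
    by (intro sum_mono2 finite_short_lists seminorm2_nonneg) (auto simp: short_lists_def)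
  have low0: "0 \<le> low k U" if "smooth U" for k U
    unfolding low_def using that by (intro sum_nonneg seminorm2_nonneg)
  have "\<exists>C\<ge>0. \<forall>U. smooth U \<longrightarrow> integral Om (\<lambda>y. coord_derivs \<beta> (evol U) y \<bullet> coord_derivs \<beta> U y)
     \<le> (c + 1/2 - sum_list (map q \<beta>)) * seminorm2 \<beta> U + C * low (length \<beta>) U" for \<beta>
  proof -
    obtain R where R: "lower_order_op (length \<beta>) R"
      "\<And>U. smooth U \<Longrightarrow> coord_derivs \<beta> (evol U) = (\<lambda>y. evol (coord_derivs \<beta> U) y
       - sum_list (map q \<beta>) *\<^sub>R coord_derivs \<beta> U y + R U y)"
      using coord_derivs_evol by blast
    obtain C where C: "C \<ge> 0" "\<And>U y. y \<in> Om \<Longrightarrow>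
        (norm (R U y))\<^sup>2 \<le> C * (\<Sum>\<gamma>\<in>short_lists (length \<beta>). (norm (coord_derivs \<gamma> U y))\<^sup>2)"
      using lower_order_op_bound[OF R(1)] by blast
    have "integral Om (\<lambda>y. coord_derivs \<beta> (evol U) y \<bullet> coord_derivs \<beta> U y)
     \<le> (c + 1/2 - sum_list (map q \<beta>)) * seminorm2 \<beta> U + C * low (length \<beta>) U" if U: "smooth U" for U
    proof -
      let ?W = "coord_derivs \<beta> U" and ?s = "sum_list (map q \<beta>)"
      have W: "smooth ?W" by (rule smooth_coord_derivs[OF U])
      have cont: "continuous_on UNIV ?W" "continuous_on UNIV (evol ?W)"
         "continuous_on UNIV (coord_derivs \<gamma> U)" "continuous_on UNIV (coord_derivs \<beta> (evol U))" for \<gamma>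
        using W U by (auto intro!: smooth_continuous smooth_evol smooth_coord_derivs)
      have "integral Om (\<lambda>y. coord_derivs \<beta> (evol U) y \<bullet> ?W y)
        \<le> integral Om (\<lambda>y. evol ?W y \<bullet> ?W y + ((1/2 - ?s) * (norm (?W y))\<^sup>2
            + C * (\<Sum>\<gamma>\<in>short_lists (length \<beta>). (norm (coord_derivs \<gamma> U y))\<^sup>2)))"
      proof (intro integral_le integrable_on_cube)
        fix y assume y: "y \<in> Om"
        have "R U y \<bullet> ?W y \<le> norm (R U y) * norm (?W y)" by (rule norm_cauchy_schwarz)
        also have "\<dots> \<le> 1/2 * (norm (R U y))\<^sup>2 + 1/2 * (norm (?W y))\<^sup>2"
          using sum_squares_bound[of "norm (R U y)" "norm (?W y)"] by simp
        also have "\<dots> \<le> 1 * (norm (R U y))\<^sup>2 + 1/2 * (norm (?W y))\<^sup>2" by simp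
        finally show "coord_derivs \<beta> (evol U) y \<bullet> ?W y \<le> evol ?W y \<bullet> ?W y + ((1/2 - ?s) * (norm (?W y))\<^sup>2
            + C * (\<Sum>\<gamma>\<in>short_lists (length \<beta>). (norm (coord_derivs \<gamma> U y))\<^sup>2))"
          using C(2)[OF y, of U]
          by (simp add: R(2)[OF U] inner_add_left inner_diff_left dot_square_norm left_diff_distrib)
      qed (auto intro!: continuous_intros cont)
      also have "\<dots> = integral Om (\<lambda>y. evol ?W y \<bullet> ?W y) + ((1/2 - ?s) * seminorm2 \<beta> U
          + C * integral Om (\<lambda>y. \<Sum>\<gamma>\<in>short_lists (length \<beta>). (norm (coord_derivs \<gamma> U y))\<^sup>2))"
        by (subst integral_add, (intro integrable_on_cube continuous_intros cont)+, subst integral_add)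
           (auto intro!: integrable_on_cube continuous_intros cont simp: seminorm2_def)
      also have "integral Om (\<lambda>y. \<Sum>\<gamma>\<in>short_lists (length \<beta>). (norm (coord_derivs \<gamma> U y))\<^sup>2) = low (length \<beta>) U"
        unfolding low_def seminorm2_def
        by (rule integral_sum) (auto intro!: integrable_on_cube continuous_intros cont finite_short_lists)
      also have "integral Om (\<lambda>y. evol ?W y \<bullet> ?W y) \<le> c * seminorm2 \<beta> U"
        using c[OF W] by (simp add: seminorm2_def dot_square_norm)
      finally show ?thesis by (simp add: algebra_simps)
    qed
    with C(1) show ?thesis by blast
  qed
  then obtain C where C: "\<And>\<beta>. 0 \<le> C \<beta>" "\<And>\<beta> U. smooth U \<Longrightarrow>
      integral Om (\<lambda>y. coord_derivs \<beta> (evol U) y \<bullet> coord_derivs \<beta> U y)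
     \<le> (c + 1/2 - sum_list (map q \<beta>)) * seminorm2 \<beta> U + C \<beta> * low (length \<beta>) U"
    by metis
  define \<kappa> where "\<kappa> = Min (range q)"
  have \<kappa>: "\<kappa> > 0" "\<kappa> \<le> q k" for k using q_pos by (auto simp: \<kappa>_def)
  have slist: "\<kappa> * length \<beta> \<le> sum_list (map q \<beta>)" for \<beta>
    by (induction \<beta>) (auto simp: distrib_left add_mono \<kappa>(2))
  obtain N where N: "c + 1/2 + \<alpha> \<le> \<kappa> * real N"
    using \<kappa>(1) real_arch_simple[of "(c + 1/2 + \<alpha>) / \<kappa>"] by (auto simp: field_simps)
  define K where "K = \<bar>c\<bar> + 1/2 + \<bar>\<alpha>\<bar>"
  have "sob N (evol U) U \<le> - \<alpha> * sob N U U + (K + sum C (short_lists (Suc N))) * low N U"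
    if U: "smooth U" for U
  proof -
    have "sob N (evol U) U \<le> (\<Sum>\<beta>\<in>short_lists (Suc N). - \<alpha> * seminorm2 \<beta> U
         + (if \<beta> \<in> short_lists N then K * seminorm2 \<beta> U else 0) + C \<beta> * low N U)"
      unfolding sob_def
    proof (rule sum_mono)
      fix \<beta> :: "'n list" assume \<beta>: "\<beta> \<in> short_lists (Suc N)"
      have "C \<beta> * low (length \<beta>) U \<le> C \<beta> * low N U"
        using \<beta> by (intro mult_left_mono low_mono U C(1)) (auto simp: short_lists_def)
      moreover have "(c + 1/2 - sum_list (map q \<beta>)) * seminorm2 \<beta> U
         \<le> (- \<alpha> + (if \<beta> \<in> short_lists N then K else 0)) * seminorm2 \<beta> U"
      proof (rule mult_right_mono[OF _ seminorm2_nonneg[OF U]])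
        have nn: "0 \<le> sum_list (map q \<beta>)" using slist[of \<beta>] \<kappa>(1)
          by (meson less_imp_le mult_nonneg_nonneg of_nat_0_le_iff order_trans)
        show "c + 1/2 - sum_list (map q \<beta>) \<le> - \<alpha> + (if \<beta> \<in> short_lists N then K else 0)"
        proof (cases "\<beta> \<in> short_lists N")
          case True
          then show ?thesis using nn by (simp add: K_def)
        next
          case False
          then have "length \<beta> = N" using \<beta> by (auto simp: short_lists_def)
          then show ?thesis using slist[of \<beta>] N False by simp
        qed
      qed
      ultimately show "integral Om (\<lambda>y. coord_derivs \<beta> (evol U) y \<bullet> coord_derivs \<beta> U y)
        \<le> - \<alpha> * seminorm2 \<beta> U + (if \<beta> \<in> short_lists N then K * seminorm2 \<beta> U else 0) + C \<beta> * low N U"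
        using C(2)[OF U, of \<beta>] by (simp add: distrib_right left_diff_distrib split: if_splits)
    qed
    also have "\<dots> = - \<alpha> * sob N U U
        + (\<Sum>\<beta>\<in>short_lists (Suc N). if \<beta> \<in> short_lists N then K * seminorm2 \<beta> U else 0)
        + sum C (short_lists (Suc N)) * low N U"
      by (simp add: sum.distrib sum_subtractf sob_eq sum_negf sum_distrib_left sum_distrib_right)
    also have "(\<Sum>\<beta>\<in>short_lists (Suc N). if \<beta> \<in> short_lists N then K * seminorm2 \<beta> U else 0) = K * low N U"
    proof -
      have "short_lists (Suc N) \<inter> short_lists N = (short_lists N :: 'n list set)"
        by (auto simp: short_lists_def)
      then show ?thesis
        by (simp add: sum.inter_restrict[OF finite_short_lists, symmetric] low_def sum_distrib_left)
    qed
    finally show ?thesis by (simp add: distrib_right)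
  qed
  moreover have "0 \<le> K + sum C (short_lists (Suc N))"
    unfolding K_def by (intro add_nonneg_nonneg sum_nonneg C) auto
  ultimately show ?thesis unfolding low_def by blast
qed

definition orthonormal :: "nat \<Rightarrow> nat \<Rightarrow> (nat \<Rightarrow> real^'n \<Rightarrow> 'b) \<Rightarrow> bool" where
  "orthonormal N d v \<longleftrightarrow> (\<forall>i<d. smooth (v i)) \<and>
     (\<forall>i<d. \<forall>j<d. sob N (v i) (v j) = (if i = j then 1 else 0))"

text \<open>Bessel's inequality for each component of the functional \<open>v \<mapsto> integral B (coord_derivs \<beta> v)\<close>, whose
  squared norm with respect to \<open>sob N\<close> is at most the volume of \<open>B\<close>.\<close>

lemma bessel_cell:
  assumes v: "orthonormal N d v" and B: "B = cbox a b" "B \<subseteq> Om" and \<beta>: "length \<beta> \<le> N"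
  shows "(\<Sum>i<d. (norm (integral B (coord_derivs \<beta> (v i))))\<^sup>2 / measure lborel B) \<le> DIM('b)"
proof -
  have sv: "smooth (v i)" if "i < d" for i using v that by (simp add: orthonormal_def)
  have on: "sob N (v i) (v j) = (if i = j then 1 else 0)" if "i < d" "j < d" for i j
    using v that by (simp add: orthonormal_def)
  define m where "m = measure lborel B"
  have m: "m \<ge> 0" by (simp add: m_def)
  have one: "(\<Sum>i<d. (integral B (coord_derivs \<beta> (v i)) \<bullet> e)\<^sup>2) \<le> m" if e: "e \<in> Basis" for e
  proof -
    define l where "l i = integral B (coord_derivs \<beta> (v i)) \<bullet> e" for i
    define s where "s = (\<Sum>i<d. (l i)\<^sup>2)"
    \<comment> \<open>The Riesz representative of the functional within the span of the family.\<close>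
    define w where "w = (\<lambda>y. \<Sum>i<d. l i *\<^sub>R v i y)"
    have w: "smooth w" unfolding w_def by (intro smooth_on_sum smooth_on_scaleR_const open_UNIV sv) auto
    have cw: "continuous_on UNIV (coord_derivs \<beta> w)" by (rule continuous_coord_derivs[OF w])
    have "coord_derivs \<beta> w = (\<lambda>y. \<Sum>i<d. l i *\<^sub>R coord_derivs \<beta> (v i) y)"
      unfolding w_def
      by (subst coord_derivs_sum)
         (auto intro!: smooth_on_scaleR_const sv simp: coord_derivs_bounded_linear[OF sv bounded_linear_scaleR_right])
    moreover have "integral B (\<lambda>y. \<Sum>i<d. l i *\<^sub>R coord_derivs \<beta> (v i) y) = (\<Sum>i<d. l i *\<^sub>R integral B (coord_derivs \<beta> (v i)))"
      unfolding B
      by (subst integral_sum)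
         (auto intro!: integrable_on_cbox_continuous continuous_intros continuous_coord_derivs sv)
    ultimately have lw: "integral B (coord_derivs \<beta> w) \<bullet> e = s"
      by (simp add: inner_sum_left s_def l_def power2_eq_square)
    have sw: "sob N w w = s"
    proof -
      have "sob N (v i) w = l i" if i: "i < d" for i
      proof -
        have "sob N w (v i) = (\<Sum>j<d. l j * sob N (v j) (v i))"
          unfolding w_def by (rule sob_sum_left) (use sv i in auto)
        also have "\<dots> = (\<Sum>j<d. if j = i then l j else 0)"
          by (rule sum.cong) (use on i in auto)
        also have "\<dots> = l i" using i by simp
        finally show ?thesis by (simp add: sob_commute)
      qed
      moreover have "sob N w w = (\<Sum>j<d. l j * sob N (v j) w)"
        using sob_sum_left[of "{..<d}" v w N l] sv w unfolding w_def by auto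
      ultimately show ?thesis by (simp add: s_def power2_eq_square)
    qed
    have iw: "coord_derivs \<beta> w integrable_on B" unfolding B by (rule integrable_on_cbox_continuous[OF cw])
    have "s\<^sup>2 = (integral B (\<lambda>y. coord_derivs \<beta> w y \<bullet> e))\<^sup>2"
      using integral_component_eq[OF iw, of e] by (simp add: lw)
    also have "\<dots> \<le> m * integral B (\<lambda>y. (coord_derivs \<beta> w y \<bullet> e)\<^sup>2)"
      unfolding m_def B(1) by (intro integral_squared_le continuous_intros cw)
    also have "integral B (\<lambda>y. (coord_derivs \<beta> w y \<bullet> e)\<^sup>2) \<le> integral B (\<lambda>y. (norm (coord_derivs \<beta> w y))\<^sup>2)"
      unfolding B(1)
      by (intro integral_le integrable_on_cbox_continuous continuous_intros cw)
         (metis Basis_le_norm e power2_abs power_mono abs_ge_zero)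
    also have "\<dots> \<le> seminorm2 \<beta> w"
      unfolding seminorm2_def
      by (intro integral_subset_le B(2) integrable_on_cube continuous_intros cw,
          unfold B(1), intro integrable_on_cbox_continuous continuous_intros cw) auto
    also have "\<dots> \<le> s" using seminorm2_le_sob[OF w \<beta>] sw by simp
    finally have "s\<^sup>2 \<le> m * s" using m by (simp add: mult_left_mono)
    moreover have "s \<ge> 0" unfolding s_def by (intro sum_nonneg) auto
    ultimately have "s \<le> m"
      using m by (cases "s = 0") (auto simp: power2_eq_square)
    then show ?thesis by (simp add: s_def l_def)
  qed
  have "(\<Sum>i<d. (norm (integral B (coord_derivs \<beta> (v i))))\<^sup>2)
     = (\<Sum>i<d. \<Sum>e\<in>Basis. (integral B (coord_derivs \<beta> (v i)) \<bullet> e)\<^sup>2)"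
    unfolding power2_norm_eq_inner
    by (intro sum.cong refl) (subst euclidean_inner, simp add: power2_eq_square)
  also have "\<dots> = (\<Sum>e\<in>Basis. \<Sum>i<d. (integral B (coord_derivs \<beta> (v i)) \<bullet> e)\<^sup>2)" by (rule sum.swap)
  also have "\<dots> \<le> (\<Sum>e\<in>(Basis::'b set). m)" by (rule sum_mono[OF one])
  also have "\<dots> = DIM('b) * m" by simp
  finally have "(\<Sum>i<d. (norm (integral B (coord_derivs \<beta> (v i))))\<^sup>2) / m \<le> DIM('b)"
    using m by (cases "m = 0") (auto simp: field_simps)
  then show ?thesis by (simp add: m_def sum_divide_distrib)
qed

text \<open>The lower-order form has small trace per dimension with respect to \<open>sob N\<close>, up to a constant: the
  small gradient term contributes at most \<open>\<epsilon>\<close> per orthonormal vector, and the finitely many cell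
  functionals contribute a bounded amount in total.\<close>

lemma trace_seminorm_bound:
  fixes \<epsilon> :: real
  assumes "\<epsilon> > 0" and \<beta>: "length \<beta> < N"
  shows "\<exists>K\<ge>0. \<forall>d v. orthonormal N d v \<longrightarrow> (\<Sum>i<d. seminorm2 \<beta> (v i)) \<le> \<epsilon> * d + K"
proof -
  obtain D :: "(real^'n) set set" where D: "finite D"
    "\<forall>B\<in>D. B \<subseteq> Om \<and> (\<exists>a b. B = cbox a b)"
    "\<forall>w :: real^'n \<Rightarrow> 'b. smooth w \<longrightarrow> integral Om (\<lambda>y. (norm (w y))\<^sup>2)
        \<le> \<epsilon> * (\<Sum>j\<in>UNIV. integral Om (\<lambda>y. (norm (coord_deriv j w y))\<^sup>2))
          + (\<Sum>B\<in>D. (norm (integral B w))\<^sup>2 / measure lborel B)"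
    using approximate_by_cell_means[OF assms(1), of "\<rho> + 1"] by (elim exE conjE) (rule that; assumption)
  have "(\<Sum>i<d. seminorm2 \<beta> (v i)) \<le> \<epsilon> * d + card D * DIM('b)" if v: "orthonormal N d v" for d v
  proof -
    have sv: "smooth (v i)" if "i < d" for i using v that by (simp add: orthonormal_def)
    have "seminorm2 \<beta> (v i) \<le> \<epsilon> * 1 + (\<Sum>B\<in>D. (norm (integral B (coord_derivs \<beta> (v i))))\<^sup>2 / measure lborel B)"
      if i: "i < d" for i
    proof -
      have "(\<Sum>j\<in>UNIV. seminorm2 (j # \<beta>) (v i)) = (\<Sum>\<gamma>\<in>(\<lambda>j. j # \<beta>) ` UNIV. seminorm2 \<gamma> (v i))"
        by (subst sum.reindex) (auto simp: inj_on_def)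
      also have "\<dots> \<le> sob N (v i) (v i)"
        unfolding sob_eq using \<beta>
        by (intro sum_mono2 finite_short_lists seminorm2_nonneg sv i) (auto simp: short_lists_def)
      also have "\<dots> = 1" using v i by (simp add: orthonormal_def)
      finally have "\<epsilon> * (\<Sum>j\<in>UNIV. seminorm2 (j # \<beta>) (v i)) \<le> \<epsilon> * 1"
        using assms(1) by (intro mult_left_mono) auto
      then show ?thesis
        using D(3)[rule_format, OF smooth_coord_derivs[OF sv[OF i]], of \<beta>] by (simp add: seminorm2_def)
    qed
    then have "(\<Sum>i<d. seminorm2 \<beta> (v i))
       \<le> (\<Sum>i<d. \<epsilon> * 1 + (\<Sum>B\<in>D. (norm (integral B (coord_derivs \<beta> (v i))))\<^sup>2 / measure lborel B))"
      by (intro sum_mono) auto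
    also have "\<dots> = \<epsilon> * d + (\<Sum>B\<in>D. \<Sum>i<d. (norm (integral B (coord_derivs \<beta> (v i))))\<^sup>2 / measure lborel B)"
      by (simp add: sum.distrib sum.swap[of _ D])
    also have "(\<Sum>B\<in>D. \<Sum>i<d. (norm (integral B (coord_derivs \<beta> (v i))))\<^sup>2 / measure lborel B) \<le> (\<Sum>B\<in>D. real DIM('b))"
    proof (rule sum_mono)
      fix B assume B: "B \<in> D"
      then obtain a b where "B = cbox a b" using D(2) by blast
      then show "(\<Sum>i<d. (norm (integral B (coord_derivs \<beta> (v i))))\<^sup>2 / measure lborel B) \<le> real DIM('b)"
        using bessel_cell[OF v, of B] D(2) B \<beta> by simp
    qed
    finally show ?thesis by simp
  qed
  then show ?thesis by (intro exI[of _ "real (card D * DIM('b))"]) auto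
qed

text \<open>Summing the damped estimate over an orthonormal family compares two traces. The left-hand side is at
  least \<open>- \<alpha> d\<close>, the damping contributes \<open>- (\<alpha> + 1) d\<close>, and the lower-order terms contribute at most
  \<open>d / 2\<close> plus a constant. Hence \<open>d\<close> is bounded.\<close>

lemma dimension_bound:
  "\<exists>N D. \<forall>d v. orthonormal N d v \<and> (\<forall>i<d. - \<alpha> \<le> sob N (evol (v i)) (v i)) \<longrightarrow> d \<le> D"
proof -
  obtain N C where C: "0 \<le> C" "\<And>U. smooth U \<Longrightarrow>
     sob N (evol U) U \<le> - (\<alpha> + 1) * sob N U U + C * (\<Sum>\<beta>\<in>short_lists N. seminorm2 \<beta> U)"
    using damped_energy_inequality[of "\<alpha> + 1"] by blast
  define n where "n = real (card (short_lists N :: 'n list set))"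
  \<comment> \<open>Chosen so that the lower-order terms use up at most half of the gap \<open>1\<close> between the rates \<open>\<alpha>\<close> and \<open>\<alpha> + 1\<close>.\<close>
  define \<epsilon> where "\<epsilon> = 1 / (2 * (C * n + 1))"
  have n0: "n \<ge> 0" by (simp add: n_def)
  have Cn: "C * n \<ge> 0" using C n0 by simp
  have \<epsilon>: "\<epsilon> > 0" "C * n * \<epsilon> \<le> 1/2" using Cn by (auto simp: \<epsilon>_def field_simps)
  have "\<forall>\<beta>. \<exists>K\<ge>0. length \<beta> < N \<longrightarrow> (\<forall>d v. orthonormal N d v \<longrightarrow> (\<Sum>i<d. seminorm2 \<beta> (v i)) \<le> \<epsilon> * d + K)"
  proof
    fix \<beta> :: "'n list"
    show "\<exists>K\<ge>0. length \<beta> < N \<longrightarrow> (\<forall>d v. orthonormal N d v \<longrightarrow> (\<Sum>i<d. seminorm2 \<beta> (v i)) \<le> \<epsilon> * d + K)"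
      using trace_seminorm_bound[OF \<epsilon>(1), of \<beta> N] by (cases "length \<beta> < N") auto
  qed
  then obtain K where K: "\<And>\<beta>. 0 \<le> K \<beta>" "\<And>\<beta> d v. length \<beta> < N \<Longrightarrow> orthonormal N d v \<Longrightarrow>
      (\<Sum>i<d. seminorm2 \<beta> (v i)) \<le> \<epsilon> * d + K \<beta>"
    unfolding choice_iff by blast
  define K' where "K' = (\<Sum>\<beta>\<in>short_lists N. K \<beta>)"
  have "d \<le> nat \<lceil>2 * C * K'\<rceil>"
    if v: "orthonormal N d v" and ge: "\<And>i. i < d \<Longrightarrow> - \<alpha> \<le> sob N (evol (v i)) (v i)" for d v
  proof -
    have "1 \<le> C * (\<Sum>\<beta>\<in>short_lists N. seminorm2 \<beta> (v i))" if i: "i < d" for i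
    proof -
      have "smooth (v i)" "sob N (v i) (v i) = 1" using v i by (auto simp: orthonormal_def)
      then show ?thesis using C(2)[of "v i"] ge[OF i] by simp
    qed
    then have "(\<Sum>i<d. 1) \<le> (\<Sum>i<d. C * (\<Sum>\<beta>\<in>short_lists N. seminorm2 \<beta> (v i)))"
      by (intro sum_mono) auto
    also have "\<dots> = C * (\<Sum>\<beta>\<in>short_lists N. \<Sum>i<d. seminorm2 \<beta> (v i))"
      unfolding sum_distrib_left[symmetric] by (simp add: sum.swap[of _ "short_lists N"])
    also have "\<dots> \<le> C * (\<Sum>\<beta>\<in>short_lists N. \<epsilon> * d + K \<beta>)"
      by (intro mult_left_mono sum_mono K C v) (auto simp: short_lists_def)
    also have "\<dots> = (C * n * \<epsilon>) * d + C * K'"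
      by (simp add: sum.distrib K'_def n_def algebra_simps)
    also have "\<dots> \<le> (1/2) * d + C * K'"
      using mult_right_mono[OF \<epsilon>(2), of "real d"] by simp
    finally have "real d \<le> 2 * C * K'" by simp
    then show ?thesis by linarith
  qed
  then show ?thesis by blast
qed

text \<open>Derivative of \<open>t \<mapsto> (max 0 (t - \<rho>))\<^sup>2 + (max 0 (- t - \<rho>))\<^sup>2\<close>, a \<open>C\<^sup>1\<close> function that vanishes on
  \<open>[- \<rho>, \<rho>]\<close>, where the flux may have either sign, and grows outside, where the flux points outward.\<close>

definition hinge' :: "real \<Rightarrow> real" where
  "hinge' t = 2 * max 0 (t - \<rho>) - 2 * max 0 (- t - \<rho>)"

lemma hinge_has_derivative:
  "((\<lambda>t. (max 0 (t - \<rho>))\<^sup>2 + (max 0 (- t - \<rho>))\<^sup>2) has_real_derivative hinge' t) (at t)"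
proof -
  have pos: "((\<lambda>x. (max 0 x)\<^sup>2) has_real_derivative 2 * max 0 x) (at x)" for x :: real
  proof (cases "x = 0")
    case True
    have "((\<lambda>h::real. ((max 0 (0 + h))\<^sup>2 - (max 0 0)\<^sup>2) / h) \<longlongrightarrow> 0) (at 0)"
    proof (rule Lim_null_comparison)
      show "\<forall>\<^sub>F h::real in at 0. norm (((max 0 (0 + h))\<^sup>2 - (max 0 0)\<^sup>2) / h) \<le> \<bar>h\<bar>"
        by (rule always_eventually) (auto simp: max_def power2_eq_square)
      show "((\<lambda>h::real. \<bar>h\<bar>) \<longlongrightarrow> 0) (at 0)"
        using tendsto_rabs_zero[OF tendsto_ident_at, of UNIV] by simp
    qed
    then show ?thesis using True by (simp add: DERIV_def)
  next
    case False
    show ?thesis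
    proof (cases "x > 0")
      case True
      have "((\<lambda>x. x\<^sup>2) has_real_derivative 2 * x) (at x)" by (auto intro!: derivative_eq_intros)
      then have "((\<lambda>x. (max 0 x)\<^sup>2) has_real_derivative 2 * x) (at x)"
        by (rule has_field_derivative_transform_within_open[where S="{0<..}"]) (use True in auto)
      then show ?thesis using True by simp
    next
      case neg: False
      have "((\<lambda>x::real. 0) has_real_derivative 0) (at x)" by simp
      then have "((\<lambda>x. (max 0 x)\<^sup>2) has_real_derivative 0) (at x)"
        by (rule has_field_derivative_transform_within_open[where S="{..<0}"]) (use neg False in auto)
      then show ?thesis using neg by simp
    qed
  qed
  have 1: "((\<lambda>t. t - \<rho>) has_real_derivative 1) (at t)" "((\<lambda>t. - t - \<rho>) has_real_derivative - 1) (at t)"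
    by (auto intro!: derivative_eq_intros)
  show ?thesis unfolding hinge'_def
    using DERIV_add[OF DERIV_chain2[OF pos 1(1)] DERIV_chain2[OF pos 1(2)]] by simp
qed

lemma hinge_flux_nonneg: "0 \<le> hinge' (y $ k) * flux k U y"
proof -
  consider "\<rho> < y $ k" | "\<rho> < - (y $ k)" | "\<bar>y $ k\<bar> \<le> \<rho>" by linarith
  then show ?thesis
  proof cases
    case 1
    then show ?thesis using flux_nonneg[of y k U] rho_pos by (simp add: hinge'_def)
  next
    case 2
    then show ?thesis using flux_nonpos[of y k U] rho_pos by (simp add: hinge'_def mult_nonpos_nonpos)
  qed (simp add: hinge'_def)
qed

lemma hinge_flux_lower_bound:
  assumes "\<rho> + 1 \<le> \<bar>y $ k\<bar>"
  shows "2 * q k * (U y \<bullet> U y) \<le> hinge' (y $ k) * flux k U y"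
proof -
  have e: "q k \<le> q k * s - 1" if "\<rho> + 1 \<le> s" for s
  proof -
    have "q k * (\<rho> + 1) \<le> q k * s" using that q_pos[of k] by (intro mult_left_mono) auto
    then show ?thesis using rho[of k] by (simp add: distrib_left)
  qed
  consider "\<rho> + 1 \<le> y $ k" | "\<rho> + 1 \<le> - (y $ k)" using assms by linarith
  then show ?thesis
  proof cases
    case 1
    have "q k * (U y \<bullet> U y) \<le> (q k * y $ k - 1) * (U y \<bullet> U y)"
      by (intro mult_right_mono e 1) auto
    also have "\<dots> \<le> flux k U y" using flux_lower_bound(1)[of y k U] 1 by simp
    finally have "2 * (q k * (U y \<bullet> U y)) \<le> hinge' (y $ k) * flux k U y"
      using 1 rho_pos q_pos[of k] by (intro mult_mono) (auto simp: hinge'_def intro: order_trans[rotated])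
    then show ?thesis by simp
  next
    case 2
    have "q k * (U y \<bullet> U y) \<le> (q k * (- (y $ k)) - 1) * (U y \<bullet> U y)"
      by (intro mult_right_mono e 2) auto
    also have "\<dots> \<le> - flux k U y" using flux_upper_bound(1)[of y k U] 2 by simp
    finally have "2 * (q k * (U y \<bullet> U y)) \<le> (- hinge' (y $ k)) * (- flux k U y)"
      using 2 rho_pos q_pos[of k] by (intro mult_mono) (auto simp: hinge'_def intro: order_trans[rotated])
    then show ?thesis by simp
  qed
qed

text \<open>Outside the cube the system is hyperbolic in the outward direction, so a stationary state cannot be
  supported there; the hypothesis on \<open>evol U \<bullet> U\<close> holds for every eigenfunction with eigenvalue of
  real part \<open>a\<close>. With the weight \<open>\<phi> = exp (- s * (\<Sum>k. h (y $ k)))\<close> the flux term is at most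
  \<open>- 2 s \<kappa> \<phi> (U \<bullet> U)\<close> outside the cube; once \<open>s\<close> is large, this dominates all zeroth-order terms on a
  prescribed larger cube.\<close>

lemma unique_continuation:
  assumes U: "smooth U" and eig: "\<And>y. evol U y \<bullet> U y = a * (U y \<bullet> U y)"
    and zero: "\<And>y. y \<in> Om \<Longrightarrow> U y = 0"
  shows "U x = 0"
proof -
  define r where "r = max (\<rho> + 1) (norm x)"
  have r: "\<rho> + 1 \<le> r" "x \<in> cube r"
    by (auto simp: r_def mem_cube intro: order_trans[OF component_le_norm_cart])
  obtain m where m: "m \<ge> 0" "\<And>y. y \<in> cube r \<Longrightarrow> norm (M y) \<le> m"
    using norm_blinfun_bounded_on_cube[OF M_smooth] by blast
  define C where "C = sum q UNIV + 2 * m + 2 * \<bar>a\<bar>"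
  define \<kappa> where "\<kappa> = Min (range q)"
  have \<kappa>: "\<kappa> > 0" "\<kappa> \<le> q k" for k using q_pos by (auto simp: \<kappa>_def)
  \<comment> \<open>With this choice the flux term beats the zeroth-order terms with a margin of \<open>U y \<bullet> U y\<close>.\<close>
  define s where "s = (\<bar>C\<bar> + 1) / (2 * \<kappa>)"
  have s: "s > 0" "2 * \<kappa> * s = \<bar>C\<bar> + 1" using \<kappa>(1) by (auto simp: s_def)
  define h where "h t = (max 0 (t - \<rho>))\<^sup>2 + (max 0 (- t - \<rho>))\<^sup>2" for t
  define \<phi> where "\<phi> y = exp (- s * (\<Sum>k\<in>UNIV. h (y $ k)))" for y :: "real^'n"
  define \<phi>' where "\<phi>' y v = \<phi> y * (- s * (\<Sum>k\<in>UNIV. v $ k * hinge' (y $ k)))" for y v :: "real^'n"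
  have dh: "((\<lambda>y::real^'n. h (y $ k)) has_derivative (\<lambda>v. v $ k * hinge' (y $ k))) (at y)" for k y
  proof -
    have "(h has_derivative (\<lambda>x. x * hinge' (y $ k))) (at (y $ k))"
      using hinge_has_derivative[of "y $ k"]
      by (simp add: h_def[abs_def] has_field_derivative_def mult_commute_abs)
    from has_derivative_compose[OF bounded_linear.has_derivative[OF bounded_linear_vec_nth has_derivative_ident] this]
    show ?thesis by simp
  qed
  have d\<phi>: "(\<phi> has_derivative \<phi>' y) (at y)" for y
    unfolding \<phi>_def[abs_def] \<phi>'_def[abs_def]
  proof -
    have "((\<lambda>y. - s * (\<Sum>k\<in>UNIV. h (y $ k))) has_derivative
        (\<lambda>v. - s * (\<Sum>k\<in>UNIV. v $ k * hinge' (y $ k)))) (at y)"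
      by (intro has_derivative_mult_right has_derivative_sum dh)
    from DERIV_compose_FDERIV[OF DERIV_exp this]
    show "((\<lambda>y. exp (- s * (\<Sum>k\<in>UNIV. h (y $ k)))) has_derivative
        (\<lambda>v. exp (- s * (\<Sum>k\<in>UNIV. h (y $ k))) * (- s * (\<Sum>k\<in>UNIV. v $ k * hinge' (y $ k))))) (at y)"
      by (simp add: mult_ac)
  qed
  have c\<phi>: "continuous_on UNIV \<phi>"
    using d\<phi> by (meson continuous_at_imp_continuous_on has_derivative_continuous)
  have \<phi>'k: "\<phi>' y (axis k 1) = - s * \<phi> y * hinge' (y $ k)" for y k
  proof -
    have "(\<Sum>j\<in>UNIV. axis k 1 $ j * hinge' (y $ j)) = (\<Sum>j\<in>UNIV. if j = k then hinge' (y $ k) else 0)"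
      by (rule sum.cong) (auto simp: axis_def)
    then show ?thesis by (simp add: \<phi>'_def)
  qed
  have c\<phi>': "continuous_on UNIV (\<lambda>y. \<phi>' y (axis k 1))" for k
    unfolding \<phi>'k hinge'_def by (intro continuous_intros c\<phi>)
  have cU: "continuous_on UNIV U" using U by (rule smooth_continuous)
  have cflux: "continuous_on UNIV (flux k U)" for k
    unfolding flux_def[abs_def]
    by (intro continuous_intros cU bounded_linear.continuous_on[OF S_bounded_linear])
  have \<phi>0: "0 \<le> \<phi> y" for y by (simp add: \<phi>_def)
  have "0 \<le> integral (cube r) (\<lambda>y. \<phi> y * (sum q UNIV * (U y \<bullet> U y) + 2 * (U y \<bullet> blinfun_apply (M y) (U y))
      - 2 * (U y \<bullet> evol U y)) + (\<Sum>k\<in>UNIV. \<phi>' y (axis k 1) * flux k U y))"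
    by (rule weighted_energy_inequality[OF U]) (use r d\<phi> c\<phi>' \<phi>0 in auto)
  also have "\<dots> \<le> integral (cube r) (\<lambda>y. - (\<phi> y * (U y \<bullet> U y)))"
  proof (intro integral_le integrable_on_cube)
    fix y :: "real^'n" assume y: "y \<in> cube r"
    have 1: "U y \<bullet> blinfun_apply (M y) (U y) \<le> m * (U y \<bullet> U y)" by (rule MU_inner_le[OF m(2)[OF y]])
    have "- a * (U y \<bullet> U y) \<le> \<bar>a\<bar> * (U y \<bullet> U y)" by (intro mult_right_mono) auto
    then have 2: "sum q UNIV * (U y \<bullet> U y) + 2 * (U y \<bullet> blinfun_apply (M y) (U y))
      - 2 * (U y \<bullet> evol U y) \<le> C * (U y \<bullet> U y)"
      using 1 eig[of y] by (simp add: C_def distrib_right inner_commute)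
    have 3: "2 * \<kappa> * (U y \<bullet> U y) \<le> (\<Sum>k\<in>UNIV. hinge' (y $ k) * flux k U y)"
    proof (cases "y \<in> Om")
      case True
      then show ?thesis using zero[OF True] by (simp add: sum_nonneg hinge_flux_nonneg)
    next
      case False
      then obtain k where k: "\<rho> + 1 \<le> \<bar>y $ k\<bar>" by (auto simp: mem_cube not_le intro: less_imp_le)
      have "2 * \<kappa> * (U y \<bullet> U y) \<le> 2 * q k * (U y \<bullet> U y)"
        using \<kappa>(2)[of k] by (intro mult_right_mono) auto
      also have "\<dots> \<le> hinge' (y $ k) * flux k U y" by (rule hinge_flux_lower_bound[OF k])
      also have "\<dots> \<le> (\<Sum>k\<in>UNIV. hinge' (y $ k) * flux k U y)"
        by (rule member_le_sum) (auto intro: hinge_flux_nonneg)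
      finally show ?thesis .
    qed
    have "(\<Sum>k\<in>UNIV. \<phi>' y (axis k 1) * flux k U y) = - (\<phi> y * (s * (\<Sum>k\<in>UNIV. hinge' (y $ k) * flux k U y)))"
      by (simp add: \<phi>'k sum_distrib_left sum_negf[symmetric] algebra_simps)
    also have "\<dots> \<le> - (\<phi> y * (s * (2 * \<kappa> * (U y \<bullet> U y))))"
      using mult_left_mono[OF mult_left_mono[OF 3, of s], of "\<phi> y"] s(1) by (simp add: \<phi>_def)
    also have "s * (2 * \<kappa> * (U y \<bullet> U y)) = (\<bar>C\<bar> + 1) * (U y \<bullet> U y)"
      using s(2) by (simp add: mult.assoc[symmetric] mult.commute)
    finally have 4: "(\<Sum>k\<in>UNIV. \<phi>' y (axis k 1) * flux k U y) \<le> - (\<phi> y * ((\<bar>C\<bar> + 1) * (U y \<bullet> U y)))" .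
    have "C * (U y \<bullet> U y) \<le> \<bar>C\<bar> * (U y \<bullet> U y)" by (intro mult_right_mono) auto
    then have "sum q UNIV * (U y \<bullet> U y) + 2 * (U y \<bullet> blinfun_apply (M y) (U y))
      - 2 * (U y \<bullet> evol U y) \<le> \<bar>C\<bar> * (U y \<bullet> U y)" using 2 by linarith
    then have "\<phi> y * (sum q UNIV * (U y \<bullet> U y) + 2 * (U y \<bullet> blinfun_apply (M y) (U y))
      - 2 * (U y \<bullet> evol U y)) \<le> \<phi> y * (\<bar>C\<bar> * (U y \<bullet> U y))"
      by (intro mult_left_mono) (auto simp: \<phi>_def)
    with 4 show "\<phi> y * (sum q UNIV * (U y \<bullet> U y) + 2 * (U y \<bullet> blinfun_apply (M y) (U y))
      - 2 * (U y \<bullet> evol U y)) + (\<Sum>k\<in>UNIV. \<phi>' y (axis k 1) * flux k U y) \<le> - (\<phi> y * (U y \<bullet> U y))"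
      by (simp add: distrib_right distrib_left)
  qed (auto intro!: continuous_intros c\<phi> c\<phi>' cflux cU smooth_continuous[OF smooth_evol[OF U]] smooth_continuous[OF smooth_MU[OF U]])
  finally have "integral (cube r) (\<lambda>y. \<phi> y * (U y \<bullet> U y)) \<le> 0" by simp
  moreover have cont: "continuous_on UNIV (\<lambda>y. \<phi> y * (U y \<bullet> U y))" by (intro continuous_intros c\<phi> cU)
  moreover have "0 \<le> integral (cube r) (\<lambda>y. \<phi> y * (U y \<bullet> U y))"
    by (intro integral_nonneg integrable_on_cube cont) (auto simp: \<phi>_def)
  ultimately have "integral (cube r) (\<lambda>y. \<phi> y * (U y \<bullet> U y)) = 0" by simp
  from zero_if_integral_cube_zero[OF cont _ _ this r(2)]
  have "\<phi> x * (U x \<bullet> U x) = 0" using r(1) rho_pos \<phi>0 by simp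
  then show ?thesis by (simp add: \<phi>_def)
qed

lemma coord_deriv_vanishes:
  assumes f: "smooth f" and zero: "\<And>y. y \<in> Om \<Longrightarrow> f y = 0" and y: "y \<in> Om"
  shows "coord_deriv j f y = 0"
proof -
  let ?U = "box (vec (- (\<rho> + 1))) (vec (\<rho> + 1)) :: (real^'n) set"
  have U: "?U \<subseteq> Om" by (simp add: cube_def box_subset_cbox)
  have "coord_deriv j f x = 0" if x: "x \<in> ?U" for x
  proof -
    have "f y = 0" if "y \<in> ?U" for y using U zero that by blast
    then have "frechet_derivative f (at x) = frechet_derivative (\<lambda>_. 0) (at x)"
      by (rule frechet_derivative_cong_open(1)[OF open_box x])
    then show ?thesis by (simp add: coord_deriv_def)
  qed
  moreover have "?U \<noteq> {}" using rho_pos by (intro box_vec_nonempty) simp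
  then have "closure ?U = Om" by (simp add: cube_def closure_box)
  ultimately show ?thesis
    using continuous_constant_on_closure[of ?U "coord_deriv j f" 0 y] y
      smooth_continuous[OF smooth_coord_deriv[OF f]] by auto
qed

lemma coord_derivs_vanish:
  assumes f: "smooth f" and zero: "\<And>y. y \<in> Om \<Longrightarrow> f y = 0" and y: "y \<in> Om"
  shows "coord_derivs \<beta> f y = 0"
  using y
  by (induction \<beta> arbitrary: y) (auto intro: coord_deriv_vanishes smooth_coord_derivs f zero)

lemma sob_vanish:
  assumes "smooth U" "\<And>y. y \<in> Om \<Longrightarrow> U y = 0"
  shows "sob N U V = 0"
  unfolding sob_def
proof (rule sum.neutral, rule ballI)
  fix \<beta> :: "'n list"
  have "integral Om (\<lambda>y. coord_derivs \<beta> U y \<bullet> coord_derivs \<beta> V y) = integral Om (\<lambda>y. 0)"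
    by (rule integral_cong) (simp add: coord_derivs_vanish[OF assms])
  then show "integral Om (\<lambda>y. coord_derivs \<beta> U y \<bullet> coord_derivs \<beta> V y) = 0" by simp
qed

lemma sob_null:
  assumes U: "smooth U" and null: "sob N U U = 0" and y: "y \<in> Om"
  shows "U y = 0"
proof -
  have cont: "continuous_on UNIV (\<lambda>y. (norm (U y))\<^sup>2)" by (intro continuous_intros smooth_continuous U)
  have "seminorm2 [] U = 0"
    using seminorm2_le_sob[OF U, of "[]" N] seminorm2_nonneg[OF U, of "[]"] null by simp
  then have "integral Om (\<lambda>y. (norm (U y))\<^sup>2) = 0" by (simp add: seminorm2_def)
  from zero_if_integral_cube_zero[OF cont _ _ this y] show ?thesis using rho_pos by simp
qed

lemma evol_vanishes:
  assumes U: "smooth U" and zero: "\<And>y. y \<in> Om \<Longrightarrow> U y = 0" and y: "y \<in> Om"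
  shows "evol U y = 0"
  using coord_deriv_vanishes[OF U zero y] zero[OF y] linear_0[OF S_linear]
  by (simp add: evol_def blinfun.zero_right)

end

section \<open>Orthonormal flags of generalized eigenvectors\<close>

text \<open>A flag is an orthonormal family on whose partial spans \<open>T\<close> acts in upper triangular form, with
  diagonal entries of real part at least \<open>- \<alpha>\<close>. The diagonal entries are \<open>h (T (v i)) (v i)\<close>, so
  a bound on the length of orthonormal families with \<open>Re (h (T (v i)) (v i)) \<ge> - \<alpha>\<close> is a bound on
  the length of flags. The form \<open>h\<close> may be degenerate on \<open>V\<close>; it suffices that its null vectors are
  \<open>T\<close>-invariant and contain no eigenvector.\<close>

locale bounded_flags = vector_space scale
  for scale :: "complex \<Rightarrow> 'v::ab_group_add \<Rightarrow> 'v" +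
  fixes V :: "'v set" and T :: "'v \<Rightarrow> 'v" and h :: "'v \<Rightarrow> 'v \<Rightarrow> complex" and \<alpha> :: real and D :: nat
  assumes V: "subspace V"
    and T_in: "u \<in> V \<Longrightarrow> T u \<in> V"
    and T_add: "u \<in> V \<Longrightarrow> w \<in> V \<Longrightarrow> T (u + w) = T u + T w"
    and T_scale: "u \<in> V \<Longrightarrow> T (scale c u) = scale c (T u)"
    and h_add: "u \<in> V \<Longrightarrow> u' \<in> V \<Longrightarrow> w \<in> V \<Longrightarrow> h (u + u') w = h u w + h u' w"
    and h_scale: "u \<in> V \<Longrightarrow> w \<in> V \<Longrightarrow> h (scale c u) w = c * h u w"
    and h_cnj: "u \<in> V \<Longrightarrow> w \<in> V \<Longrightarrow> h w u = cnj (h u w)"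
    and h_nonneg: "u \<in> V \<Longrightarrow> 0 \<le> Re (h u u)"
    and h_null: "u \<in> V \<Longrightarrow> h u u = 0 \<Longrightarrow> w \<in> V \<Longrightarrow> h u w = 0"
    and h_null_T: "u \<in> V \<Longrightarrow> h u u = 0 \<Longrightarrow> w \<in> V \<Longrightarrow> h (T u) w = 0"
    and h_eigen: "u \<in> V \<Longrightarrow> T u = scale \<mu> u \<Longrightarrow> h u u = 0 \<Longrightarrow> u = 0"
    and h_bound: "(\<And>i. i < d \<Longrightarrow> v i \<in> V) \<Longrightarrow>
        (\<And>i j. i < d \<Longrightarrow> j < d \<Longrightarrow> h (v i) (v j) = (if i = j then 1 else 0)) \<Longrightarrow>
        (\<And>i. i < d \<Longrightarrow> - \<alpha> \<le> Re (h (T (v i)) (v i))) \<Longrightarrow> d \<le> D"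
begin

definition shift :: "complex \<Rightarrow> 'v \<Rightarrow> 'v" where
  "shift \<mu> u = T u - scale \<mu> u"

definition flag :: "nat \<Rightarrow> (nat \<Rightarrow> 'v) \<Rightarrow> (nat \<Rightarrow> complex) \<Rightarrow> bool" where
  "flag d v l \<longleftrightarrow>
     (\<forall>i<d. v i \<in> V \<and> - \<alpha> \<le> Re (l i) \<and> shift (l i) (v i) \<in> span (v ` {..<i})) \<and>
     (\<forall>i<d. \<forall>j<d. h (v i) (v j) = (if i = j then 1 else 0))"

lemma shift_in: "u \<in> V \<Longrightarrow> shift \<mu> u \<in> V"
  unfolding shift_def by (intro subspace_diff V T_in subspace_scale)

lemma shift_funpow_in: "u \<in> V \<Longrightarrow> (shift \<mu> ^^ k) u \<in> V"
  by (induction k) (auto intro: shift_in)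

lemma shift_add: "u \<in> V \<Longrightarrow> w \<in> V \<Longrightarrow> shift \<mu> (u + w) = shift \<mu> u + shift \<mu> w"
  by (simp add: shift_def T_add scale_right_distrib)

lemma shift_scale: "u \<in> V \<Longrightarrow> shift \<mu> (scale c u) = scale c (shift \<mu> u)"
  by (simp add: shift_def T_scale scale_right_diff_distrib mult.commute)

lemma T_zero: "T 0 = 0"
  using T_scale[of 0 0] subspace_0[OF V] by simp

lemma shift_zero: "shift \<mu> 0 = 0"
  by (simp add: shift_def T_zero)

lemma shift_diff: "u \<in> V \<Longrightarrow> w \<in> V \<Longrightarrow> shift \<mu> (u - w) = shift \<mu> u - shift \<mu> w"
  using shift_add[of u "scale (- 1) w" \<mu>] shift_scale[of w \<mu> "- 1"] subspace_scale[OF V, of w "- 1"] by simp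

lemma shift_funpow_add:
  "u \<in> V \<Longrightarrow> w \<in> V \<Longrightarrow> (shift \<mu> ^^ k) (u + w) = (shift \<mu> ^^ k) u + (shift \<mu> ^^ k) w"
  by (induction k) (auto simp: shift_add shift_funpow_in)

lemma shift_funpow_scale: "u \<in> V \<Longrightarrow> (shift \<mu> ^^ k) (scale c u) = scale c ((shift \<mu> ^^ k) u)"
  by (induction k) (auto simp: shift_scale shift_funpow_in)

lemma shift_funpow_zero: "(shift \<mu> ^^ k) 0 = 0"
  by (induction k) (auto simp: shift_zero)

lemma h_zero_left: "w \<in> V \<Longrightarrow> h 0 w = 0"
  using h_scale[of 0 w 0] subspace_0[OF V] by simp

lemma h_diff: "u \<in> V \<Longrightarrow> u' \<in> V \<Longrightarrow> w \<in> V \<Longrightarrow> h (u - u') w = h u w - h u' w"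
  using h_add[of u "scale (- 1) u'" w] h_scale[of u' w "- 1"] subspace_scale[OF V, of u' "- 1"] by simp

lemma flag_span_subset:
  assumes "flag d v l" "i \<le> d"
  shows "span (v ` {..<i}) \<subseteq> V"
  using assms by (intro span_minimal V) (auto simp: flag_def)

lemma span_induct_step [consumes 1, case_names base step]:
  assumes "x \<in> span S" "P 0"
    and step: "\<And>c y z. y \<in> S \<Longrightarrow> z \<in> span S \<Longrightarrow> P z \<Longrightarrow> P (scale c y + z)"
  shows "P x"
proof -
  have "x \<in> span S \<and> P x"
    using assms(1)
    by (induction rule: span_induct_alt)
       (auto simp: assms(2) span_zero intro: step span_add span_scale span_base)
  then show ?thesis ..
qed

lemma flag_span_orthogonal:
  assumes "flag d v l" "i \<le> j" "j < d" "x \<in> span (v ` {..<i})"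
  shows "h x (v j) = 0"
  using assms(4)
proof (induction rule: span_induct_step)
  case base
  then show ?case using assms by (auto simp: flag_def h_zero_left)
next
  case (step c y z)
  then obtain i' where i': "y = v i'" "i' < i" by auto
  then have yV: "y \<in> V" and zero: "h y (v j) = 0" and vV: "v j \<in> V" using assms by (auto simp: flag_def)
  have "z \<in> V" using flag_span_subset[OF assms(1), of i] step assms by auto
  then show ?case using yV zero vV step.IH by (simp add: h_add h_scale subspace_scale[OF V])
qed

lemma flag_expansion:
  assumes "flag d v l" "x \<in> span (v ` {..<d})"
  shows "x = (\<Sum>i<d. scale (h x (v i)) (v i))"
  using assms(2)
proof (induction rule: span_induct_step)
  case base
  then show ?case using assms by (auto simp: flag_def h_zero_left)
next
  case (step c y z)
  then obtain j where j: "y = v j" "j < d" by auto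
  have zV: "z \<in> V" using flag_span_subset[OF assms(1), of d] step by auto
  have vV: "v i \<in> V" if "i < d" for i using assms(1) that by (simp add: flag_def)
  have "h (scale c y + z) (v i) = (if i = j then c else 0) + h z (v i)" if "i < d" for i
    using that j zV vV assms(1) by (simp add: h_add h_scale subspace_scale[OF V] flag_def)
  then have "(\<Sum>i<d. scale (h (scale c y + z) (v i)) (v i))
     = (\<Sum>i<d. scale (if i = j then c else 0) (v i) + scale (h z (v i)) (v i))"
    by (intro sum.cong) (auto simp: scale_left_distrib)
  also have "\<dots> = (\<Sum>i<d. if i = j then scale c (v j) else 0) + z"
    using step.IH by (simp add: sum.distrib if_distrib[of "\<lambda>c. scale c _"] cong: if_cong)
  also have "\<dots> = scale c y + z" using j by simp
  finally show ?case by simp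
qed

lemma flag_shift_invariant:
  assumes "flag d v l" "i \<le> d" "x \<in> span (v ` {..<i})"
  shows "shift \<mu> x \<in> span (v ` {..<i})"
  using assms(3)
proof (induction rule: span_induct_step)
  case base
  then show ?case by (simp add: shift_zero span_zero)
next
  case (step c y z)
  then obtain j where j: "y = v j" "j < i" by auto
  have zV: "z \<in> V" using flag_span_subset[OF assms(1), of i] step assms by auto
  have yV: "y \<in> V" using assms j by (simp add: flag_def)
  have "shift (l j) (v j) \<in> span (v ` {..<j})" using assms j by (auto simp: flag_def)
  then have "shift (l j) (v j) \<in> span (v ` {..<i})"
    using j by (meson image_mono in_mono lessThan_subset_iff less_imp_le span_mono)
  moreover have "v j \<in> span (v ` {..<i})" using j by (intro span_base) auto
  moreover have "shift \<mu> y = shift (l j) (v j) + scale (l j - \<mu>) (v j)"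
    by (simp add: shift_def j scale_left_diff_distrib)
  ultimately have "shift \<mu> y \<in> span (v ` {..<i})" by (simp add: span_add span_scale)
  then show ?case
    using step zV yV by (simp add: shift_add shift_scale subspace_scale[OF V] span_add span_scale)
qed

lemma flag_length_le: "flag d v l \<Longrightarrow> d \<le> D"
proof (rule h_bound)
  assume f: "flag d v l"
  show "v i \<in> V" if "i < d" for i using f that by (simp add: flag_def)
  show "h (v i) (v j) = (if i = j then 1 else 0)" if "i < d" "j < d" for i j
    using f that by (simp add: flag_def)
  show "- \<alpha> \<le> Re (h (T (v i)) (v i))" if i: "i < d" for i
  proof -
    have vV: "v i \<in> V" and s: "shift (l i) (v i) \<in> span (v ` {..<i})" using f i by (auto simp: flag_def)
    have "T (v i) = shift (l i) (v i) + scale (l i) (v i)" by (simp add: shift_def)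
    then have "h (T (v i)) (v i) = h (shift (l i) (v i)) (v i) + l i * h (v i) (v i)"
      using vV by (simp add: h_add h_scale shift_in subspace_scale[OF V])
    also have "\<dots> = l i" using flag_span_orthogonal[OF f _ i s] f i by (simp add: flag_def)
    finally show ?thesis using f i by (simp add: flag_def)
  qed
qed

lemma last_nonmember_iterate:
  assumes "(f ^^ k) u \<in> S" "u \<notin> S"
  obtains j where "(f ^^ j) u \<notin> S" "f ((f ^^ j) u) \<in> S"
proof -
  define m where "m = (LEAST k. (f ^^ k) u \<in> S)"
  have m: "(f ^^ m) u \<in> S" unfolding m_def using assms(1) by (rule LeastI)
  then obtain j where j: "m = Suc j" using assms(2) by (cases m) auto
  then have "(f ^^ j) u \<notin> S" unfolding m_def using not_less_Least[of j "\<lambda>k. (f ^^ k) u \<in> S"] by (simp add: m_def)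
  then show ?thesis using m j that by simp
qed

text \<open>The last iterate of \<open>shift \<mu>\<close> on \<open>u\<close> outside the span is an eigenvector modulo the span. Its component
  orthogonal to the span extends the flag after normalization, provided that it is not a null vector of
  \<open>h\<close>. A null vector would satisfy \<open>T y = scale \<mu> y\<close> exactly, because the error lies in the span and is
  orthogonal to it.\<close>

lemma flag_extend:
  assumes f: "flag d v l" and u: "u \<in> V" "(shift \<mu> ^^ k) u = 0" "- \<alpha> \<le> Re \<mu>"
    and notin: "u \<notin> span (v ` {..<d})"
  shows "\<exists>v' l'. flag (Suc d) v' l'"
proof -
  let ?S = "span (v ` {..<d})"
  have vV: "v i \<in> V" if "i < d" for i using f that by (simp add: flag_def)
  have SV: "?S \<subseteq> V" using flag_span_subset[OF f] by simp
  obtain j where j: "(shift \<mu> ^^ j) u \<notin> ?S" "shift \<mu> ((shift \<mu> ^^ j) u) \<in> ?S"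
    using last_nonmember_iterate[of k "shift \<mu>" u ?S] u notin span_zero by metis
  define w where "w = (shift \<mu> ^^ j) u"
  have w: "w \<in> V" "w \<notin> ?S" "shift \<mu> w \<in> ?S" using j u by (auto simp: w_def shift_funpow_in)
  define x where "x = (\<Sum>i<d. scale (h w (v i)) (v i))"
  have x: "x \<in> ?S" unfolding x_def by (intro span_sum span_scale span_base) auto
  have hx: "h x (v i) = h w (v i)" if i: "i < d" for i
  proof -
    have "h (\<Sum>j\<in>I. scale (h w (v j)) (v j)) (v i) = (\<Sum>j\<in>I. h w (v j) * h (v j) (v i))"
      if "finite I" "I \<subseteq> {..<d}" for I
      using that
    proof (induction I)
      case empty
      then show ?case using vV[OF i] by (simp add: h_zero_left)
    next
      case (insert a I)
      have "(\<Sum>j\<in>I. scale (h w (v j)) (v j)) \<in> V"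
        using insert vV by (intro subspace_sum V subspace_scale) auto
      then show ?case using insert vV i by (simp add: h_add h_scale subspace_scale[OF V])
    qed
    from this[of "{..<d}"] have "h x (v i) = (\<Sum>j<d. h w (v j) * h (v j) (v i))" by (simp add: x_def)
    also have "\<dots> = (\<Sum>j<d. if j = i then h w (v i) else 0)"
      using f i by (intro sum.cong) (auto simp: flag_def)
    finally show ?thesis using i by simp
  qed
  \<comment> \<open>The component of \<open>w\<close> orthogonal to the span.\<close>
  define y where "y = w - x"
  have xV: "x \<in> V" using x SV by auto
  have yV: "y \<in> V" unfolding y_def using w xV by (intro subspace_diff V)
  have yS: "y \<notin> ?S" using w x span_add[OF _ x, of y] by (auto simp: y_def)
  have hy: "h y (v i) = 0" if "i < d" for i
    using that hx w xV vV by (simp add: y_def h_diff)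
  have Ny: "shift \<mu> y \<in> ?S"
    unfolding y_def shift_diff[OF w(1) xV]
    by (intro span_diff w flag_shift_invariant[OF f] x order_refl)
  have hyy: "h y y \<noteq> 0"
  proof
    assume 0: "h y y = 0"
    have "h (shift \<mu> y) (v i) = 0" if "i < d" for i
      using h_null_T[OF yV 0 vV[OF that]] h_null[OF yV 0 vV[OF that]] yV vV[OF that]
      by (simp add: shift_def h_diff h_scale T_in subspace_scale[OF V])
    then have "shift \<mu> y = 0" using flag_expansion[OF f Ny] by simp
    then have "T y = scale \<mu> y" by (simp add: shift_def)
    then have "y = 0" using h_eigen yV 0 by blast
    then show False using yS span_zero by simp
  qed
  define r where "r = Re (h y y)"
  have hr: "h y y = of_real r" using h_cnj[OF yV yV] by (simp add: r_def complex_eq_iff)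
  have "r \<noteq> 0" using hyy hr by auto
  moreover have "r \<ge> 0" unfolding r_def by (rule h_nonneg[OF yV])
  ultimately have r: "r > 0" by simp
  define c where "c = complex_of_real (1 / sqrt r)"
  define e where "e = scale c y"
  have eV: "e \<in> V" unfolding e_def by (intro subspace_scale V yV)
  have he: "h e (v i) = 0" if "i < d" for i using that hy vV yV by (simp add: e_def h_scale)
  have hve: "h (v i) e = 0" if "i < d" for i using he[OF that] h_cnj[OF eV vV[OF that]] by simp
  have hee: "h e e = 1"
  proof -
    have "h y e = cnj (h e y)" using h_cnj[OF eV yV] .
    then have "h e e = c * cnj (c * h y y)" by (simp add: e_def h_scale yV eV subspace_scale[OF V])
    also have "\<dots> = of_real (1 / sqrt r * (1 / sqrt r) * r)" by (simp only: c_def hr complex_cnj_mult complex_cnj_complex_of_real of_real_mult mult.assoc)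
    also have "1 / sqrt r * (1 / sqrt r) * r = 1" using r by (simp add: field_simps)
    finally show ?thesis by simp
  qed
  have Ne: "shift \<mu> e \<in> ?S" unfolding e_def shift_scale[OF yV] by (intro span_scale Ny)
  have img: "{..<i} \<inter> {x. x \<noteq> d} = {..<i}" if "i \<le> d" for i using that by auto
  have "flag (Suc d) (v(d := e)) (l(d := \<mu>))"
    using f eV he hve hee Ne u(3) unfolding flag_def less_Suc_eq by (auto simp: img)
  then show ?thesis by blast
qed

text \<open>A flag of maximal length cannot be extended, so its span contains all generalized eigenvectors. Since
  \<open>T\<close> is triangular on this span, the eigenvalues are among the diagonal entries.\<close>

theorem maximal_flag:
  "\<exists>(d::nat) v l.
     (\<forall>u \<mu> k. u \<in> V \<longrightarrow> (shift \<mu> ^^ k) u = 0 \<longrightarrow> - \<alpha> \<le> Re \<mu> \<longrightarrow> u \<in> span (v ` {..<d})) \<and>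
     (\<forall>u \<mu> k. u \<in> V \<longrightarrow> u \<noteq> 0 \<longrightarrow> (shift \<mu> ^^ k) u = 0 \<longrightarrow> - \<alpha> \<le> Re \<mu> \<longrightarrow> \<mu> \<in> l ` {..<d})"
proof -
  define F where "F d \<longleftrightarrow> (\<exists>v l. flag d v l)" for d
  have "F 0" by (simp add: F_def flag_def)
  moreover have "\<forall>d. F d \<longrightarrow> d \<le> D" using flag_length_le by (auto simp: F_def)
  ultimately obtain d where d: "F d" "\<And>d'. F d' \<Longrightarrow> d' \<le> d"
    using Greatest_le_nat[of F _ D] GreatestI_nat[of F 0 D] by blast
  then obtain v l where f: "flag d v l" by (auto simp: F_def)
  have sp: "u \<in> span (v ` {..<d})" if "u \<in> V" "(shift \<mu> ^^ k) u = 0" "- \<alpha> \<le> Re \<mu>" for u \<mu> k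
  proof (rule ccontr)
    assume "u \<notin> span (v ` {..<d})"
    then have "F (Suc d)" using flag_extend[OF f that] by (simp add: F_def)
    then show False using d(2)[of "Suc d"] by simp
  qed
  have "\<mu> \<in> l ` {..<d}" if u: "u \<in> V" "u \<noteq> 0" "(shift \<mu> ^^ k) u = 0" "- \<alpha> \<le> Re \<mu>" for u \<mu> k
  proof -
    obtain j where j: "(shift \<mu> ^^ j) u \<notin> {0}" "shift \<mu> ((shift \<mu> ^^ j) u) \<in> {0}"
      using last_nonmember_iterate[of k "shift \<mu>" u "{0}"] u by blast
    define w where "w = (shift \<mu> ^^ j) u"
    have w: "w \<in> V" "w \<noteq> 0" "shift \<mu> w = 0" using j u by (auto simp: w_def shift_funpow_in)
    have "w \<in> span (v ` {..<d})" using sp[of w 1 \<mu>] w u by simp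
    then have ex: "\<exists>i. w \<in> span (v ` {..<i})" by blast
    \<comment> \<open>The first partial span that contains \<open>w\<close>: its last vector occurs in \<open>w\<close>, so its diagonal entry is \<open>\<mu>\<close>.\<close>
    define m where "m = (LEAST i. w \<in> span (v ` {..<i}))"
    have m: "w \<in> span (v ` {..<m})" unfolding m_def using ex by (rule LeastI_ex)
    have md: "m \<le> d" unfolding m_def using \<open>w \<in> span (v ` {..<d})\<close> by (rule Least_le)
    obtain i where i: "m = Suc i" using m w by (cases m) auto
    have wi: "w \<notin> span (v ` {..<i})" using not_less_Least[of i "\<lambda>i. w \<in> span (v ` {..<i})"] i by (simp add: m_def)
    have "v ` {..<m} = insert (v i) (v ` {..<i})" by (simp add: i lessThan_Suc)
    then obtain c where c: "w - scale c (v i) \<in> span (v ` {..<i})"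
      using m span_breakdown_eq[of w "v i" "v ` {..<i}"] by auto
    define x where "x = w - scale c (v i)"
    have x: "x \<in> span (v ` {..<i})" using c by (simp add: x_def)
    have id: "i < d" using i md by simp
    have vV: "v i \<in> V" using f id by (simp add: flag_def)
    have xV: "x \<in> V" using flag_span_subset[OF f, of i] x id by auto
    have c0: "c \<noteq> 0" using wi x by (auto simp: x_def)
    have "w = scale c (v i) + x" by (simp add: x_def)
    then have "0 = scale c (shift \<mu> (v i)) + shift \<mu> x"
      using w(3) vV xV by (simp add: shift_add shift_scale subspace_scale[OF V])
    then have "scale c (shift \<mu> (v i)) = - shift \<mu> x" by (simp add: eq_neg_iff_add_eq_0)
    then have "scale c (shift \<mu> (v i)) \<in> span (v ` {..<i})"
      using flag_shift_invariant[OF f _ x, of \<mu>] id by (simp add: span_neg)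
    then have 1: "shift \<mu> (v i) \<in> span (v ` {..<i})"
      using c0 span_scale[of "scale c (shift \<mu> (v i))" "v ` {..<i}" "inverse c"] by simp
    have 2: "shift (l i) (v i) \<in> span (v ` {..<i})" using f id by (simp add: flag_def)
    have "scale (l i - \<mu>) (v i) = shift \<mu> (v i) - shift (l i) (v i)"
      by (simp add: shift_def scale_left_diff_distrib)
    then have "scale (l i - \<mu>) (v i) \<in> span (v ` {..<i})" using span_diff[OF 1 2] by simp
    from flag_span_orthogonal[OF f order_refl id this]
    have "(l i - \<mu>) * h (v i) (v i) = 0" using vV by (simp add: h_scale)
    then have "l i = \<mu>" using f id by (simp add: flag_def)
    then show ?thesis using id by auto
  qed
  with sp show ?thesis by (intro exI[of _ d] exI[of _ v] exI[of _ l] conjI allI impI) simp_all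
qed

end

section \<open>The wave equation on the slice of unit time\<close>

lemma open_kasner_space: "open (kasner_space :: (real \<times> (real^'n)) set)"
  unfolding kasner_space_def by (intro open_Times) auto

lemma slice_in_kasner_space: "(1, y) \<in> kasner_space"
  by (simp add: kasner_space_def)

lemma partial_cong:
  assumes "\<And>z. z \<in> kasner_space \<Longrightarrow> u z = w z" "z \<in> kasner_space"
  shows "partial \<mu> u z = partial \<mu> w z"
  unfolding partial_def
  using frechet_derivative_cong_open(1)[OF open_kasner_space assms(2), of u w] assms(1) by simp

lemma smooth_on_partial: "smooth_on kasner_space u \<Longrightarrow> smooth_on kasner_space (partial \<mu> u)"
  unfolding partial_def[abs_def] by (rule smooth_on_frechet_derivative)

lemma partial_eqI: "(u has_derivative u') (at z) \<Longrightarrow> partial \<mu> u z = u' (coord_vec \<mu>)"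
  unfolding partial_def using frechet_derivative_at by metis

lemma partial_add:
  assumes "smooth_on kasner_space u" "smooth_on kasner_space w" "z \<in> kasner_space"
  shows "partial \<mu> (\<lambda>z. u z + w z) z = partial \<mu> u z + partial \<mu> w z"
  by (subst partial_eqI[OF has_derivative_add[OF smooth_on_has_derivative smooth_on_has_derivative]])
     (use assms in \<open>auto simp: partial_def\<close>)

lemma partial_bounded_linear:
  assumes "smooth_on kasner_space u" "bounded_linear L" "z \<in> kasner_space"
  shows "partial \<mu> (\<lambda>z. L (u z)) z = L (partial \<mu> u z)"
  by (subst partial_eqI[OF bounded_linear.has_derivative[OF assms(2) smooth_on_has_derivative]])
     (use assms in \<open>auto simp: partial_def\<close>)

lemma partial_commute:
  fixes u :: "real \<times> (real^'n) \<Rightarrow> 'b::euclidean_space"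
  assumes "smooth_on kasner_space u" "z \<in> kasner_space"
  shows "partial \<mu> (partial \<nu> u) z = partial \<nu> (partial \<mu> u) z"
  unfolding partial_def[abs_def] by (rule mixed_derivatives_commute[OF open_kasner_space assms(2,1)])

lemma bounded_linear_complex_scale: "bounded_linear (\<lambda>x :: complex^'m::finite. c *s x)"
  unfolding linear_conv_bounded_linear[symmetric]
  by (rule linearI) (simp_all add: vec_eq_iff algebra_simps)

lemma scalar_mult_inner: "(c *s x) \<bullet> (c *s y) = (cmod c)\<^sup>2 * (x \<bullet> (y :: complex^'m::finite))"
proof -
  have "(c * a) \<bullet> (c * b) = (cmod c)\<^sup>2 * (a \<bullet> b)" for a b :: complex
    unfolding cmod_power2 by (simp add: inner_complex_def power2_eq_square algebra_simps)
  then show ?thesis by (simp add: inner_vec_def sum_distrib_left)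
qed

lemma bounded_linear_matrix_vector_left:
  "bounded_linear (\<lambda>X :: complex^'m::finite^'k::finite. X *v x)"
  unfolding linear_conv_bounded_linear[symmetric]
  by (rule linearI)
     (simp_all add: vec_eq_iff matrix_vector_mult_def sum.distrib algebra_simps scaleR_sum_right)

lemma bounded_linear_matrix_vector_right:
  "bounded_linear (\<lambda>x. (X :: complex^'m::finite^'k::finite) *v x)"
  unfolding linear_conv_bounded_linear[symmetric]
  by (rule linearI)
     (simp_all add: vec_eq_iff matrix_vector_mult_def sum.distrib algebra_simps scaleR_sum_right)

lemma matrix_vector_mult_complex_scale:
  "(X :: complex^'m::finite^'k::finite) *v (c *s x) = c *s (X *v x)"
  by (simp add: vec_eq_iff matrix_vector_mult_def sum_distrib_left algebra_simps)

lemma smooth_on_Pair: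
  assumes "open S" "smooth_on S f" "smooth_on S g"
  shows "smooth_on S (\<lambda>x. (f x, g x))"
proof -
  have "smooth_on S (\<lambda>x. (f x, 0) + (0, g x))"
    by (intro smooth_on_add assms smooth_on_bounded_linear[where L="\<lambda>a. (a, 0)"]
         smooth_on_bounded_linear[where L="\<lambda>a. (0, a)"] bounded_linear_Pair bounded_linear_ident bounded_linear_zero)
  then show ?thesis by simp
qed

lemma bounded_linear_axis: "bounded_linear (axis k :: 'b::euclidean_space \<Rightarrow> 'b^'n::finite)"
  unfolding linear_conv_bounded_linear[symmetric]
  by (rule linearI) (simp_all add: vec_eq_iff axis_def)

lemma sum_axis: "(\<Sum>k\<in>UNIV. axis k (f k)) = (\<chi> k. f k)"
  by (simp add: vec_eq_iff axis_def if_distrib cong: if_cong)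

lemma smooth_on_vec_lambda:
  fixes f :: "'n::finite \<Rightarrow> 'a::euclidean_space \<Rightarrow> 'b::euclidean_space"
  assumes "open S" "\<And>k. smooth_on S (f k)"
  shows "smooth_on S (\<lambda>x. \<chi> k. f k x)"
proof -
  have "smooth_on S (\<lambda>x. \<Sum>k\<in>UNIV. axis k (f k x))"
    by (intro smooth_on_sum assms smooth_on_bounded_linear[OF _ _ bounded_linear_axis])
  then show ?thesis by (simp add: sum_axis)
qed

text \<open>Smoothness in the operator norm follows from smoothness of the images of a basis, by writing a
  linear map as the sum of its rank-one parts.\<close>

lemma smooth_Blinfun:
  fixes m :: "real^'n::finite \<Rightarrow> 'b::euclidean_space \<Rightarrow> 'b"
  assumes lin: "\<And>y. linear (m y)" and sm: "\<And>e. smooth (\<lambda>y. m y e)"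
  shows "smooth (\<lambda>y. Blinfun (m y))"
proof -
  have ap: "blinfun_apply (Blinfun (m y)) = m y" for y
    using lin linear_conv_bounded_linear by (intro bounded_linear_Blinfun_apply) blast
  have eq: "Blinfun (m y) = (\<Sum>e\<in>Basis. blinfun_scaleR_left (m y e) o\<^sub>L blinfun_inner_left e)" for y
  proof (rule blinfun_eqI)
    fix x
    have "m y x = m y (\<Sum>e\<in>Basis. (x \<bullet> e) *\<^sub>R e)" by (simp add: euclidean_representation)
    also have "\<dots> = (\<Sum>e\<in>Basis. (x \<bullet> e) *\<^sub>R m y e)"
      by (simp add: linear_sum[OF lin] linear_scale[OF lin])
    finally show "blinfun_apply (Blinfun (m y)) x
        = blinfun_apply (\<Sum>e\<in>Basis. blinfun_scaleR_left (m y e) o\<^sub>L blinfun_inner_left e) x"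
      by (simp add: ap blinfun.sum_left inner_commute)
  qed
  show ?thesis unfolding eq
    by (intro smooth_on_sum open_UNIV smooth_on_bilinear[OF open_UNIV bounded_bilinear_blinfun_compose]
        smooth_on_const smooth_on_bounded_linear[OF open_UNIV sm bounded_linear_blinfun_scaleR_left])
qed

type_synonym ('n, 'm) cauchy_data = "(complex^'m) \<times> (complex^'m) \<times> ((complex^'m)^'n)"

text \<open>The first-order jet of a field on the slice \<open>t = 1\<close>. Taking all first derivatives as unknowns turns
  the second-order equation into a first-order symmetric hyperbolic system.\<close>

definition data :: "(real \<times> (real^'n) \<Rightarrow> complex^'m) \<Rightarrow> real^'n \<Rightarrow> ('n::finite, 'm::finite) cauchy_data" where
  "data u y = (partial None u (1, y), u (1, y), \<chi> k. partial (Some k) u (1, y))"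

text \<open>The principal part of the wave equation \<open>\<partial>\<^sub>t\<^sup>2 u = \<Sum>k. \<partial>\<^sub>k\<^sup>2 u\<close> as a first-order system, with the
  sign reversed because the vector field \<open>T = - t \<partial>\<^sub>t - \<dots>\<close> points towards \<open>t = 0\<close>.\<close>

definition coupling :: "'n \<Rightarrow> ('n::finite, 'm::finite) cauchy_data \<Rightarrow> ('n, 'm) cauchy_data" where
  "coupling k x = (- (snd (snd x) $ k), 0, - axis k (fst x))"

definition data_scale :: "complex \<Rightarrow> ('n::finite, 'm::finite) cauchy_data \<Rightarrow> ('n, 'm) cauchy_data" where
  "data_scale c x = (c *s fst x, c *s fst (snd x), \<chi> k. c *s (snd (snd x) $ k))"

text \<open>The scaling field, set to zero outside the spacetime, so that it maps fields extended by zero to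
  fields extended by zero and its iterates make sense on them.\<close>

definition generator :: "real^'n \<Rightarrow> ('n::finite, 'm::finite) field_op" where
  "generator p u z = (if z \<in> kasner_space then scaling_field p u z else 0)"

lemma linear_coupling: "linear (coupling k)"
  by (rule linearI) (auto simp: coupling_def vec_eq_iff axis_def scaleR_prod_def)

lemma coupling_sym: "coupling k x \<bullet> y = x \<bullet> coupling k y"
  by (simp add: coupling_def inner_prod_def inner_axis inner_axis' inner_commute)

lemma coupling_bound: "\<bar>coupling k x \<bullet> x\<bar> \<le> x \<bullet> x"
proof -
  let ?g = "fst x" and ?f = "snd (snd x) $ k"
  have "coupling k x \<bullet> x = - 2 * (?g \<bullet> ?f)"
    by (simp add: coupling_def inner_prod_def inner_axis inner_axis' inner_commute)
  moreover have "\<bar>?g \<bullet> ?f\<bar> \<le> norm ?g * norm ?f" by (rule Cauchy_Schwarz_ineq2)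
  moreover have "2 * (norm ?g * norm ?f) \<le> ?g \<bullet> ?g + ?f \<bullet> ?f"
    using sum_squares_bound[of "norm ?g" "norm ?f"] by (simp add: dot_square_norm)
  moreover have "?f \<bullet> ?f \<le> snd (snd x) \<bullet> snd (snd x)"
    unfolding inner_vec_def[of "snd (snd x)"] by (rule member_le_sum) auto
  moreover have "0 \<le> fst (snd x) \<bullet> fst (snd x)" by simp
  ultimately show ?thesis unfolding inner_prod_def[of x x] inner_prod_def[of "snd x" "snd x"] by linarith
qed

lemma bounded_linear_data_scale: "bounded_linear (data_scale c)"
  unfolding linear_conv_bounded_linear[symmetric]
  by (rule linearI) (simp_all add: data_scale_def vec_eq_iff scaleR_prod_def algebra_simps)

lemma data_scale_inner: "data_scale \<i> x \<bullet> data_scale \<i> y = x \<bullet> y"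
  by (simp add: data_scale_def inner_prod_def scalar_mult_inner inner_vec_def[of "vec_lambda _"] inner_vec_def[of "snd (snd x)"])

lemma data_scale_eq: "data_scale c x = Re c *\<^sub>R x + Im c *\<^sub>R data_scale \<i> x"
proof -
  have "c * a = Re c *\<^sub>R a + Im c *\<^sub>R (\<i> * a)" for a :: complex
    by (simp add: complex_eq_iff)
  then show ?thesis
    by (auto simp: data_scale_def prod_eq_iff vec_eq_iff)
qed

lemma data_scale_inner_self:
  fixes x :: "('n::finite, 'm::finite) cauchy_data"
  shows "data_scale c x \<bullet> x = Re c * (x \<bullet> x)"
proof -
  have "(\<i> *s v) \<bullet> v = 0" for v :: "complex^'m"
    by (simp add: inner_vec_def inner_complex_def)
  then have "data_scale \<i> x \<bullet> x = 0"
    by (simp add: data_scale_def inner_prod_def inner_vec_def[of "vec_lambda _"])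
  then show ?thesis by (subst data_scale_eq) (simp add: inner_add_left)
qed

lemma slice_has_derivative:
  assumes "smooth_on kasner_space u"
  shows "((\<lambda>y. u (1, y)) has_derivative (\<lambda>v. frechet_derivative u (at (1, y)) (0, v))) (at y)"
proof -
  have "((\<lambda>y. (1::real, y)) has_derivative (\<lambda>v. (0, v))) (at y)"
    by (auto intro!: derivative_eq_intros)
  from has_derivative_compose[OF this smooth_on_has_derivative[OF assms slice_in_kasner_space]]
  show ?thesis .
qed

lemma coord_deriv_slice:
  assumes "smooth_on kasner_space u"
  shows "coord_deriv k (\<lambda>y. u (1, y)) y = partial (Some k) u (1, y)"
  by (subst coord_deriv_eqI[OF slice_has_derivative[OF assms]]) (simp add: partial_def coord_vec_def)

lemma smooth_slice:
  assumes "smooth_on kasner_space u"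
  shows "smooth (\<lambda>y. u (1, y))"
proof -
  have "smooth (\<lambda>y. u ((1, 0) + (0, y)))"
    by (rule smooth_on_affine_comp[OF open_UNIV _ assms])
       (auto simp: kasner_space_def intro!: bounded_linear_Pair bounded_linear_ident bounded_linear_zero)
  then show ?thesis by simp
qed

lemma smooth_data: "smooth_on kasner_space u \<Longrightarrow> smooth (data u)"
  unfolding data_def[abs_def]
  by (intro smooth_on_Pair smooth_on_vec_lambda smooth_slice smooth_on_partial open_UNIV)

lemma coord_deriv_data:
  assumes u: "smooth_on kasner_space u"
  shows "coord_deriv k (data u) y = (partial (Some k) (partial None u) (1, y), partial (Some k) u (1, y),
     \<chi> j. partial (Some k) (partial (Some j) u) (1, y))"
proof -
  note s = smooth_data[OF u]
  have "fst (coord_deriv k (data u) y) = coord_deriv k (\<lambda>y. fst (data u y)) y"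
    by (simp add: coord_deriv_bounded_linear[OF s bounded_linear_fst])
  also have "\<dots> = partial (Some k) (partial None u) (1, y)"
    by (simp add: data_def coord_deriv_slice smooth_on_partial u)
  finally have 1: "fst (coord_deriv k (data u) y) = partial (Some k) (partial None u) (1, y)" .
  have "fst (snd (coord_deriv k (data u) y)) = coord_deriv k (\<lambda>y. fst (snd (data u y))) y"
    by (simp add: coord_deriv_bounded_linear[OF s bounded_linear_compose[OF bounded_linear_fst bounded_linear_snd]])
  also have "\<dots> = partial (Some k) u (1, y)"
    by (simp add: data_def coord_deriv_slice u)
  finally have 2: "fst (snd (coord_deriv k (data u) y)) = partial (Some k) u (1, y)" .
  have "snd (snd (coord_deriv k (data u) y)) $ j = coord_deriv k (\<lambda>y. snd (snd (data u y)) $ j) y" for j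
    by (simp add: coord_deriv_bounded_linear[OF s bounded_linear_compose[OF bounded_linear_vec_nth
        bounded_linear_compose[OF bounded_linear_snd bounded_linear_snd]]])
  also have "\<dots> j = partial (Some k) (partial (Some j) u) (1, y)" for j
    by (simp add: data_def coord_deriv_slice smooth_on_partial u)
  finally have 3: "snd (snd (coord_deriv k (data u) y)) = (\<chi> j. partial (Some k) (partial (Some j) u) (1, y))"
    by (simp add: vec_eq_iff)
  show ?thesis using 1 2 3 by (simp add: prod_eq_iff)
qed

lemma data_add:
  "smooth_on kasner_space u \<Longrightarrow> smooth_on kasner_space w \<Longrightarrow> data (\<lambda>z. u z + w z) = (\<lambda>y. data u y + data w y)"
  by (auto simp: data_def partial_add slice_in_kasner_space fun_eq_iff vec_eq_iff)

lemma data_cscale: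
  "smooth_on kasner_space u \<Longrightarrow> data (\<lambda>z. c *s u z) = (\<lambda>y. data_scale c (data u y))"
  by (simp add: data_def data_scale_def partial_bounded_linear[OF _ bounded_linear_complex_scale]
      slice_in_kasner_space fun_eq_iff)

lemma kasner_metric_at_one:
  "kasner_metric p (1, y) = (\<chi> \<mu> \<nu>. if \<mu> = \<nu> then (case \<mu> of None \<Rightarrow> - 1 | Some j \<Rightarrow> 1) else 0)"
  by (simp add: kasner_metric_def vec_eq_iff split: option.splits)

lemma dual_metric_at_one:
  fixes p :: "real^'n::finite"
  shows "dual_metric p (1, y) \<xi> \<xi> = (\<Sum>\<mu>\<in>UNIV. (case \<mu> of None \<Rightarrow> - 1 | Some j \<Rightarrow> 1) * (\<xi> $ \<mu>)\<^sup>2)"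
proof -
  define s :: "'n option \<Rightarrow> real" where "s \<mu> = (case \<mu> of None \<Rightarrow> - 1 | Some j \<Rightarrow> 1)" for \<mu>
  define G where "G = kasner_metric p (1, y)"
  have G: "G = (\<chi> \<mu> \<nu>. if \<mu> = \<nu> then s \<mu> else 0)"
    by (simp add: G_def kasner_metric_at_one s_def[abs_def] vec_eq_iff)
  have ss: "s \<mu> * s \<mu> = 1" for \<mu> by (simp add: s_def split: option.splits)
  have GG: "G ** G = mat 1"
    by (simp add: G matrix_matrix_mult_def mat_def vec_eq_iff if_distrib[of "\<lambda>x. x * _"] ss cong: if_cong)
  have "G ** matrix_inv G = mat 1"
    using someI[of "\<lambda>X. G ** X = mat 1 \<and> X ** G = mat 1" G] GG by (simp add: matrix_inv_def)
  then have "matrix_inv G = G"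
    using GG by (metis matrix_mul_assoc matrix_mul_lid matrix_mul_rid)
  then show ?thesis
    unfolding dual_metric_def G_def[symmetric]
    by (simp add: G matrix_vector_mult_def inner_vec_def if_distrib[of "\<lambda>x. x * _"] if_distrib[of "(*) _"] s_def[symmetric]
        power2_eq_square mult_ac cong: if_cong)
qed

locale kasner_wave_operator =
  fixes p :: "real^'n::finite" and P :: "('n, 'm::finite) field_op"
    and A :: "'n option \<Rightarrow> 'n option \<Rightarrow> real \<times> (real^'n) \<Rightarrow> complex^'m^'m"
    and B :: "'n option \<Rightarrow> real \<times> (real^'n) \<Rightarrow> complex^'m^'m"
    and C :: "real \<times> (real^'n) \<Rightarrow> complex^'m^'m"
  assumes p_less: "p $ j < 1"
    and B_smooth: "smooth_on kasner_space (B \<mu>)"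
    and C_smooth: "smooth_on kasner_space C"
    and symbol: "z \<in> kasner_space \<Longrightarrow> principal_symbol2 A z \<xi> = dual_metric p z \<xi> \<xi> *\<^sub>R mat 1"
    and P_eq: "smooth_on kasner_space u \<Longrightarrow> z \<in> kasner_space \<Longrightarrow>
       P u z = (\<Sum>\<mu>\<in>UNIV. \<Sum>\<nu>\<in>UNIV. A \<mu> \<nu> z *v partial \<mu> (partial \<nu> u) z)
               + (\<Sum>\<mu>\<in>UNIV. B \<mu> z *v partial \<mu> u z) + C z *v u z"
    and commutes: "smooth_on kasner_space u \<Longrightarrow> z \<in> kasner_space \<Longrightarrow>
       op_commutator (scaling_field p) (t_squared P) u z = 0"
begin

text \<open>Polarization: evaluating the principal symbol at \<open>axis \<mu> 1\<close> and at \<open>axis \<mu> 1 + axis \<nu> 1\<close> determines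
  the symmetric part of \<open>A\<close>. On the slice \<open>t = 1\<close> the metric is the Minkowski metric, whatever the
  exponents \<open>p\<close> are.\<close>

lemma symbol_coefficients:
  "A \<mu> \<nu> (1, y) + A \<nu> \<mu> (1, y) =
     (if \<mu> = \<nu> then - 2 * (case \<mu> of None \<Rightarrow> - 1 | Some j \<Rightarrow> 1) else 0) *\<^sub>R mat 1"
proof -
  define s :: "'n option \<Rightarrow> real" where "s \<mu> = (case \<mu> of None \<Rightarrow> - 1 | Some j \<Rightarrow> 1)" for \<mu>
  define a where "a \<mu> \<nu> = A \<mu> \<nu> (1, y)" for \<mu> \<nu>
  have sym: "(\<Sum>\<mu>\<in>UNIV. \<Sum>\<nu>\<in>UNIV. (- (\<xi> $ \<mu> * \<xi> $ \<nu>)) *\<^sub>R a \<mu> \<nu>)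
     = (\<Sum>\<mu>\<in>UNIV. s \<mu> * (\<xi> $ \<mu>)\<^sup>2) *\<^sub>R mat 1" for \<xi>
    using symbol[OF slice_in_kasner_space, of y \<xi>]
    unfolding principal_symbol2_def dual_metric_at_one s_def[symmetric] a_def[symmetric] .
  have e1: "(\<Sum>\<mu>\<in>UNIV. \<Sum>\<nu>\<in>UNIV. (- (axis k 1 $ \<mu> * axis l 1 $ \<nu>)) *\<^sub>R a \<mu> \<nu>) = - a k l" for k l
  proof -
    have "(- (axis k 1 $ \<mu> * axis l 1 $ \<nu>)) *\<^sub>R a \<mu> \<nu> = (if \<nu> = l then (if \<mu> = k then - a k l else 0) else 0)"
      for \<mu> \<nu> by (auto simp: axis_def)
    then show ?thesis by simp
  qed
  have e2: "(\<Sum>\<mu>\<in>UNIV. s \<mu> * (axis k 1 $ \<mu> * axis l 1 $ \<mu>)) = (if k = l then s k else 0)" for k l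
  proof -
    have "(\<Sum>\<mu>\<in>UNIV. s \<mu> * (axis k 1 $ \<mu> * axis l 1 $ \<mu>)) = (\<Sum>\<mu>\<in>UNIV. if \<mu> = k then (if k = l then s k else 0) else 0)"
      by (intro sum.cong refl) (auto simp: axis_def)
    then show ?thesis by simp
  qed
  have diag: "a k k = - s k *\<^sub>R mat 1" for k
    using sym[of "axis k 1"] e2[of k k] unfolding e1 power2_eq_square
    by (metis scaleR_minus_left minus_equation_iff)
  show ?thesis
  proof (cases "\<mu> = \<nu>")
    case True
    then show ?thesis using diag[of \<nu>]
      by (simp add: a_def[symmetric] s_def[symmetric] flip: scaleR_left_distrib scaleR_minus_left)
  next
    case False
    let ?\<xi> = "axis \<mu> 1 + axis \<nu> 1"
    have "- a \<mu> \<mu> + - a \<mu> \<nu> + (- a \<nu> \<mu> + - a \<nu> \<nu>) = (s \<mu> + s \<nu>) *\<^sub>R mat 1"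
    proof -
      have "(\<Sum>m\<in>UNIV. \<Sum>n\<in>UNIV. (- (?\<xi> $ m * ?\<xi> $ n)) *\<^sub>R a m n)
        = - a \<mu> \<mu> + - a \<mu> \<nu> + (- a \<nu> \<mu> + - a \<nu> \<nu>)"
        unfolding e1[symmetric] sum.distrib[symmetric]
        by (intro sum.cong refl) (simp add: algebra_simps)
      moreover have "(\<Sum>m\<in>UNIV. s m * (?\<xi> $ m)\<^sup>2) = s \<mu> + s \<nu>"
      proof -
        have "(\<Sum>m\<in>UNIV. s m * (?\<xi> $ m)\<^sup>2) =
          (\<Sum>m\<in>UNIV. s m * (axis \<mu> 1 $ m * axis \<mu> 1 $ m)) + (\<Sum>m\<in>UNIV. s m * (axis \<mu> 1 $ m * axis \<nu> 1 $ m))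
          + ((\<Sum>m\<in>UNIV. s m * (axis \<nu> 1 $ m * axis \<mu> 1 $ m)) + (\<Sum>m\<in>UNIV. s m * (axis \<nu> 1 $ m * axis \<nu> 1 $ m)))"
          unfolding sum.distrib[symmetric]
          by (intro sum.cong refl) (simp add: algebra_simps power2_eq_square)
        then show ?thesis unfolding e2 using False by simp
      qed
      ultimately show ?thesis using sym[of ?\<xi>] by simp
    qed
    then have "a \<mu> \<nu> + a \<nu> \<mu> = 0"
      unfolding diag by (simp add: algebra_simps)
    then show ?thesis using False by (simp add: a_def)
  qed
qed

text \<open>The antisymmetric part of \<open>A\<close> drops out because second partial derivatives commute.\<close>

lemma P_slice:
  assumes u: "smooth_on kasner_space u"
  shows "P u (1, y) = partial None (partial None u) (1, y)
     - (\<Sum>j\<in>UNIV. partial (Some j) (partial (Some j) u) (1, y))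
     + (\<Sum>\<mu>\<in>UNIV. B \<mu> (1, y) *v partial \<mu> u (1, y)) + C (1, y) *v u (1, y)"
proof -
  define s :: "'n option \<Rightarrow> real" where "s \<mu> = (case \<mu> of None \<Rightarrow> - 1 | Some j \<Rightarrow> 1)" for \<mu>
  define X where "X \<mu> \<nu> = partial \<mu> (partial \<nu> u) (1, y)" for \<mu> \<nu>
  have Xsym: "X \<mu> \<nu> = X \<nu> \<mu>" for \<mu> \<nu>
    unfolding X_def by (rule partial_commute[OF u slice_in_kasner_space])
  define Q where "Q = (\<Sum>\<mu>\<in>UNIV. \<Sum>\<nu>\<in>UNIV. A \<mu> \<nu> (1, y) *v X \<mu> \<nu>)"
  \<comment> \<open>Summing \<open>Q\<close> with both orders of the indices symmetrizes the coefficients.\<close>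
  have Q': "Q = (\<Sum>\<mu>\<in>UNIV. \<Sum>\<nu>\<in>UNIV. A \<nu> \<mu> (1, y) *v X \<mu> \<nu>)"
    unfolding Q_def by (subst sum.swap) (simp add: Xsym)
  have "Q + Q = (\<Sum>\<mu>\<in>UNIV. \<Sum>\<nu>\<in>UNIV. (A \<mu> \<nu> (1, y) + A \<nu> \<mu> (1, y)) *v X \<mu> \<nu>)"
    by (subst Q', unfold Q_def) (simp add: sum.distrib matrix_vector_mult_add_rdistrib)
  also have "\<dots> = (\<Sum>\<mu>\<in>UNIV. \<Sum>\<nu>\<in>UNIV. if \<nu> = \<mu> then (- 2 * s \<mu>) *\<^sub>R X \<mu> \<mu> else 0)"
  proof (intro sum.cong refl)
    fix \<mu> \<nu> :: "'n option"
    have sc: "(r *\<^sub>R mat 1) *v x = r *\<^sub>R x" for r and x :: "complex^'m"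
      using linear_scale[OF bounded_linear.linear[OF bounded_linear_matrix_vector_left[of x]], of r "mat 1"]
      by simp
    show "(A \<mu> \<nu> (1, y) + A \<nu> \<mu> (1, y)) *v X \<mu> \<nu> = (if \<nu> = \<mu> then (- 2 * s \<mu>) *\<^sub>R X \<mu> \<mu> else 0)"
      unfolding symbol_coefficients s_def[symmetric] sc by simp
  qed
  also have "\<dots> = 2 *\<^sub>R (\<Sum>\<mu>\<in>UNIV. (- s \<mu>) *\<^sub>R X \<mu> \<mu>)"
    by (simp add: scaleR_sum_right)
  finally have "2 *\<^sub>R Q = 2 *\<^sub>R (\<Sum>\<mu>\<in>UNIV. (- s \<mu>) *\<^sub>R X \<mu> \<mu>)" by (simp add: scaleR_2)
  then have "Q = (\<Sum>\<mu>\<in>UNIV. (- s \<mu>) *\<^sub>R X \<mu> \<mu>)" by simp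
  also have "\<dots> = X None None - (\<Sum>j\<in>UNIV. X (Some j) (Some j))"
    by (simp add: UNIV_option_conv sum.reindex s_def sum_negf)
  finally show ?thesis
    using P_eq[OF u slice_in_kasner_space] by (simp add: Q_def X_def)
qed

lemma P_cong:
  assumes u: "smooth_on kasner_space u" and eq: "\<And>z. z \<in> kasner_space \<Longrightarrow> u z = w z" and z: "z \<in> kasner_space"
  shows "P u z = P w z"
proof -
  have w: "smooth_on kasner_space w" using u smooth_on_cong[OF open_kasner_space, of u w] eq by simp
  have 1: "partial \<mu> u z = partial \<mu> w z" if "z \<in> kasner_space" for \<mu> z
    by (rule partial_cong) (use eq that in auto)
  have 2: "partial \<mu> (partial \<nu> u) z = partial \<mu> (partial \<nu> w) z" for \<mu> \<nu>
    by (rule partial_cong) (use 1 z in auto)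
  show ?thesis by (simp add: P_eq u w z 1 2 eq)
qed

lemma P_add:
  assumes u: "smooth_on kasner_space u" and w: "smooth_on kasner_space w" and z: "z \<in> kasner_space"
  shows "P (\<lambda>z. u z + w z) z = P u z + P w z"
proof -
  have uw: "smooth_on kasner_space (\<lambda>z. u z + w z)"
    by (intro smooth_on_add open_kasner_space u w)
  have 2: "partial \<mu> (partial \<nu> (\<lambda>z. u z + w z)) z = partial \<mu> (partial \<nu> u) z + partial \<mu> (partial \<nu> w) z" for \<mu> \<nu>
    using partial_cong[of "partial \<nu> (\<lambda>z. u z + w z)" "\<lambda>z. partial \<nu> u z + partial \<nu> w z" z \<mu>]
    by (simp add: partial_add u w z smooth_on_partial)
  show ?thesis
    by (simp add: P_eq uw u w z 2 partial_add matrix_vector_right_distrib sum.distrib)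
qed

lemma P_cscale:
  assumes u: "smooth_on kasner_space u" and z: "z \<in> kasner_space"
  shows "P (\<lambda>z. c *s u z) z = c *s P u z"
proof -
  note L = bounded_linear_complex_scale[where c=c]
  have cu: "smooth_on kasner_space (\<lambda>z. c *s u z)"
    by (rule smooth_on_bounded_linear[OF open_kasner_space u L])
  have 2: "partial \<mu> (partial \<nu> (\<lambda>z. c *s u z)) z = c *s partial \<mu> (partial \<nu> u) z" for \<mu> \<nu>
    using partial_cong[of "partial \<nu> (\<lambda>z. c *s u z)" "\<lambda>z. c *s partial \<nu> u z" z \<mu>]
    by (simp add: partial_bounded_linear[OF _ L] u z smooth_on_partial)
  have sum: "c *s (\<Sum>i\<in>I. f i) = (\<Sum>i\<in>I. c *s f i)" for I and f :: "'n option \<Rightarrow> complex^'m"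
    using linear_sum[OF bounded_linear.linear[OF L]] .
  show ?thesis
    by (simp add: P_eq cu u z 2 partial_bounded_linear[OF _ L] matrix_vector_mult_complex_scale
        sum vector_add_ldistrib)
qed

end

context kasner_wave_operator
begin

text \<open>The zeroth-order part of the evolution of \<open>data u\<close>. The terms \<open>- fst x\<close> in the first component and
  \<open>- (1 - p $ k)\<close> in the last one come from the commutators of \<open>\<partial>\<^sub>t\<close> and \<open>\<partial>\<^sub>k\<close> with the scaling field;
  \<open>- fst x\<close> in the middle component is \<open>- t \<partial>\<^sub>t u\<close> at \<open>t = 1\<close>.\<close>

definition zeroth :: "real^'n \<Rightarrow> ('n, 'm) cauchy_data \<Rightarrow> ('n, 'm) cauchy_data" where
  "zeroth y x = (B None (1, y) *v fst x + (\<Sum>j\<in>UNIV. B (Some j) (1, y) *v (snd (snd x) $ j))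
      + C (1, y) *v fst (snd x) + - fst x,
     - fst x, \<chi> k. - (1 - p $ k) *\<^sub>R (snd (snd x) $ k))"

lemma matrix_vector_mult_scaleR: "X *v (r *\<^sub>R x) = r *\<^sub>R (X *v x)" for X :: "complex^'m^'m"
  using linear_scale[OF bounded_linear.linear[OF bounded_linear_matrix_vector_right]] .

lemma linear_zeroth: "linear (zeroth y)"
  by (rule linearI)
     (simp_all add: zeroth_def prod_eq_iff vec_eq_iff matrix_vector_right_distrib matrix_vector_mult_scaleR
       sum.distrib scaleR_sum_right algebra_simps)

lemma smooth_zeroth: "smooth (\<lambda>y. zeroth y x)"
proof -
  have "smooth (\<lambda>y. X (1, y) *v v)" if "smooth_on kasner_space X"
    for X :: "real \<times> (real^'n) \<Rightarrow> complex^'m^'m" and v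
    by (rule smooth_on_bounded_linear[OF open_UNIV smooth_slice[OF that] bounded_linear_matrix_vector_left])
  then show ?thesis unfolding zeroth_def
    by (intro smooth_on_Pair smooth_on_add smooth_on_sum smooth_on_const open_UNIV)
       (auto intro: B_smooth C_smooth)
qed

text \<open>Here \<open>p $ j < 1\<close> enters: the rates \<open>1 - p $ j\<close> of the drift are positive.\<close>

sublocale transport_system "\<lambda>j. 1 - p $ j" coupling "\<lambda>y. Blinfun (zeroth y)" "Max (range (\<lambda>j. 1 / (1 - p $ j)))"
proof (rule transport_system.intro)
  show "0 < 1 - p $ k" for k :: 'n using p_less[of k] by simp
  show "linear (coupling k)" for k :: 'n by (rule linear_coupling)
  show "coupling k x \<bullet> y = x \<bullet> coupling k y" for k :: 'n and x y :: "('n, 'm) cauchy_data" by (rule coupling_sym)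
  show "\<bar>coupling k x \<bullet> x\<bar> \<le> x \<bullet> x" for k :: 'n and x :: "('n, 'm) cauchy_data" by (rule coupling_bound)
  show "smooth (\<lambda>y. Blinfun (zeroth y))" by (rule smooth_Blinfun[OF linear_zeroth smooth_zeroth])
  show "1 \<le> (1 - p $ k) * Max (range (\<lambda>j. 1 / (1 - p $ j)))" for k
  proof -
    have "1 = (1 - p $ k) * (1 / (1 - p $ k))" using p_less[of k] by simp
    also have "\<dots> \<le> (1 - p $ k) * Max (range (\<lambda>j. 1 / (1 - p $ j)))"
      by (intro mult_left_mono Max_ge) (use p_less[of k] in auto)
    finally show ?thesis .
  qed
qed

section \<open>Solutions, the scaling field and the modes\<close>

definition solutions :: "(real \<times> (real^'n) \<Rightarrow> complex^'m) set" where
  "solutions = {u. (\<forall>z. z \<notin> kasner_space \<longrightarrow> u z = 0) \<and> smooth_on kasner_space u \<and>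
     (\<forall>z\<in>kasner_space. P u z = 0)}"

lemma solutions_smooth: "u \<in> solutions \<Longrightarrow> smooth_on kasner_space u"
  by (simp add: solutions_def)

lemma partial_scaling_field:
  fixes u :: "real \<times> (real^'n) \<Rightarrow> complex^'m"
  assumes u: "smooth_on kasner_space u" and z: "z \<in> kasner_space"
  shows "partial \<mu> (scaling_field p u) z = scaling_field p (partial \<mu> u) z
     - (case \<mu> of None \<Rightarrow> 1 | Some j \<Rightarrow> 1 - p $ j) *\<^sub>R partial \<mu> u z"
proof -
  have d: "(partial \<nu> u has_derivative frechet_derivative (partial \<nu> u) (at z)) (at z)" for \<nu>
    by (rule smooth_on_has_derivative[OF smooth_on_partial[OF u] z])
  have c: "((\<lambda>z::real \<times> (real^'n). (1 - p $ j) * snd z $ j) has_derivative (\<lambda>v. (1 - p $ j) * snd v $ j)) (at z)" for j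
    by (rule bounded_linear.has_derivative[OF bounded_linear_compose[OF bounded_linear_mult_right
          bounded_linear_compose[OF bounded_linear_vec_nth bounded_linear_snd]] has_derivative_ident])
  have "(scaling_field p u has_derivative
      (\<lambda>v. - (fst z *\<^sub>R frechet_derivative (partial None u) (at z) v + fst v *\<^sub>R partial None u z)
       - (\<Sum>j\<in>UNIV. ((1 - p $ j) * snd z $ j) *\<^sub>R frechet_derivative (partial (Some j) u) (at z) v
            + ((1 - p $ j) * snd v $ j) *\<^sub>R partial (Some j) u z))) (at z)"
    unfolding scaling_field_def[abs_def]
    by (intro has_derivative_diff has_derivative_minus has_derivative_sum has_derivative_scaleR d c
         has_derivative_fst has_derivative_ident)
  from partial_eqI[OF this, of \<mu>]
  have e1: "partial \<mu> (scaling_field p u) z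
     = - (fst z *\<^sub>R partial None (partial \<mu> u) z + fst (coord_vec \<mu>) *\<^sub>R partial None u z)
       - (\<Sum>j\<in>UNIV. ((1 - p $ j) * snd z $ j) *\<^sub>R partial (Some j) (partial \<mu> u) z
            + ((1 - p $ j) * snd (coord_vec \<mu>) $ j) *\<^sub>R partial (Some j) u z)"
    using partial_commute[OF u z, of \<mu>] by (simp add: partial_def[abs_def])
  have e2: "fst (coord_vec \<mu>) *\<^sub>R partial None u z
       + (\<Sum>j\<in>UNIV. ((1 - p $ j) * snd (coord_vec \<mu>) $ j) *\<^sub>R partial (Some j) u z)
     = (case \<mu> of None \<Rightarrow> 1 | Some j \<Rightarrow> 1 - p $ j) *\<^sub>R partial \<mu> u z"
  proof (cases \<mu>)
    case None
    then show ?thesis by (simp add: coord_vec_def)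
  next
    case (Some k)
    have "((1 - p $ j) * axis k 1 $ j) *\<^sub>R partial (Some j) u z
       = (if j = k then (1 - p $ k) *\<^sub>R partial (Some k) u z else 0)" for j
      by (auto simp: axis_def)
    then show ?thesis using Some by (simp add: coord_vec_def)
  qed
  have "x = (- a - s) - w" if "x = - (a + b) - (s + r)" "b + r = w"
    for x a b s r w :: "complex^'m" using that by auto
  from this[OF e1[unfolded sum.distrib] e2] show ?thesis
    unfolding scaling_field_def .
qed

lemma smooth_scaling_field:
  fixes u :: "real \<times> (real^'n) \<Rightarrow> complex^'m"
  assumes u: "smooth_on kasner_space u"
  shows "smooth_on kasner_space (scaling_field p u)"
proof -
  have "smooth_on kasner_space (\<lambda>z. (- fst z) *\<^sub>R partial None u z
     + (\<Sum>j\<in>UNIV. (- (1 - p $ j) * snd z $ j) *\<^sub>R partial (Some j) u z))"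
  proof (intro smooth_on_add smooth_on_sum open_kasner_space
      smooth_on_bilinear[OF open_kasner_space bounded_bilinear_scaleR] smooth_on_partial u)
    show "smooth_on kasner_space (\<lambda>z::real \<times> (real^'n). - fst z)"
      by (rule smooth_on_bounded_linear[OF open_kasner_space smooth_on_ident[OF open_kasner_space]])
         (intro bounded_linear_minus bounded_linear_fst)
    show "smooth_on kasner_space (\<lambda>z::real \<times> (real^'n). - (1 - p $ j) * snd z $ j)" for j
      by (rule smooth_on_bounded_linear[OF open_kasner_space smooth_on_ident[OF open_kasner_space]
            bounded_linear_compose[OF bounded_linear_mult_right
          bounded_linear_compose[OF bounded_linear_vec_nth bounded_linear_snd]]])
  qed
  moreover have "(\<lambda>z. (- fst z) *\<^sub>R partial None u z
     + (\<Sum>j\<in>UNIV. (- (1 - p $ j) * snd z $ j) *\<^sub>R partial (Some j) u z)) = scaling_field p u"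
    by (simp only: scaling_field_def[abs_def] mult_minus_left scaleR_minus_left sum_negf diff_conv_add_uminus)
  ultimately show ?thesis by simp
qed

lemma generator_eq:
  fixes u :: "real \<times> (real^'n) \<Rightarrow> complex^'m"
  shows "z \<in> kasner_space \<Longrightarrow> generator p u z = scaling_field p u z"
  by (simp add: generator_def)

lemma smooth_generator:
  fixes u :: "real \<times> (real^'n) \<Rightarrow> complex^'m"
  shows "smooth_on kasner_space u \<Longrightarrow> smooth_on kasner_space (generator p u)"
  using smooth_on_cong[OF open_kasner_space, of "generator p u" "scaling_field p u"]
  by (simp add: generator_eq smooth_scaling_field)

text \<open>The only use of the commutation hypothesis: \<open>t\<^sup>2 P u\<close> vanishes on the open spacetime, hence so does
  its derivative along the scaling field, which equals \<open>t\<^sup>2 P\<close> applied to the scaling field of \<open>u\<close>.\<close>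

lemma generator_in_solutions:
  assumes u: "u \<in> solutions"
  shows "generator p u \<in> solutions"
proof -
  have su: "smooth_on kasner_space u" using u by (rule solutions_smooth)
  have "P (generator p u) z = 0" if z: "z \<in> kasner_space" for z
  proof -
    have "partial \<mu> (t_squared P u) z = 0" for \<mu>
    proof -
      have "partial \<mu> (t_squared P u) z = partial \<mu> (\<lambda>_. 0 :: complex^'m) z"
        using u by (intro partial_cong z) (simp add: t_squared_def solutions_def)
      then show ?thesis by (simp add: partial_def)
    qed
    then have "scaling_field p (t_squared P u) z = 0" by (simp add: scaling_field_def)
    then have "t_squared P (scaling_field p u) z = 0"
      using commutes[OF su z] by (simp add: op_commutator_def)
    then have "P (scaling_field p u) z = 0"
      using z by (auto simp: t_squared_def kasner_space_def)
    moreover have "P (generator p u) z = P (scaling_field p u) z"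
      by (rule P_cong[OF smooth_generator[OF su] generator_eq z])
    ultimately show ?thesis by simp
  qed
  then show ?thesis
    using smooth_generator[OF su] by (simp add: solutions_def generator_def)
qed

text \<open>On solutions the wave equation expresses the second time derivative by spatial derivatives of the
  data, so the action of the scaling field can be read off from the data alone.\<close>

lemma data_generator:
  assumes u: "u \<in> solutions"
  shows "data (generator p u) = evol (data u)"
proof
  fix y
  have su: "smooth_on kasner_space u" using u by (rule solutions_smooth)
  have pg: "partial \<mu> (generator p u) (1, y) = scaling_field p (partial \<mu> u) (1, y)
     - (case \<mu> of None \<Rightarrow> 1 | Some j \<Rightarrow> 1 - p $ j) *\<^sub>R partial \<mu> u (1, y)" for \<mu>
  proof -
    have "partial \<mu> (generator p u) (1, y) = partial \<mu> (scaling_field p u) (1, y)"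
      by (rule partial_cong[OF generator_eq slice_in_kasner_space])
    then show ?thesis using partial_scaling_field[OF su slice_in_kasner_space, of \<mu> y] by simp
  qed
  have ap: "blinfun_apply (Blinfun (zeroth y)) = zeroth y"
    using linear_zeroth linear_conv_bounded_linear by (intro bounded_linear_Blinfun_apply) blast
  have wave: "partial None (partial None u) (1, y) = (\<Sum>j\<in>UNIV. partial (Some j) (partial (Some j) u) (1, y))
     - (B None (1, y) *v partial None u (1, y) + (\<Sum>j\<in>UNIV. B (Some j) (1, y) *v partial (Some j) u (1, y)))
     - C (1, y) *v u (1, y)"
    using u P_slice[OF su, of y] slice_in_kasner_space[of y]
    by (simp add: solutions_def UNIV_option_conv sum.reindex algebra_simps)
  show "data (generator p u) y = evol (data u) y"
  proof (intro prod_eqI)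
    show "fst (data (generator p u) y) = fst (evol (data u) y)"
      by (simp add: evol_def ap fst_sum coord_deriv_data[OF su] coupling_def zeroth_def data_def pg
          scaling_field_def wave sum_subtractf sum_negf)
    show "fst (snd (data (generator p u) y)) = fst (snd (evol (data u) y))"
      by (simp add: evol_def ap fst_sum snd_sum coord_deriv_data[OF su] coupling_def zeroth_def data_def
          generator_eq slice_in_kasner_space scaling_field_def sum_subtractf sum_negf)
    show "snd (snd (data (generator p u) y)) = snd (snd (evol (data u) y))"
    proof (rule vec_eq_iff[THEN iffD2], rule allI)
      fix i
      have ax: "(\<Sum>k\<in>UNIV. axis k (f k) $ i) = f i" for f :: "'n \<Rightarrow> complex^'m"
        by (simp add: axis_def if_distrib cong: if_cong)
      have comm: "partial None (partial (Some i) u) (1, y) = partial (Some i) (partial None u) (1, y)"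
        by (rule partial_commute[OF su slice_in_kasner_space])
      show "snd (snd (data (generator p u) y)) $ i = snd (snd (evol (data u) y)) $ i"
        by (simp add: evol_def ap snd_sum coord_deriv_data[OF su] coupling_def zeroth_def data_def pg
          scaling_field_def comm sum_subtractf sum_negf ax)
           (simp add: scaleR_left_diff_distrib)
    qed
  qed
qed

text \<open>The integral curve \<open>s \<mapsto> (exp s, exp ((1 - p $ j) * s) * y $ j)\<close> of the scaling field, with the
  opposite orientation, starts at \<open>(1, y)\<close>. Along it \<open>u\<close> solves a linear ordinary differential equation,
  and every point of the spacetime lies on such a curve.\<close>

lemma eigenfunction_vanishes:
  assumes u: "u \<in> solutions" and eig: "generator p u = (\<lambda>z. c *s u z)"
    and zero: "\<And>y. u (1, y) = 0"
  shows "u z = 0"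
proof (cases "z \<in> kasner_space")
  case False
  then show ?thesis using u by (cases z) (simp add: solutions_def)
next
  case True
  have su: "smooth_on kasner_space u" using u by (rule solutions_smooth)
  obtain t x where tx: "z = (t, x)" "t > 0" using True by (auto simp: kasner_space_def)
  define y where "y = (\<chi> j. x $ j * exp (- (1 - p $ j) * ln t))"
  define \<gamma> where "\<gamma> s = (exp s, \<chi> j. exp ((1 - p $ j) * s) * y $ j)" for s :: real
  define \<gamma>' where "\<gamma>' s = (exp s, \<chi> j. (1 - p $ j) * (exp ((1 - p $ j) * s) * y $ j))" for s :: real
  have \<gamma>K: "\<gamma> s \<in> kasner_space" for s by (simp add: \<gamma>_def kasner_space_def)
  have d\<gamma>: "(\<gamma> has_derivative (\<lambda>h. h *\<^sub>R \<gamma>' s)) (at s)" for s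
  proof -
    have 1: "(exp has_derivative (\<lambda>h. h *\<^sub>R exp s)) (at s)" for s :: real
      using DERIV_exp[of s] by (simp add: has_field_derivative_def mult_commute_abs)
    have "((\<lambda>s. exp ((1 - p $ j) * s) * y $ j) has_real_derivative (1 - p $ j) * (exp ((1 - p $ j) * s) * y $ j)) (at s)" for j
      by (auto intro!: derivative_eq_intros)
    then have 2: "((\<lambda>s. exp ((1 - p $ j) * s) * y $ j) has_derivative (\<lambda>h. h *\<^sub>R ((1 - p $ j) * (exp ((1 - p $ j) * s) * y $ j)))) (at s)" for j
      by (simp add: has_field_derivative_def mult_commute_abs)
    have "((\<lambda>s. \<Sum>j\<in>UNIV. axis j (exp ((1 - p $ j) * s) * y $ j)) has_derivative
       (\<lambda>h. \<Sum>j\<in>UNIV. axis j (h *\<^sub>R ((1 - p $ j) * (exp ((1 - p $ j) * s) * y $ j))))) (at s)"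
      by (intro has_derivative_sum bounded_linear.has_derivative[OF bounded_linear_axis] 2)
    then have "((\<lambda>s. \<chi> j. exp ((1 - p $ j) * s) * y $ j) has_derivative
       (\<lambda>h. \<chi> j. h *\<^sub>R ((1 - p $ j) * (exp ((1 - p $ j) * s) * y $ j)))) (at s)"
      by (simp add: sum_axis)
    from has_derivative_Pair[OF 1 this]
    show ?thesis unfolding \<gamma>_def[abs_def] \<gamma>'_def
      by (rule has_derivative_eq_rhs) (simp add: fun_eq_iff scaleR_prod_def vec_eq_iff)
  qed
  have \<gamma>'_eq: "\<gamma>' s = fst (\<gamma> s) *\<^sub>R coord_vec None + (\<Sum>j\<in>UNIV. ((1 - p $ j) * snd (\<gamma> s) $ j) *\<^sub>R coord_vec (Some j))" for s
    by (simp add: \<gamma>_def \<gamma>'_def coord_vec_def prod_eq_iff fst_sum snd_sum vec_eq_iff axis_def if_distrib cong: if_cong)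
  have du: "((\<lambda>s. u (\<gamma> s)) has_vector_derivative - (c *s u (\<gamma> s))) (at s)" for s
  proof -
    let ?D = "frechet_derivative u (at (\<gamma> s))"
    have D: "(u has_derivative ?D) (at (\<gamma> s))" by (rule smooth_on_has_derivative[OF su \<gamma>K])
    have lin: "linear ?D" using D has_derivative_linear by blast
    have "?D (\<gamma>' s) = - scaling_field p u (\<gamma> s)"
      unfolding \<gamma>'_eq
      by (simp add: linear_add[OF lin] linear_sum[OF lin] linear_scale[OF lin] scaling_field_def partial_def)
    also have "scaling_field p u (\<gamma> s) = c *s u (\<gamma> s)"
      using fun_cong[OF eig, of "\<gamma> s"] generator_eq[OF \<gamma>K, of u s] by simp
    finally have Dg: "?D (\<gamma>' s) = - (c *s u (\<gamma> s))" .
    have "((\<lambda>s. u (\<gamma> s)) has_derivative (\<lambda>h. ?D (h *\<^sub>R \<gamma>' s))) (at s)"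
      by (rule has_derivative_compose[OF d\<gamma> D])
    then show ?thesis by (simp add: has_vector_derivative_def linear_scale[OF lin] Dg)
  qed
  have const: "u (\<gamma> s) $ i = 0" for s i
  proof -
    \<comment> \<open>The integrating factor makes this component constant along the curve.\<close>
    define f where "f s = exp (c * of_real s) * (u (\<gamma> s) $ i)" for s :: real
    have e: "((\<lambda>s::real. exp (c * of_real s)) has_vector_derivative c * exp (c * of_real s)) (at s)" for s
    proof -
      have "((\<lambda>w. exp (c * w)) has_field_derivative c * exp (c * of_real s)) (at (of_real s))"
        by (auto intro!: derivative_eq_intros simp: mult.commute)
      then show ?thesis by (rule has_vector_derivative_real_field)
    qed
    have "((\<lambda>s. u (\<gamma> s) $ i) has_vector_derivative - (c * (u (\<gamma> s) $ i))) (at s)" for s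
      using bounded_linear.has_vector_derivative[OF bounded_linear_vec_nth du, of i s] by simp
    from has_vector_derivative_mult[OF e this]
    have "(f has_vector_derivative 0) (at s)" for s
      unfolding f_def[abs_def] by (simp add: algebra_simps)
    then have "(f has_derivative (\<lambda>h. 0)) (at s within UNIV)" for s
      by (simp add: has_vector_derivative_def)
    then have "f s = f 0"
      using has_derivative_zero_constant[of UNIV f] by (metis UNIV_I convex_UNIV)
    also have "f 0 = 0" by (simp add: f_def \<gamma>_def zero)
    finally show ?thesis by (simp add: f_def)
  qed
  have "\<gamma> (ln t) = z"
    using tx by (simp add: \<gamma>_def y_def vec_eq_iff mult.left_commute flip: exp_add) (simp add: algebra_simps)
  then show ?thesis using const[of "ln t"] by (simp add: vec_eq_iff)
qed

lemma subspace_solutions: "cfun.subspace solutions"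
proof -
  have "(\<lambda>z. u z + w z) \<in> solutions" if "u \<in> solutions" "w \<in> solutions" for u w
    using that by (simp add: solutions_def smooth_on_add open_kasner_space P_add)
  moreover have c: "(\<lambda>z. c *s u z) \<in> solutions" if "u \<in> solutions" for c u
  proof -
    have "smooth_on kasner_space (\<lambda>z. c *s u z)"
      by (rule smooth_on_bounded_linear[OF open_kasner_space solutions_smooth[OF that] bounded_linear_complex_scale])
    then show ?thesis using that by (simp add: solutions_def P_cscale)
  qed
  moreover have "(\<lambda>z. 0) \<in> solutions"
  proof -
    have 0: "smooth_on kasner_space (\<lambda>z::real \<times> (real^'n). 0 :: complex^'m)"
      by (rule smooth_on_const[OF open_kasner_space])
    have "P (\<lambda>z. 0) z = 0" if "z \<in> kasner_space" for z
      using P_cscale[OF 0 that, of 0] by simp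
    then show ?thesis using 0 by (simp add: solutions_def)
  qed
  ultimately show ?thesis
    by (simp add: cfun.subspace_def cscale_fun_def plus_fun_def zero_fun_def)
qed

lemma generator_add:
  "u \<in> solutions \<Longrightarrow> w \<in> solutions \<Longrightarrow> generator p (u + w) = generator p u + generator p w"
  by (rule ext)
     (simp add: generator_def scaling_field_def plus_fun_def partial_add solutions_smooth
       scaleR_add_right sum.distrib)

lemma generator_cscale:
  "u \<in> solutions \<Longrightarrow> generator p (cscale_fun c u) = cscale_fun c (generator p u)"
proof (rule ext)
  fix z assume u: "u \<in> solutions"
  have L: "linear (\<lambda>x :: complex^'m. c *s x)"
    using bounded_linear_complex_scale bounded_linear.linear by blast
  show "generator p (cscale_fun c u) z = cscale_fun c (generator p u) z"
    by (simp add: generator_def scaling_field_def cscale_fun_def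
       partial_bounded_linear[OF solutions_smooth[OF u] bounded_linear_complex_scale]
       linear_diff[OF L] linear_neg[OF L] linear_sum[OF L] linear_scale[OF L])
qed

abbreviation (input) J :: "('n, 'm) cauchy_data \<Rightarrow> ('n, 'm) cauchy_data" where
  "J \<equiv> data_scale \<i>"

text \<open>The imaginary part is determined by complex linearity in the first argument, because multiplication
  by \<open>\<i>\<close> is an isometry for \<open>sob N\<close>.\<close>

definition hermitian :: "nat \<Rightarrow> (real \<times> (real^'n) \<Rightarrow> complex^'m) \<Rightarrow> (real \<times> (real^'n) \<Rightarrow> complex^'m) \<Rightarrow> complex" where
  "hermitian N u w = Complex (sob N (data u) (data w)) (sob N (data u) (\<lambda>y. J (data w y)))"

lemma sob_J_J:
  "smooth U \<Longrightarrow> smooth W \<Longrightarrow> sob N (\<lambda>y. J (U y)) (\<lambda>y. J (W y)) = sob N U W"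
  by (simp add: sob_def coord_derivs_bounded_linear[OF _ bounded_linear_data_scale] data_scale_inner)

lemma smooth_J: "smooth U \<Longrightarrow> smooth (\<lambda>y. J (U y))"
  by (rule smooth_on_bounded_linear[OF open_UNIV _ bounded_linear_data_scale])

lemma J_J: "J (J x) = - x"
  by (simp add: data_scale_def prod_eq_iff vec_eq_iff)

lemma sob_J_left:
  assumes U: "smooth U" and W: "smooth W"
  shows "sob N (\<lambda>y. J (U y)) W = - sob N U (\<lambda>y. J (W y))"
proof -
  have JW: "smooth (\<lambda>y. J (W y))" by (rule smooth_J[OF W])
  have mJW: "smooth (\<lambda>y. (- 1) *\<^sub>R J (W y))" by (rule smooth_on_scaleR_const[OF open_UNIV JW])
  have "sob N (\<lambda>y. J (U y)) (\<lambda>y. J ((- 1) *\<^sub>R J (W y))) = sob N U (\<lambda>y. (- 1) *\<^sub>R J (W y))"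
    by (rule sob_J_J[OF U mJW])
  moreover have "J ((- 1) *\<^sub>R J x) = x" for x
    using linear_neg[OF bounded_linear.linear[OF bounded_linear_data_scale[of \<i>]], of "J x"] by (simp add: J_J)
  moreover have "sob N U (\<lambda>y. (- 1) *\<^sub>R J (W y)) = - sob N U (\<lambda>y. J (W y))"
    using sob_scaleR_left[OF JW, of N "- 1" U] by (simp add: sob_commute[of N U])
  ultimately show ?thesis by simp
qed

lemma hermitian_cnj:
  assumes "u \<in> solutions" "w \<in> solutions"
  shows "hermitian N w u = cnj (hermitian N u w)"
proof -
  have s: "smooth (data u)" "smooth (data w)" using assms by (auto intro: smooth_data solutions_smooth)
  have "sob N (data w) (\<lambda>y. J (data u y)) = - sob N (data u) (\<lambda>y. J (data w y))"
    using sob_J_left[OF s, of N] by (simp add: sob_commute[of N "data w"])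
  then show ?thesis by (simp add: hermitian_def complex_eq_iff sob_commute[of N "data w" "data u"])
qed

lemma data_plus: "u \<in> solutions \<Longrightarrow> w \<in> solutions \<Longrightarrow> data (u + w) = (\<lambda>y. data u y + data w y)"
  using data_add[of u w] by (simp add: solutions_smooth plus_fun_def)

lemma data_cscale_fun: "u \<in> solutions \<Longrightarrow> data (cscale_fun c u) = (\<lambda>y. data_scale c (data u y))"
  using data_cscale[of u c] by (simp add: solutions_smooth cscale_fun_def)

lemma hermitian_add:
  assumes "u \<in> solutions" "u' \<in> solutions" "w \<in> solutions"
  shows "hermitian N (u + u') w = hermitian N u w + hermitian N u' w"
  using assms
  by (simp add: hermitian_def data_plus sob_add_left smooth_data solutions_smooth smooth_J complex_eq_iff)

lemma hermitian_cscale: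
  assumes "u \<in> solutions" "w \<in> solutions"
  shows "hermitian N (cscale_fun c u) w = c * hermitian N u w"
proof -
  have s: "smooth (data u)" "smooth (data w)" using assms by (auto intro: smooth_data solutions_smooth)
  have e: "data (cscale_fun c u) = (\<lambda>y. Re c *\<^sub>R data u y + Im c *\<^sub>R J (data u y))"
    unfolding data_cscale_fun[OF assms(1)] using data_scale_eq by (rule ext)
  have "sob N (data (cscale_fun c u)) W = Re c * sob N (data u) W - Im c * sob N (data u) (\<lambda>y. J (W y))"
    if W: "smooth W" for W
    unfolding e
    using sob_add_left[OF smooth_on_scaleR_const[OF open_UNIV s(1)] smooth_on_scaleR_const[OF open_UNIV smooth_J[OF s(1)]] W]
    by (simp add: sob_scaleR_left s smooth_J sob_J_left W)
  from this[OF s(2)] this[OF smooth_J[OF s(2)]]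
  have 1: "sob N (data (cscale_fun c u)) (data w) = Re c * sob N (data u) (data w) - Im c * sob N (data u) (\<lambda>y. J (data w y))"
    and 2: "sob N (data (cscale_fun c u)) (\<lambda>y. J (data w y))
       = Re c * sob N (data u) (\<lambda>y. J (data w y)) - Im c * sob N (data u) (\<lambda>y. J (J (data w y)))"
    by auto
  have "sob N (data u) (\<lambda>y. J (J (data w y))) = - sob N (data u) (data w)"
    using sob_scaleR_left[OF s(2), of N "- 1" "data u"] by (simp add: J_J sob_commute[of N "data u"])
  then show ?thesis using 1 2 by (simp add: hermitian_def complex_eq_iff)
qed

lemma hermitian_null_data:
  assumes "u \<in> solutions" "hermitian N u u = 0" "y \<in> Om"
  shows "data u y = 0"
  using sob_null[OF smooth_data[OF solutions_smooth[OF assms(1)]], of N y] assms(2,3)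
  by (simp add: hermitian_def complex_eq_iff)

text \<open>A null vector of the form has data vanishing on the cube. This property is inherited under the
  evolution; for an eigenvector, unique continuation and transport along the scaling field show that the
  field vanishes identically.\<close>

lemma bounded_flags_solutions:
  "\<exists>N D. bounded_flags cscale_fun solutions (generator p) (hermitian N) \<alpha> D"
proof -
  obtain N D where ND: "\<And>d v. orthonormal N d v \<Longrightarrow> (\<And>i. i < d \<Longrightarrow> - \<alpha> \<le> sob N (evol (v i)) (v i)) \<Longrightarrow> d \<le> D"
    using dimension_bound[of \<alpha>] by blast
  have sd: "smooth (data u)" if "u \<in> solutions" for u using that by (intro smooth_data solutions_smooth)
  have "bounded_flags cscale_fun solutions (generator p) (hermitian N) \<alpha> D"
  proof (intro bounded_flags.intro cfun.vector_space_axioms bounded_flags_axioms.intro)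
    show "cfun.subspace solutions" by (rule subspace_solutions)
    show "generator p u \<in> solutions" if "u \<in> solutions" for u using that by (rule generator_in_solutions)
    show "generator p (u + w) = generator p u + generator p w" if "u \<in> solutions" "w \<in> solutions" for u w
      using that by (rule generator_add)
    show "generator p (cscale_fun c u) = cscale_fun c (generator p u)" if "u \<in> solutions" for u c
      using that by (rule generator_cscale)
    show "hermitian N (u + u') w = hermitian N u w + hermitian N u' w"
      if "u \<in> solutions" "u' \<in> solutions" "w \<in> solutions" for u u' w using that by (rule hermitian_add)
    show "hermitian N (cscale_fun c u) w = c * hermitian N u w" if "u \<in> solutions" "w \<in> solutions" for u w c
      using that by (rule hermitian_cscale)
    show "hermitian N w u = cnj (hermitian N u w)" if "u \<in> solutions" "w \<in> solutions" for u w
      using that by (rule hermitian_cnj)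
    show "0 \<le> Re (hermitian N u u)" if "u \<in> solutions" for u
      using sob_nonneg[OF sd[OF that]] by (simp add: hermitian_def)
    show "hermitian N u w = 0" if "u \<in> solutions" "hermitian N u u = 0" "w \<in> solutions" for u w
      using sob_vanish[OF sd[OF that(1)] hermitian_null_data[OF that(1,2)]]
      by (simp add: hermitian_def complex_eq_iff)
    show "hermitian N (generator p u) w = 0" if "u \<in> solutions" "hermitian N u u = 0" "w \<in> solutions" for u w
    proof -
      have "data (generator p u) y = 0" if "y \<in> Om" for y
        unfolding data_generator[OF \<open>u \<in> solutions\<close>]
        by (rule evol_vanishes[OF sd hermitian_null_data that]) (use \<open>u \<in> solutions\<close> \<open>hermitian N u u = 0\<close> in auto)
      then show ?thesis
        using sob_vanish[OF sd[OF generator_in_solutions[OF that(1)]]]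
        by (simp add: hermitian_def complex_eq_iff)
    qed
    show "u = 0" if u: "u \<in> solutions" and eig: "generator p u = cscale_fun \<mu> u" and null: "hermitian N u u = 0" for u \<mu>
    proof -
      have "evol (data u) y \<bullet> data u y = Re \<mu> * (data u y \<bullet> data u y)" for y
        unfolding data_generator[OF u, symmetric] eig data_cscale_fun[OF u] by (rule data_scale_inner_self)
      from unique_continuation[OF sd[OF u] this hermitian_null_data[OF u null]]
      have "data u y = 0" for y by blast
      then have "u (1, y) = 0" for y by (simp add: data_def prod_eq_iff)
      from eigenfunction_vanishes[OF u _ this, of \<mu>] eig
      show ?thesis by (auto simp: cscale_fun_def)
    qed
    show "d \<le> D" if "\<And>i. i < d \<Longrightarrow> v i \<in> solutions"
      "\<And>i j. i < d \<Longrightarrow> j < d \<Longrightarrow> hermitian N (v i) (v j) = (if i = j then 1 else 0)"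
      "\<And>i. i < d \<Longrightarrow> - \<alpha> \<le> Re (hermitian N (generator p (v i)) (v i))" for d v
    proof (rule ND[of d "\<lambda>i. data (v i)"])
      have "sob N (data (v i)) (data (v j)) = (if i = j then 1 else 0)" if "i < d" "j < d" for i j
        using arg_cong[OF \<open>\<And>i j. i < d \<Longrightarrow> j < d \<Longrightarrow> hermitian N (v i) (v j) = (if i = j then 1 else 0)\<close>[OF that], of Re]
        by (simp add: hermitian_def split: if_splits)
      then show "orthonormal N d (\<lambda>i. data (v i))"
        using sd that(1) by (simp add: orthonormal_def)
      show "- \<alpha> \<le> sob N (evol (data (v i))) (data (v i))" if "i < d" for i
        using \<open>\<And>i. i < d \<Longrightarrow> - \<alpha> \<le> Re (hermitian N (generator p (v i)) (v i))\<close>[OF that]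
          data_generator[OF \<open>\<And>i. i < d \<Longrightarrow> v i \<in> solutions\<close>[OF that]]
        by (simp add: hermitian_def)
    qed
  qed
  then show ?thesis by blast
qed

definition gen_shift :: "complex \<Rightarrow> (real \<times> (real^'n) \<Rightarrow> complex^'m) \<Rightarrow> real \<times> (real^'n) \<Rightarrow> complex^'m" where
  "gen_shift \<mu> u = generator p u - cscale_fun \<mu> u"

definition restrict_field :: "(real \<times> (real^'n) \<Rightarrow> complex^'m) \<Rightarrow> real \<times> (real^'n) \<Rightarrow> complex^'m" where
  "restrict_field u z = (if z \<in> kasner_space then u z else 0)"

lemma scaling_shift_funpow:
  "restrict_field ((scaling_shift p \<sigma> ^^ k) u) = (gen_shift (- \<i> * \<sigma>) ^^ k) (restrict_field u)"
proof (induction k)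
  case 0
  then show ?case by simp
next
  case (Suc k)
  have "restrict_field (scaling_shift p \<sigma> f) = gen_shift (- \<i> * \<sigma>) (restrict_field f)"
    for f :: "real \<times> (real^'n) \<Rightarrow> complex^'m"
  proof
    fix z
    show "restrict_field (scaling_shift p \<sigma> f) z = gen_shift (- \<i> * \<sigma>) (restrict_field f) z"
    proof (cases "z \<in> kasner_space")
      case True
      have "partial \<mu> (restrict_field f) z = partial \<mu> f z" for \<mu>
        by (rule partial_cong[OF _ True]) (simp add: restrict_field_def)
      then show ?thesis using True
        by (simp add: restrict_field_def gen_shift_def generator_def scaling_shift_def scaling_field_def
            cscale_fun_def vec_eq_iff)
    qed (simp add: restrict_field_def gen_shift_def generator_def cscale_fun_def)
  qed
  then show ?case using Suc by simp
qed

text \<open>With \<open>\<mu> = - \<i> \<sigma>\<close> the operator \<open>T + \<i> \<sigma>\<close> is \<open>T - \<mu>\<close>, and \<open>Re \<mu> = Im \<sigma>\<close>.\<close>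

lemma mode_solution_iff:
  "mode_solution p P \<sigma> k u \<longleftrightarrow> restrict_field u \<in> solutions \<and> (gen_shift (- \<i> * \<sigma>) ^^ k) (restrict_field u) = 0"
proof -
  have "smooth_on kasner_space (restrict_field u) \<longleftrightarrow> smooth_on kasner_space u"
    by (rule smooth_on_cong[OF open_kasner_space]) (simp add: restrict_field_def)
  moreover have "P (restrict_field u) z = P u z" if "smooth_on kasner_space u" "z \<in> kasner_space" for z
    by (rule P_cong[symmetric, OF that(1) _ that(2)]) (simp add: restrict_field_def)
  ultimately have "restrict_field u \<in> solutions \<longleftrightarrow> smooth_on kasner_space u \<and> (\<forall>z\<in>kasner_space. P u z = 0)"
    unfolding solutions_def by (auto simp: restrict_field_def)
  moreover have "(\<forall>z\<in>kasner_space. f z = 0) \<longleftrightarrow> restrict_field f = 0" for f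
    by (auto simp: restrict_field_def fun_eq_iff)
  ultimately show ?thesis
    unfolding mode_solution_def scaling_shift_funpow[symmetric] by blast
qed

lemma mode_space_eq:
  "mode_space p P \<sigma> = {u \<in> solutions. \<exists>k. (gen_shift (- \<i> * \<sigma>) ^^ k) u = 0}"
proof -
  have "restrict_field u = u" if "\<forall>z. z \<notin> kasner_space \<longrightarrow> u z = 0" for u
    using that by (auto simp: restrict_field_def fun_eq_iff)
  then show ?thesis
    unfolding mode_space_def mode_solution_iff by (force simp: solutions_def)
qed

lemma modes_above_line:
  "\<exists>(d::nat) v l.
    (\<forall>u \<sigma> k. u \<in> solutions \<longrightarrow> (gen_shift (- \<i> * \<sigma>) ^^ k) u = 0 \<longrightarrow> - \<alpha> \<le> Im \<sigma> \<longrightarrow> u \<in> cfun.span (v ` {..<d})) \<and>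
    (\<forall>u \<sigma> k. u \<in> solutions \<longrightarrow> u \<noteq> 0 \<longrightarrow> (gen_shift (- \<i> * \<sigma>) ^^ k) u = 0 \<longrightarrow> - \<alpha> \<le> Im \<sigma>
       \<longrightarrow> - \<i> * \<sigma> \<in> l ` {..<d})"
proof -
  obtain N D where "bounded_flags cscale_fun solutions (generator p) (hermitian N) \<alpha> D"
    using bounded_flags_solutions by blast
  then interpret F: bounded_flags cscale_fun solutions "generator p" "hermitian N" \<alpha> D .
  have sh: "F.shift = gen_shift" by (simp add: fun_eq_iff F.shift_def gen_shift_def)
  have re: "Re (- \<i> * \<sigma>) = Im \<sigma>" for \<sigma> by simp
  from F.maximal_flag[unfolded sh] show ?thesis unfolding re[symmetric] by (elim ex_forward conj_forward) blast+
qed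

lemma finite_dim_mode_space: "finite_dim_cspace (mode_space p P \<sigma>)"
proof -
  obtain N D where "bounded_flags cscale_fun solutions (generator p) (hermitian N) \<bar>Im \<sigma>\<bar> D"
    using bounded_flags_solutions by blast
  then interpret F: bounded_flags cscale_fun solutions "generator p" "hermitian N" "\<bar>Im \<sigma>\<bar>" D .
  have sh: "F.shift = gen_shift" by (simp add: fun_eq_iff F.shift_def gen_shift_def)
  let ?s = "gen_shift (- \<i> * \<sigma>)"
  have more: "(?s ^^ (j + k)) u = 0" if "(?s ^^ k) u = 0" for j k u
    using that F.shift_funpow_zero[of j "- \<i> * \<sigma>"] by (simp add: funpow_add sh)
  have "cfun.subspace (mode_space p P \<sigma>)"
    unfolding mode_space_eq cfun.subspace_def
  proof (intro conjI ballI allI)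
    show "0 \<in> {u \<in> solutions. \<exists>k. (?s ^^ k) u = 0}"
      using cfun.subspace_0[OF subspace_solutions] by (auto intro: exI[of _ 0])
    fix u w assume u: "u \<in> {u \<in> solutions. \<exists>k. (?s ^^ k) u = 0}" and w: "w \<in> {u \<in> solutions. \<exists>k. (?s ^^ k) u = 0}"
    then obtain j k where "(?s ^^ j) u = 0" "(?s ^^ k) w = 0" by blast
    then have "(?s ^^ (j + k)) u = 0" "(?s ^^ (j + k)) w = 0"
      using more[of j u k] more[of k w j] by (simp_all add: add.commute)
    then have "(?s ^^ (j + k)) (u + w) = 0"
      using u w F.shift_funpow_add[of u w "j + k" "- \<i> * \<sigma>"] by (simp add: sh)
    then show "u + w \<in> {u \<in> solutions. \<exists>k. (?s ^^ k) u = 0}"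
      using u w cfun.subspace_add[OF subspace_solutions] by blast
  next
    fix c u assume u: "u \<in> {u \<in> solutions. \<exists>k. (?s ^^ k) u = 0}"
    then obtain k where "(?s ^^ k) u = 0" by blast
    then have "(?s ^^ k) (cscale_fun c u) = 0"
      using u F.shift_funpow_scale[of u k "- \<i> * \<sigma>" c] by (simp add: sh)
    then show "cscale_fun c u \<in> {u \<in> solutions. \<exists>k. (?s ^^ k) u = 0}"
      using u cfun.subspace_scale[OF subspace_solutions] by blast
  qed
  moreover obtain d :: nat and v where
    v: "\<forall>u \<sigma>' k. u \<in> solutions \<longrightarrow> (gen_shift (- \<i> * \<sigma>') ^^ k) u = 0 \<longrightarrow> - \<bar>Im \<sigma>\<bar> \<le> Im \<sigma>' \<longrightarrow> u \<in> cfun.span (v ` {..<d})"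
    using modes_above_line[of "\<bar>Im \<sigma>\<bar>"] by (elim exE conjE) (rule that)
  have "- \<bar>Im \<sigma>\<bar> \<le> Im \<sigma>" by simp
  with v have "mode_space p P \<sigma> \<subseteq> cfun.span (v ` {..<d})"
    unfolding mode_space_eq by blast
  ultimately show ?thesis unfolding finite_dim_cspace_def by (meson finite_imageI finite_lessThan)
qed

definition mode_spectrum :: "complex set" where
  "mode_spectrum = {\<sigma>. \<exists>u k. mode_solution p P \<sigma> k u \<and> (\<exists>z\<in>kasner_space. u z \<noteq> 0)}"

lemma finite_mode_spectrum: "finite {\<sigma> \<in> mode_spectrum. - \<alpha> \<le> Im \<sigma>}"
proof -
  obtain d :: nat and l where
    l: "\<forall>u \<sigma> k. u \<in> solutions \<longrightarrow> u \<noteq> 0 \<longrightarrow> (gen_shift (- \<i> * \<sigma>) ^^ k) u = 0 \<longrightarrow> - \<alpha> \<le> Im \<sigma>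
       \<longrightarrow> - \<i> * \<sigma> \<in> l ` {..<d}"
    using modes_above_line[of \<alpha>] by (elim exE conjE) (rule that)
  have "{\<sigma> \<in> mode_spectrum. - \<alpha> \<le> Im \<sigma>} \<subseteq> (\<lambda>\<mu>. \<i> * \<mu>) ` l ` {..<d}"
  proof
    fix \<sigma> assume "\<sigma> \<in> {\<sigma> \<in> mode_spectrum. - \<alpha> \<le> Im \<sigma>}"
    then obtain u k z where u: "mode_solution p P \<sigma> k u" "z \<in> kasner_space" "u z \<noteq> 0" "- \<alpha> \<le> Im \<sigma>"
      by (auto simp: mode_spectrum_def)
    have "restrict_field u z \<noteq> 0" using u by (simp add: restrict_field_def)
    then have "restrict_field u \<noteq> 0" by auto
    then have "- \<i> * \<sigma> \<in> l ` {..<d}" using l u(1,4) by (auto simp: mode_solution_iff)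
    moreover have "\<sigma> = \<i> * (- \<i> * \<sigma>)" by simp
    ultimately show "\<sigma> \<in> (\<lambda>\<mu>. \<i> * \<mu>) ` l ` {..<d}" by blast
  qed
  then show ?thesis by (rule finite_subset) simp
qed

end

lemma discrete_if_finite_above_lines:
  fixes X :: "complex set"
  assumes "\<And>\<alpha>. finite {\<sigma> \<in> X. - \<alpha> \<le> Im \<sigma>}"
  shows "discrete X"
proof (rule discreteI)
  fix x assume x: "x \<in> X"
  let ?F = "{\<sigma> \<in> X. - (1 - Im x) \<le> Im \<sigma>} - {x}"
  let ?T = "{\<sigma>. Im x - 1 < Im \<sigma>} - ?F"
  have "open ?T"
    by (intro open_Diff open_halfspace_Im_gt finite_imp_closed finite_Diff assms)
  moreover have "?T \<inter> X = {x}" using x by auto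
  ultimately show "x isolated_in X" using x unfolding isolated_in_def by blast
qed

theorem theorem1p12:
  fixes p :: "real^'n"
    and P :: "(real \<times> (real^'n) \<Rightarrow> complex^'m) \<Rightarrow> (real \<times> (real^'n) \<Rightarrow> complex^'m)"
  assumes "\<forall>j. p $ j < 1"
    and "linear_wave_operator p P"
    and "\<forall>u. smooth_on kasner_space u \<longrightarrow>
           (\<forall>z\<in>kasner_space. op_commutator (scaling_field p) (t_squared P) u z = 0)"
  shows "\<exists>\<sigma>s :: nat \<Rightarrow> complex.
           discrete (range \<sigma>s) \<and>
           (\<forall>\<alpha>::real. \<alpha> > 0 \<longrightarrow> finite {\<sigma> \<in> range \<sigma>s. Im \<sigma> \<ge> - \<alpha>}) \<and>
           (\<forall>u \<sigma> k. mode_solution p P \<sigma> k u \<and> (\<exists>z\<in>kasner_space. u z \<noteq> 0)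
              \<longrightarrow> (\<exists>j. \<sigma> = \<sigma>s j)) \<and>
           (\<forall>\<sigma>. finite_dim_cspace (mode_space p P \<sigma>))"
proof -
  obtain A B C where "\<forall>\<mu>. smooth_on kasner_space (B \<mu>)" "smooth_on kasner_space C"
    "\<forall>z\<in>kasner_space. \<forall>\<xi>. principal_symbol2 A z \<xi> = dual_metric p z \<xi> \<xi> *\<^sub>R mat 1"
    "\<forall>u. smooth_on kasner_space u \<longrightarrow> (\<forall>z\<in>kasner_space.
           P u z = (\<Sum>\<mu>\<in>UNIV. \<Sum>\<nu>\<in>UNIV. A \<mu> \<nu> z *v partial \<mu> (partial \<nu> u) z)
                   + (\<Sum>\<mu>\<in>UNIV. B \<mu> z *v partial \<mu> u z) + C z *v u z)"
    using assms(2) unfolding linear_wave_operator_def by blast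
  then interpret kasner_wave_operator p P A B C
    using assms(1,3) by unfold_locales auto
  \<comment> \<open>Inserting \<open>0\<close> makes the set nonempty, so that it can be enumerated even if there are no modes.\<close>
  define X where "X = insert 0 mode_spectrum"
  have fin: "finite {\<sigma> \<in> X. - \<alpha> \<le> Im \<sigma>}" for \<alpha>
    by (rule finite_subset[of _ "insert 0 {\<sigma> \<in> mode_spectrum. - \<alpha> \<le> Im \<sigma>}"])
       (auto simp: X_def finite_mode_spectrum)
  have eq: "(\<Union>n. {\<sigma> \<in> X. - real n \<le> Im \<sigma>}) = X"
  proof -
    have "\<exists>n. - real n \<le> Im \<sigma>" for \<sigma>
      using real_arch_simple[of "- Im \<sigma>"] by (auto simp: minus_le_iff)
    then show ?thesis by auto
  qed
  have "countable (\<Union>n. {\<sigma> \<in> X. - real n \<le> Im \<sigma>})"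
    by (intro countable_UN countableI_type countable_finite fin)
  then have "countable X" unfolding eq .
  moreover have "X \<noteq> {}" by (simp add: X_def)
  ultimately have range: "range (from_nat_into X) = X" by (rule range_from_nat_into[rotated])
  show ?thesis
  proof (intro exI[of _ "from_nat_into X"] conjI allI impI)
    show "discrete (range (from_nat_into X))"
      unfolding range by (rule discrete_if_finite_above_lines[OF fin])
    show "finite {\<sigma> \<in> range (from_nat_into X). Im \<sigma> \<ge> - \<alpha>}" for \<alpha>
      unfolding range by (rule fin)
    show "\<exists>j. \<sigma> = from_nat_into X j"
      if "mode_solution p P \<sigma> k u \<and> (\<exists>z\<in>kasner_space. u z \<noteq> 0)" for u \<sigma> k
    proof -
      have "\<sigma> \<in> mode_spectrum" unfolding mode_spectrum_def using that by blast
      then have "\<sigma> \<in> range (from_nat_into X)" unfolding range by (simp add: X_def)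
      then show ?thesis by blast
    qed
    show "finite_dim_cspace (mode_space p P \<sigma>)" for \<sigma> by (rule finite_dim_mode_space)
  qed
qed

end
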